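(* Let $K$ be a field, $S=K[x_1,\ldots,x_n]$, and let $I\subset S$, $I\neq S$, be a monomial ideal, minimally generated by $m$ monomials. Let $k=\max\{|P| : P\in \operatorname{Ass}(S/I)\}$ and let $s\geq k$ be an integer. Then: (1) If $m\leq s-1+\left\lceil \frac{s}{k-1} \right\rceil$, then $\operatorname{sdepth}_S(S/I)\geq n-s$. (2) If $m\leq 2s-3 + \left\lceil \frac{2s-2}{k-1} \right\rceil$, then $\operatorname{sdepth}_S(I)\geq n-s+1$. If $\operatorname{depth}_S(S/I)=n-s$, then (1) and (2) imply the Stanley Conjecture for $S/I$, respectively for $I$; that is, under the numerical hypothesis of (1) one has $\operatorname{depth}_S(S/I)\le \operatorname{sdepth}_S(S/I)$, and under the numerical hypothesis of (2) one has $\operatorname{depth}_S(I)\le\operatorname{sdepth}_S(I)$.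
   Context: Every associated prime $P$ of $S/I$, for $I$ a monomial ideal, is generated by a subset of the variables; $|P|$ denotes the number of variables generating $P$. Let $M$ be a $\mathbb{Z}^n$-graded $S$-module. A Stanley decomposition of $M$ is a direct sum decomposition $\mathcal{D}: M=\bigoplus_{i=1}^r m_iK[Z_i]$ as a $K$-vector space, where $m_i\in M$ and $Z_i\subset\{x_1,\ldots,x_n\}$ are such that $m_iK[Z_i]$ is a free $K[Z_i]$-module. Put $\operatorname{sdepth}(\mathcal{D})=\min_{i=1}^r|Z_i|$, and define the Stanley depth $\operatorname{sdepth}_S(M)=\max\{\operatorname{sdepth}(\mathcal{D}) : \mathcal{D}\text{ is a Stanley decomposition of }M\}$. Here $\operatorname{depth}_S(M)$ is the usual depth with respect to the maximal ideal $(x_1,\ldots,x_n)$. The Stanley Conjecture for $M$ is the inequality $\operatorname{depth}_S(M)\le\operatorname{sdepth}_S(M)$. *)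

theory Defs
  imports
    "HOL-Algebra.Module"
    "HOL-Algebra.QuotRing"
    "HOL-Library.Poly_Mapping"
    "HOL-Library.Extended_Real"
    "HOL-Library.Cardinality"
begin

text \<open>
  The variables are indexed by a finite type \<open>'n\<close>, so \<open>n = CARD('n)\<close>. An exponent vector is an
  element of \<open>'n \<Rightarrow>\<^sub>0 nat\<close>, and \<open>S\<close> is the convolution ring of finitely supported functions from
  exponent vectors to \<open>K\<close>.
\<close>

type_synonym ('n, 'k) mpoly = "('n \<Rightarrow>\<^sub>0 nat) \<Rightarrow>\<^sub>0 'k"

type_synonym ('n, 'k, 'm) mpoly_module = "(('n, 'k) mpoly, 'm) module"

definition mpoly_ring :: "('n::finite, 'k::field) mpoly ring"  (\<open>\<S>\<close>)
  where "\<S> = \<lparr>carrier = UNIV, mult = (*), one = 1, zero = 0, add = (+)\<rparr>"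

definition monomial :: "('n::finite \<Rightarrow>\<^sub>0 nat) \<Rightarrow> ('n, 'k::field) mpoly"
  where "monomial a = Poly_Mapping.single a 1"

definition var :: "'n::finite \<Rightarrow> ('n, 'k::field) mpoly"
  where "var i = monomial (Poly_Mapping.single i 1)"

definition max_ideal :: "('n::finite, 'k::field) mpoly set"
  where "max_ideal = Idl\<^bsub>\<S>\<^esub> (range var)"

text \<open>The subring \<open>K[Z]\<close>, for a set \<open>Z\<close> of (indices of) variables.\<close>

definition subpoly :: "'n::finite set \<Rightarrow> ('n, 'k::field) mpoly set"
  where "subpoly Z = {f. \<forall>a\<in>Poly_Mapping.keys f. Poly_Mapping.keys a \<subseteq> Z}"

subsection \<open>Monomial ideals\<close>

definition monomial_ideal :: "('n::finite, 'k::field) mpoly set \<Rightarrow> bool"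
  where "monomial_ideal I \<longleftrightarrow> (\<exists>G \<subseteq> range monomial. I = Idl\<^bsub>\<S>\<^esub> G)"

definition minimal_monomial_generators ::
    "('n::finite, 'k::field) mpoly set \<Rightarrow> ('n, 'k) mpoly set \<Rightarrow> bool"
  where "minimal_monomial_generators I G \<longleftrightarrow>
    finite G \<and> G \<subseteq> range monomial \<and> I = Idl\<^bsub>\<S>\<^esub> G \<and> (\<forall>H. H \<subset> G \<longrightarrow> Idl\<^bsub>\<S>\<^esub> H \<noteq> I)"

subsection \<open>The modules \<open>I\<close> and \<open>S/I\<close>\<close>

text \<open>
  The \<open>mult\<close> and \<open>one\<close> fields of a \<open>module\<close> record are irrelevant to its module structure; in
  particular \<open>one\<close> need not lie in the carrier of \<open>ideal_module I\<close>.
\<close>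

definition ideal_module ::
    "('n::finite, 'k::field) mpoly set \<Rightarrow> ('n, 'k, ('n, 'k) mpoly) mpoly_module"
  where "ideal_module I =
    \<lparr>carrier = I, mult = (*), one = 1, zero = 0, add = (+), smult = (*)\<rparr>"

definition quot_module ::
    "('n::finite, 'k::field) mpoly set \<Rightarrow> ('n, 'k, ('n, 'k) mpoly set) mpoly_module"
  where "quot_module I =
    \<lparr>carrier = carrier (\<S> Quot I), mult = mult (\<S> Quot I), one = one (\<S> Quot I),
     zero = zero (\<S> Quot I), add = add (\<S> Quot I),
     smult = (\<lambda>f X. (I +>\<^bsub>\<S>\<^esub> f) \<otimes>\<^bsub>\<S> Quot I\<^esub> X)\<rparr>"

lemma cring_mpoly_ring: "cring (\<S> :: ('n::finite, 'k::field) mpoly ring)"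
proof (rule cringI)
  show "abelian_group (\<S> :: ('n, 'k) mpoly ring)"
    by (rule abelian_groupI) (auto simp: mpoly_ring_def algebra_simps intro: exI[of _ "- _"])
  show "Group.comm_monoid (\<S> :: ('n, 'k) mpoly ring)"
    by (rule comm_monoidI) (auto simp: mpoly_ring_def algebra_simps)
qed (auto simp: mpoly_ring_def algebra_simps)

lemma module_ideal_module:
  fixes I :: "('n::finite, 'k::field) mpoly set"
  assumes "ideal I \<S>"
  shows "Module.module \<S> (ideal_module I)"
proof -
  interpret ideal I "\<S> :: ('n, 'k) mpoly ring" by fact
  have mult: "f * g \<in> I" if "g \<in> I" for f g
    using I_l_closed[OF that, of f] by (simp add: mpoly_ring_def)
  have add: "f + g \<in> I" if "f \<in> I" "g \<in> I" for f g
    using additive_subgroup.a_closed[OF additive_subgroup_axioms that] by (simp add: mpoly_ring_def)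
  have zero: "0 \<in> I"
    using additive_subgroup.zero_closed[OF additive_subgroup_axioms] by (simp add: mpoly_ring_def)
  have neg: "- f \<in> I" if "f \<in> I" for f
    using mult[OF that, of "- 1"] by simp
  show ?thesis
  proof (rule moduleI)
    show "abelian_group (ideal_module I)"
      by (rule abelian_groupI)
        (auto simp: ideal_module_def algebra_simps add zero intro: bexI[OF _ neg])
  qed (auto simp: cring_mpoly_ring[unfolded mpoly_ring_def] ideal_module_def mult mpoly_ring_def algebra_simps)
qed

lemma module_quot_module:
  fixes I :: "('n::finite, 'k::field) mpoly set"
  assumes "ideal I \<S>"
  shows "Module.module \<S> (quot_module I)"
proof -
  interpret ideal I "\<S> :: ('n, 'k) mpoly ring" by fact
  interpret Q: cring "\<S> Quot I"
    by (rule quotient_is_cring[OF cring_mpoly_ring])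
  interpret h: ring_hom_ring \<S> "\<S> Quot I" "(+>\<^bsub>\<S>\<^esub>) I"
    by (rule rcos_ring_hom_ring)
  show ?thesis
  proof (rule moduleI)
    show "abelian_group (quot_module I)"
      by (rule abelian_groupI)
        (auto simp: quot_module_def Q.a_ac intro: Q.l_neg)
  qed (auto simp: cring_mpoly_ring quot_module_def Q.l_distr Q.r_distr Q.m_assoc)
qed

subsection \<open>Associated primes\<close>

definition associated_primes ::
    "('n::finite, 'k::field, 'm) mpoly_module \<Rightarrow> ('n, 'k) mpoly set set"
  where "associated_primes M =
    {P. primeideal P \<S> \<and> (\<exists>x\<in>carrier M. P = {f. f \<odot>\<^bsub>M\<^esub> x = \<zero>\<^bsub>M\<^esub>})}"

text \<open>
  \<open>|P|\<close>, for an ideal \<open>P\<close> generated by a (then unique) set \<open>V\<close> of variables.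
\<close>

definition num_vars :: "('n::finite, 'k::field) mpoly set \<Rightarrow> nat"
  where "num_vars P = card (THE V. P = Idl\<^bsub>\<S>\<^esub> (var ` V))"

subsection \<open>Depth\<close>

text \<open>The submodule \<open>(f\<^sub>1, \<dots>, f\<^sub>t)M\<close>.\<close>

definition ideal_smult ::
    "('n::finite, 'k::field) mpoly list \<Rightarrow> ('n, 'k, 'm) mpoly_module \<Rightarrow> 'm set"
  where "ideal_smult fs M =
    {\<Oplus>\<^bsub>M\<^esub>i\<in>{..<length fs}. (fs ! i) \<odot>\<^bsub>M\<^esub> y i | y. y \<in> {..<length fs} \<rightarrow> carrier M}"

text \<open>
  The middle clause says that \<open>f\<^sub>i\<close> is a nonzerodivisor on \<open>M/(f\<^sub>1, \<dots>, f\<^bsub>i-1\<^esub>)M\<close>, the last one that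
  \<open>M/(f\<^sub>1, \<dots>, f\<^sub>t)M \<noteq> 0\<close>.
\<close>

definition regular_sequence ::
    "('n::finite, 'k::field, 'm) mpoly_module \<Rightarrow> ('n, 'k) mpoly list \<Rightarrow> bool"
  where "regular_sequence M fs \<longleftrightarrow>
    (\<forall>i<length fs. \<forall>x\<in>carrier M.
      (fs ! i) \<odot>\<^bsub>M\<^esub> x \<in> ideal_smult (take i fs) M \<longrightarrow> x \<in> ideal_smult (take i fs) M) \<and>
    ideal_smult fs M \<noteq> carrier M"

text \<open>
  For a nonzero finitely generated graded module the set of lengths is nonempty and bounded by \<open>n\<close>,
  so the maximum exists.
\<close>

definition depth :: "('n::finite, 'k::field, 'm) mpoly_module \<Rightarrow> nat"
  where "depth M = Max {length fs | fs. set fs \<subseteq> max_ideal \<and> regular_sequence M fs}"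

subsection \<open>Stanley depth\<close>

text \<open>The \<open>K\<close>-subspace \<open>mK[Z]\<close> of \<open>M\<close>.\<close>

definition stanley_space ::
    "('n::finite, 'k::field, 'm) mpoly_module \<Rightarrow> 'm \<times> 'n set \<Rightarrow> 'm set"
  where "stanley_space M = (\<lambda>(m, Z). {f \<odot>\<^bsub>M\<^esub> m | f. f \<in> subpoly Z})"

text \<open>
  A decomposition is the list of its pairs \<open>(m\<^sub>i, Z\<^sub>i)\<close>. The second clause says that \<open>m\<^sub>iK[Z\<^sub>i]\<close> is free
  over \<open>K[Z\<^sub>i]\<close> with basis \<open>m\<^sub>i\<close>, the third that \<open>M\<close> is the direct sum of the subspaces \<open>m\<^sub>iK[Z\<^sub>i]\<close>.
\<close>

definition stanley_decomposition ::
    "('n::finite, 'k::field, 'm) mpoly_module \<Rightarrow> ('m \<times> 'n set) list \<Rightarrow> bool"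
  where "stanley_decomposition M D \<longleftrightarrow>
    (\<forall>(m, Z)\<in>set D. m \<in> carrier M) \<and>
    (\<forall>(m, Z)\<in>set D. \<forall>f\<in>subpoly Z. f \<odot>\<^bsub>M\<^esub> m = \<zero>\<^bsub>M\<^esub> \<longrightarrow> f = 0) \<and>
    (\<forall>x\<in>carrier M. \<exists>!y. y \<in> (\<Pi>\<^sub>E i\<in>{..<length D}. stanley_space M (D ! i)) \<and>
      x = (\<Oplus>\<^bsub>M\<^esub>i\<in>{..<length D}. y i))"

definition sdepth_decomposition :: "('m \<times> 'n::finite set) list \<Rightarrow> nat"
  where "sdepth_decomposition D = Min {card Z | m Z. (m, Z) \<in> set D}"

text \<open>
  A decomposition of a nonzero module is nonempty, hence has Stanley depth at most \<open>n\<close>.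
\<close>

definition sdepth :: "('n::finite, 'k::field, 'm) mpoly_module \<Rightarrow> nat"
  where "sdepth M = Max {sdepth_decomposition D | D. stanley_decomposition M D}"

subsection \<open>The numerical bound\<close>

text \<open>
  \<open>\<lceil>a/b\<rceil>\<close>, read as \<open>\<infinity>\<close> for \<open>b = 0\<close>. The denominator \<open>k - 1\<close> vanishes exactly when \<open>I\<close> is a nonzero
  principal ideal; a bound by \<open>\<infinity>\<close> is then no restriction.
\<close>

definition ceil_quot :: "int \<Rightarrow> int \<Rightarrow> ereal"
  where "ceil_quot a b =
    (if b = 0 then \<infinity> else ereal (of_int \<lceil>real_of_int a / real_of_int b\<rceil>))"

end

theory Submission
  imports Defs "HOL-Library.Countable"
begin

text \<open>
  Write \<open>S/I\<close> and \<open>I\<close> in terms of exponent vectors and split off the \<open>x\<^sub>j\<close>-free part: \<open>I\<close> becomes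
  \<open>(I \<inter> K[x\<^sub>i : i \<noteq> j]) \<oplus> x\<^sub>j (I : x\<^sub>j)\<close>, and similarly for \<open>S/I\<close>. An associated prime has at most \<open>k\<close>
  variables and every generator involves one of them, so some \<open>x\<^sub>j\<close> divides at least \<open>m/k\<close> of the
  \<open>m\<close> generators. The first summand therefore has at most \<open>m - m/k\<close> generators, and the numerical
  hypotheses say exactly that the general bounds \<open>n - m\<close> for \<open>S/I\<close> and \<open>n - \<lfloor>m/2\<rfloor>\<close> for \<open>I\<close> suffice
  for it. The second summand is treated by induction, since the associated primes of \<open>I : x\<^sub>j\<close> are
  among those of \<open>I\<close>.

  The bound \<open>n - \<lfloor>m/2\<rfloor>\<close> for \<open>I\<close> comes from a partition of the nonempty subsets of a cycle of odd
  length \<open>M = 2p + 1\<close> into intervals \<open>[A, B]\<close> with at most \<open>p\<close> elements outside \<open>B\<close>. The monomials whose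
  set of dividing generators lies in \<open>[A, B]\<close> are the multiples of \<open>lcm(A)\<close> outside an ideal with at
  most \<open>p\<close> generators.

  The statement on \<open>depth I\<close> needs \<open>depth I \<le> depth S/I + 1\<close>. This is proved without homology: by prime
  avoidance one finds elements that are regular on several modules at once, which shows that the
  grade drops by at most one modulo any regular element and allows one to reduce the exact sequence
  \<open>0 \<rightarrow> I \<rightarrow> S \<rightarrow> S/I \<rightarrow> 0\<close> modulo a common regular element.
\<close>

section \<open>Cone partitions of sets of monomials\<close>

text \<open>Let \<open>m'\<close> be the number of generators free of \<open>x_j\<close>; the choice
  of \<open>x_j\<close> gives \<open>k m' <= (k - 1) m\<close>. For \<open>k >= 2\<close>, since
  \<open>\<lceil>y\<rceil> < y + 1\<close>, hypothesis (1) yields \<open>m < s + s/(k - 1)\<close>,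
  that is \<open>(k - 1) m < k s\<close>, hence \<open>m' < s\<close>; hypothesis (2) likewise
  yields \<open>m' < 2 s - 2\<close>, hence \<open>\<lfloor>m'/2\<rfloor> < s - 1\<close>. The
  strict inequality pays for the variable \<open>x_j\<close>, which is missing from the first
  summand. Generators are kept in a list that need not be minimal, so their number is unchanged in
  \<open>I : x_j\<close> and the numerical condition carries over; what drops is the total degree.
  Both \<open>depth\<close> and \<open>sdepth\<close> are maxima of sets of naturals, so these sets
  have to be bounded before anything can be said. For regular sequences the bound \<open>n\<close>
  comes from counting, in place of dimension theory: a longer sequence would produce too many
  linearly independent polynomials of small degree.\<close>

definition cone :: "('n \<Rightarrow>\<^sub>0 nat) \<Rightarrow> 'n set \<Rightarrow> ('n \<Rightarrow>\<^sub>0 nat) set"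
  where "cone a Z = {a + b | b. Poly_Mapping.keys b \<subseteq> Z}"

text \<open>\<open>cone a Z\<close> consists of the exponents of \<open>x^a K[Z]\<close>, and
  \<open>conic c X\<close> makes \<open>X\<close> a finite disjoint union of cones. The bound counts
  the variables missing from \<open>Z\<close>, so that passing to fewer variables is an additive
  cost and the final estimate is \<open>n - c\<close>.\<close>

inductive conic :: "nat \<Rightarrow> ('n \<Rightarrow>\<^sub>0 nat) set \<Rightarrow> bool" for c where
  conic_empty: "conic c {}"
| conic_insert: "conic c X \<Longrightarrow> cone a Z \<inter> X = {} \<Longrightarrow> card (- Z) \<le> c \<Longrightarrow> conic c (cone a Z \<union> X)"

lemma conic_cone: "card (- Z) \<le> c \<Longrightarrow> conic c (cone a Z)"
  using conic_insert[OF conic_empty, of a Z] by simp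

lemma conic_mono: "conic c X \<Longrightarrow> c \<le> d \<Longrightarrow> conic d X"
  by (induction rule: conic.induct) (auto intro: conic_empty conic_insert)

lemma conic_Un: "conic c X \<Longrightarrow> conic c Y \<Longrightarrow> X \<inter> Y = {} \<Longrightarrow> conic c (X \<union> Y)"
proof (induction rule: conic.induct)
  case (conic_insert X a Z)
  have "conic c (cone a Z \<union> (X \<union> Y))"
    using conic_insert by (intro conic.conic_insert) auto
  thus ?case by (simp add: Un_assoc)
qed auto

lemma cone_shift: "(+) d ` cone a Z = cone (d + a) Z"
  unfolding cone_def by (auto simp: add.assoc image_iff)

lemma conic_shift: "conic c X \<Longrightarrow> conic c ((+) d ` X)"
proof (induction rule: conic.induct)
  case (conic_insert X a Z)
  have "(+) d ` cone a Z \<inter> (+) d ` X = {}"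
    using conic_insert(2) by auto
  thus ?case
    using conic_insert by (simp add: image_Un cone_shift conic.conic_insert)
qed (simp add: conic_empty)

lemma conic_UN:
  assumes "finite J" "\<And>j. j \<in> J \<Longrightarrow> conic c (X j)"
    "\<And>i j. i \<in> J \<Longrightarrow> j \<in> J \<Longrightarrow> i \<noteq> j \<Longrightarrow> X i \<inter> X j = {}"
  shows "conic c (\<Union>j\<in>J. X j)"
  using assms
proof (induction J rule: finite_induct)
  case (insert j J)
  have "X j \<inter> (\<Union>i\<in>J. X i) = {}"
    using insert by fastforce
  thus ?case using insert by (simp add: conic_Un)
qed (simp add: conic_empty)

lemma cone_zero: "cone 0 V = {a. Poly_Mapping.keys a \<subseteq> V}"
  by (auto simp: cone_def)

section \<open>Divisibility of exponent vectors and the splitting at one variable\<close>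

definition exp_dvd :: "('n \<Rightarrow>\<^sub>0 nat) \<Rightarrow> ('n \<Rightarrow>\<^sub>0 nat) \<Rightarrow> bool"  (infix \<open>\<preceq>\<close> 50)
  where "g \<preceq> a \<longleftrightarrow> (\<forall>i. Poly_Mapping.lookup g i \<le> Poly_Mapping.lookup a i)"

lemma exp_dvd_iff: "g \<preceq> a \<longleftrightarrow> (\<exists>b. a = g + b)"
proof
  assume "g \<preceq> a"
  hence "a = g + (a - g)"
    by (intro poly_mapping_eqI) (simp add: lookup_add lookup_minus exp_dvd_def)
  thus "\<exists>b. a = g + b" ..
qed (auto simp: exp_dvd_def lookup_add)

lemma exp_dvd_refl: "a \<preceq> a" and exp_dvd_zero: "0 \<preceq> a"
  by (auto simp: exp_dvd_def)

lemma exp_dvd_add: "a \<preceq> a + b" "b \<preceq> a + b"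
  by (auto simp: exp_dvd_def lookup_add)

lemma exp_dvd_trans: "a \<preceq> b \<Longrightarrow> b \<preceq> c \<Longrightarrow> a \<preceq> c"
  by (meson exp_dvd_def le_trans)

lemma exp_dvd_diff_iff: "g - d \<preceq> a \<longleftrightarrow> g \<preceq> d + a"
  by (simp add: exp_dvd_def lookup_add lookup_minus le_diff_conv add.commute)

lemma keys_subset_iff: "Poly_Mapping.keys a \<subseteq> V \<longleftrightarrow> (\<forall>i. i \<notin> V \<longrightarrow> Poly_Mapping.lookup a i = 0)"
  by (auto simp: in_keys_iff)

definition multiples :: "('n \<Rightarrow>\<^sub>0 nat) list \<Rightarrow> ('n \<Rightarrow>\<^sub>0 nat) set"
  where "multiples G = {a. \<exists>g\<in>set G. g \<preceq> a}"

lemma multiples_diff: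
  "a \<in> multiples (map (\<lambda>g. g - d) G) \<longleftrightarrow> d + a \<in> multiples G"
  by (auto simp: multiples_def exp_dvd_diff_iff)

lemma multiples_add: "a \<in> multiples G \<Longrightarrow> a + b \<in> multiples G"
  unfolding multiples_def using exp_dvd_add exp_dvd_trans by blast

definition avoiding :: "'n \<Rightarrow> ('n \<Rightarrow>\<^sub>0 nat) list \<Rightarrow> ('n \<Rightarrow>\<^sub>0 nat) list"
  where "avoiding j G = filter (\<lambda>g. Poly_Mapping.lookup g j = 0) G"

lemma multiples_avoiding:
  assumes "Poly_Mapping.lookup a j = 0"
  shows "a \<in> multiples (avoiding j G) \<longleftrightarrow> a \<in> multiples G"
proof -
  have "Poly_Mapping.lookup g j = 0" if "g \<preceq> a" for g
    using that assms by (metis exp_dvd_def le_zero_eq)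
  thus ?thesis by (auto simp: multiples_def avoiding_def)
qed

text \<open>With \<open>V\<close> all variables, \<open>True\<close> gives the monomials in the
  ideal and \<open>False\<close> those outside it, a basis of the quotient. The Boolean lets both
  statements share one splitting and one induction.\<close>

definition part :: "bool \<Rightarrow> 'n set \<Rightarrow> ('n \<Rightarrow>\<^sub>0 nat) list \<Rightarrow> ('n \<Rightarrow>\<^sub>0 nat) set"
  where "part b V G = {a. Poly_Mapping.keys a \<subseteq> V \<and> (a \<in> multiples G \<longleftrightarrow> b)}"

text \<open>Vectors are sorted by whether their \<open>j\<close>-th exponent is zero. If it is, only
  generators free of \<open>x_j\<close> can divide them. Otherwise a factor \<open>x_j\<close> is
  removed, and \<open>g\<close> divides \<open>x_j b\<close> iff the truncated difference of
  \<open>g\<close> and \<open>x_j\<close> divides \<open>b\<close>; these differences generate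
  \<open>I : x_j\<close>.\<close>

lemma part_split:
  assumes j: "j \<in> V"
  shows "part b V G = part b (V - {j}) (avoiding j G) \<union>
      (+) (Poly_Mapping.single j 1) ` part b V (map (\<lambda>g. g - Poly_Mapping.single j 1) G)" (is "?L = ?A \<union> ?s ` ?B")
    and "part b (V - {j}) (avoiding j G) \<inter>
      (+) (Poly_Mapping.single j 1) ` part b V (map (\<lambda>g. g - Poly_Mapping.single j 1) G) = {}"
proof -
  let ?e = "Poly_Mapping.single j (1::nat)"
  have zero: "Poly_Mapping.lookup a j = 0" if "a \<in> ?A" for a
    using that by (auto simp: part_def keys_subset_iff)
  have 1: "a \<in> ?A \<longleftrightarrow> a \<in> ?L" if "Poly_Mapping.lookup a j = 0" for a
    using that multiples_avoiding[OF that, of G] by (auto simp: part_def keys_subset_iff)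
  have 2: "?e + a \<in> ?L \<longleftrightarrow> a \<in> ?B" for a
    using j by (auto simp: part_def keys_subset_iff multiples_diff lookup_add lookup_single when_def)
  have 3: "a = ?e + (a - ?e)" if "Poly_Mapping.lookup a j \<noteq> 0" for a
    using that by (intro poly_mapping_eqI) (auto simp: lookup_add lookup_minus lookup_single when_def)
  have "a \<in> ?L \<longleftrightarrow> a \<in> ?A \<union> ?s ` ?B" for a
  proof (cases "Poly_Mapping.lookup a j = 0")
    case True
    hence "a \<notin> ?s ` ?B" by (auto simp: lookup_add)
    thus ?thesis using 1[OF True] by (metis UnE UnI1)
  next
    case False
    hence "a \<notin> ?A" using zero by metis
    moreover have "a \<in> ?s ` ?B \<longleftrightarrow> a - ?e \<in> ?B"
    proof
      assume "a \<in> ?s ` ?B"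
      then obtain b where "b \<in> ?B" "a = ?e + b" by (rule imageE)
      thus "a - ?e \<in> ?B" by simp
    qed (rule image_eqI, rule 3[OF False])
    moreover have "a - ?e \<in> ?B \<longleftrightarrow> a \<in> ?L"
      using 2[of "a - ?e"] 3[OF False] by (simp only:)
    ultimately show ?thesis by (metis UnE UnI2)
  qed
  thus "?L = ?A \<union> ?s ` ?B" by blast
  show "?A \<inter> ?s ` ?B = {}"
    using zero by (fastforce simp: lookup_add)
qed

section \<open>The bound \<open>n - m\<close> for the quotient\<close>

definition deg :: "('n::finite \<Rightarrow>\<^sub>0 nat) \<Rightarrow> nat"
  where "deg a = (\<Sum>i\<in>UNIV. Poly_Mapping.lookup a i)"

lemma deg_diff_le: "deg (a - b) \<le> deg a"
  unfolding deg_def by (intro sum_mono) (simp add: lookup_minus)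

lemma deg_diff_single_less:
  assumes "Poly_Mapping.lookup a j \<noteq> 0"
  shows "deg (a - Poly_Mapping.single j 1) < deg a"
  unfolding deg_def using assms
  by (intro sum_strict_mono_ex1) (auto simp: lookup_minus lookup_single when_def intro!: bexI[of _ j])

lemma sum_list_deg_diff_less:
  assumes "g \<in> set G" "Poly_Mapping.lookup g j \<noteq> 0"
  shows "sum_list (map deg (map (\<lambda>g. g - Poly_Mapping.single j 1) G)) < sum_list (map deg G)"
  using assms
proof (induction G)
  case (Cons h G)
  show ?case
  proof (cases "g = h")
    case True
    have "sum_list (map deg (map (\<lambda>g. g - Poly_Mapping.single j 1) G)) \<le> sum_list (map deg G)"
      unfolding map_map by (intro sum_list_mono) (simp add: deg_diff_le)
    thus ?thesis using deg_diff_single_less[of g j] Cons.prems True by simp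
  next
    case False
    thus ?thesis using Cons deg_diff_le[of h] by (force intro!: add_le_less_mono)
  qed
qed simp

lemma length_avoiding_less:
  "g \<in> set G \<Longrightarrow> Poly_Mapping.lookup g j \<noteq> 0 \<Longrightarrow> length (avoiding j G) < length G"
  unfolding avoiding_def by (rule length_filter_less) auto

text \<open>Dividing by \<open>x_j\<close> does not change a generator free of \<open>x_j\<close>,
  so the shorter list has at most the total degree of the divided one.\<close>

lemma sum_list_deg_avoiding_less:
  assumes "g \<in> set G" "Poly_Mapping.lookup g j \<noteq> 0"
  shows "sum_list (map deg (avoiding j G)) < sum_list (map deg G)"
proof -
  have "sum_list (map deg (avoiding j G)) \<le> sum_list (map deg (map (\<lambda>g. g - Poly_Mapping.single j 1) G))"
    unfolding avoiding_def
  proof (induction G)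
    case (Cons h G)
    have "h - Poly_Mapping.single j 1 = h" if "Poly_Mapping.lookup h j = 0"
      using that by (intro poly_mapping_eqI) (auto simp: lookup_minus lookup_single when_def)
    thus ?case using Cons by auto
  qed simp
  with sum_list_deg_diff_less[OF assms] show ?thesis by linarith
qed

lemma keys_diff_single_subset:
  "Poly_Mapping.keys a \<subseteq> V \<Longrightarrow> Poly_Mapping.keys (a - b :: _ \<Rightarrow>\<^sub>0 nat) \<subseteq> V"
  by (auto simp: keys_subset_iff lookup_minus)

text \<open>Split at a variable that occurs in some generator. The first summand loses that variable
  but also at least one generator, so the bound does not grow; the second keeps both numbers and has
  smaller total degree. The recursion ends with no generators, where the part is one cone, or with
  the generator 1, where it is empty.\<close>

lemma conic_nonmultiples:
  fixes G :: "('n::finite \<Rightarrow>\<^sub>0 nat) list"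
  assumes "\<And>g. g \<in> set G \<Longrightarrow> Poly_Mapping.keys g \<subseteq> V"
  shows "conic (card (- V) + length G) (part False V G)"
  using assms
proof (induction "sum_list (map deg G)" arbitrary: V G rule: less_induct)
  case less
  show ?case
  proof (cases "\<exists>g\<in>set G. g \<noteq> 0")
    case True
    then obtain g j where g: "g \<in> set G" and gj: "Poly_Mapping.lookup g j \<noteq> 0"
      by (metis lookup_zero poly_mapping_eqI)
    have jV: "j \<in> V" using less.prems[OF g] gj by (auto simp: in_keys_iff)
    have "conic (card (- (V - {j})) + length (avoiding j G)) (part False (V - {j}) (avoiding j G))"
      by (rule less.hyps[OF sum_list_deg_avoiding_less[OF g gj]])
        (use less.prems in \<open>auto simp: avoiding_def in_keys_iff\<close>)
    moreover have "card (- (V - {j})) = Suc (card (- V))"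
    proof -
      have "- (V - {j}) = insert j (- V)" by auto
      thus ?thesis using jV by simp
    qed
    ultimately have 1: "conic (card (- V) + length G) (part False (V - {j}) (avoiding j G))"
      using length_avoiding_less[OF g gj] by (elim conic_mono) auto
    have "conic (card (- V) + length (map (\<lambda>g. g - Poly_Mapping.single j 1) G))
        (part False V (map (\<lambda>g. g - Poly_Mapping.single j 1) G))"
      by (rule less.hyps[OF sum_list_deg_diff_less[OF g gj]])
        (use less.prems keys_diff_single_subset in \<open>force simp del: One_nat_def\<close>)
    hence 2: "conic (card (- V) + length G) ((+) (Poly_Mapping.single j 1) `
        part False V (map (\<lambda>g. g - Poly_Mapping.single j 1) G))"
      by (intro conic_shift) simp
    show ?thesis
      unfolding part_split(1)[OF jV, of False G]
      by (rule conic_Un[OF 1 2 part_split(2)[OF jV]])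
  next
    case False
    show ?thesis
    proof (cases G)
      case Nil
      have "part False V G = cone 0 V"
        by (auto simp: part_def Nil multiples_def cone_zero)
      thus ?thesis by (simp add: conic_cone)
    next
      case (Cons g G')
      hence "part False V G = {}"
        using False by (auto simp: part_def multiples_def exp_dvd_zero)
      thus ?thesis by (simp add: conic_empty)
    qed
  qed
qed

text \<open>
  Fix a nonempty subset \<open>X\<close> of the cycle \<open>{..<M}\<close> and go once around the cycle. In each run of
  non-elements of \<open>X\<close>, mark the first, the third, the fifth one and so on. A marked position together
  with its successor forms a tile of length 2. The positions outside these tiles lie in \<open>X\<close>, and
  membership in \<open>X\<close> is arbitrary at the second position of a tile.
\<close>

primrec mark :: "(nat \<Rightarrow> bool) \<Rightarrow> nat \<Rightarrow> bool" where
  "mark p 0 = False"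
| "mark p (Suc r) = (\<not> p (Suc r) \<and> \<not> mark p r)"

text \<open>\<open>Q\<close> is the set of first positions of tiles, described by a local rule
  around the cycle that refers to no starting point.\<close>

definition tiling :: "nat \<Rightarrow> nat set \<Rightarrow> nat set \<Rightarrow> bool"
  where "tiling M X Q \<longleftrightarrow> Q \<subseteq> {..<M} \<and>
    (\<forall>j<M. Suc j mod M \<in> Q \<longleftrightarrow> Suc j mod M \<notin> X \<and> j \<notin> Q)"

text \<open>Elements of \<open>X\<close> are never marked, so the marking is periodic from
  \<open>x\<close> on. \<open>Q\<close> is read off the second turn, positions \<open>M\<close> to
  \<open>2 M - 1\<close>, where the arbitrary start value at 0 no longer matters.\<close>

lemma ex_tiling:
  assumes X: "x \<in> X" "x < M"
  shows "\<exists>Q. tiling M X Q"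
proof -
  let ?p = "\<lambda>r. r mod M \<in> X"
  let ?q = "mark ?p"
  have no_mark: "\<not> ?q r" if "?p r" for r
    using that by (cases r) simp_all
  have x: "\<not> ?q x" "\<not> ?q (x + M)"
    using X by (simp_all add: no_mark)
  have per: "?q (x + r + M) = ?q (x + r)" for r
  proof (induction r)
    case (Suc r)
    have "Suc (x + r + M) mod M = Suc (x + r) mod M"
      by (metis add_Suc mod_add_self2)
    thus ?case using Suc by simp
  qed (use x in auto)
  have per': "?q (r + M) = ?q r" if "x \<le> r" for r
    using per[of "r - x"] that by simp
  have 1: "Suc j mod M \<in> {j. j < M \<and> ?q (j + M)} \<longleftrightarrow> Suc j mod M \<notin> X \<and> j \<notin> {j. j < M \<and> ?q (j + M)}"
    if "j < M" for j
  proof (cases "Suc j = M")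
    case True
    have "?q M = (\<not> ?p M \<and> \<not> ?q j)"
      using True by auto
    moreover have "?q (j + M) = ?q j"
      using per'[of j] X True by simp
    ultimately show ?thesis using True that by simp
  next
    case False
    moreover have "Suc (j + M) mod M = Suc j mod M" by (metis add_Suc mod_add_self2)
    ultimately show ?thesis using that by simp
  qed
  show ?thesis
    by (rule exI[of _ "{j. j < M \<and> ?q (j + M)}"]) (use 1 in \<open>auto simp: tiling_def\<close>)
qed

text \<open>By the local rule \<open>x\<close> lies in neither \<open>Q\<close> nor
  \<open>R\<close>; from there the rule carries the agreement once around the cycle.\<close>

lemma tiling_unique:
  assumes "tiling M X Q" "tiling M X R" and X: "x \<in> X" "x < M"
  shows "Q = R"
proof -
  have M: "M > 0" using X by simp
  have "(x + r) mod M \<in> Q \<longleftrightarrow> (x + r) mod M \<in> R" for r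
  proof (induction r)
    case 0
    have pred: "Suc ((x + M - 1) mod M) mod M = x" "(x + M - 1) mod M < M"
      using X M by (simp_all add: mod_Suc_eq)
    show ?case
      using assms pred unfolding tiling_def by (metis add.right_neutral mod_less)
  next
    case (Suc r)
    have "Suc ((x + r) mod M) mod M = (x + Suc r) mod M" "(x + r) mod M < M"
      using M by (simp_all add: mod_Suc_eq)
    thus ?case using assms Suc unfolding tiling_def by metis
  qed
  note * = this
  have "j \<in> Q \<longleftrightarrow> j \<in> R" if "j < M" for j
    using *[of "j + M - x"] that X by simp
  thus ?thesis
    using assms unfolding tiling_def by blast
qed

lemma inj_on_Suc_mod: "inj_on (\<lambda>j. Suc j mod M) {..<M}"
  by (auto simp: inj_on_def mod_Suc split: if_splits)

lemma surj_Suc_mod: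
  assumes "j < M"
  obtains i where "i < M" "j = Suc i mod M"
  using assms by (intro that[of "(j + M - 1) mod M"]) (auto simp: mod_Suc_eq)

text \<open>The successor of a marked position is unmarked and successors are distinct, so the tiles
  are disjoint pairs of positions.\<close>

lemma tiling_card:
  assumes "tiling M X Q"
  shows "2 * card Q \<le> M" "2 * card Q = card (Q \<union> (\<lambda>j. Suc j mod M) ` Q)"
proof -
  let ?s = "\<lambda>j. Suc j mod M"
  have Q: "Q \<subseteq> {..<M}" and fin: "finite Q"
    using assms finite_subset unfolding tiling_def by auto
  have "card (?s ` Q) = card Q"
    using inj_on_subset[OF inj_on_Suc_mod Q] by (rule card_image)
  moreover have "Q \<inter> ?s ` Q = {}" using assms by (auto simp: tiling_def)
  ultimately show 2: "2 * card Q = card (Q \<union> ?s ` Q)"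
    using fin by (simp add: card_Un_disjoint)
  have "card (Q \<union> ?s ` Q) \<le> card {..<M}" using Q by (intro card_mono) auto
  thus "2 * card Q \<le> M" using 2 by simp
qed

text \<open>
  So the sets with a given tiling form an interval. Its lower end is nonempty because tiles of length
  2 cannot cover a cycle of odd length.
\<close>

lemma tiling_interval:
  assumes "odd M" and Q: "tiling M X Q" and Y: "Y \<subseteq> {..<M}"
  shows "Y \<noteq> {} \<and> tiling M Y Q \<longleftrightarrow>
    (\<forall>j<M. j \<notin> Q \<and> Suc j mod M \<notin> Q \<longrightarrow> Suc j mod M \<in> Y) \<and> Y \<inter> Q = {}" (is "?L \<longleftrightarrow> ?R")
proof
  assume L: ?L
  have "j \<notin> Y" if j: "j \<in> Q" for j
  proof -
    have "j < M" using Q j by (auto simp: tiling_def)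
    then obtain i where "i < M" "j = Suc i mod M" by (rule surj_Suc_mod)
    thus ?thesis using L j by (auto simp: tiling_def)
  qed
  thus ?R using L by (auto simp: tiling_def)
next
  assume R: ?R
  have "Y \<noteq> {}"
  proof
    assume "Y = {}"
    hence "{..<M} \<subseteq> Q \<union> (\<lambda>j. Suc j mod M) ` Q"
      using R by (auto elim: surj_Suc_mod)
    moreover have "Q \<union> (\<lambda>j. Suc j mod M) ` Q \<subseteq> {..<M}"
      using Q by (auto simp: tiling_def)
    ultimately have "Q \<union> (\<lambda>j. Suc j mod M) ` Q = {..<M}" by blast
    hence "2 * card Q = M" using tiling_card(2)[OF Q] by simp
    thus False using \<open>odd M\<close> by (metis dvd_triv_left)
  qed
  moreover have "tiling M Y Q"
    using R Q by (auto simp: tiling_def)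
  ultimately show ?L by blast
qed

lemma exp_lcm:
  fixes A :: "nat set" and g :: "nat \<Rightarrow> 'n \<Rightarrow>\<^sub>0 nat"
  assumes "finite A" "\<And>i. i \<in> A \<Longrightarrow> Poly_Mapping.keys (g i) \<subseteq> V"
  shows "\<exists>l. Poly_Mapping.keys l \<subseteq> V \<and> (\<forall>a. (\<forall>i\<in>A. g i \<preceq> a) \<longleftrightarrow> l \<preceq> a)"
  using assms
proof (induction A rule: finite_induct)
  case empty
  show ?case by (rule exI[of _ 0]) (simp add: exp_dvd_zero)
next
  case (insert j A)
  then obtain l where l: "Poly_Mapping.keys l \<subseteq> V" "\<And>a. (\<forall>i\<in>A. g i \<preceq> a) \<longleftrightarrow> l \<preceq> a"
    by auto
  \<comment> \<open>With truncated subtraction, \<open>l + (g j - l)\<close> is the componentwise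
    maximum, the exponent of the least common multiple.\<close>
  have "l + (g j - l) \<preceq> a \<longleftrightarrow> g j \<preceq> a \<and> l \<preceq> a" for a
  proof -
    have "m + (n - m) \<le> k \<longleftrightarrow> n \<le> k \<and> m \<le> k" for m n k :: nat
      by arith
    thus ?thesis by (simp add: exp_dvd_def lookup_add lookup_minus) blast
  qed
  moreover have "Poly_Mapping.keys (l + (g j - l)) \<subseteq> V"
    using l(1) insert.prems[of j] by (auto simp: keys_subset_iff lookup_add lookup_minus)
  ultimately show ?case
    using l(2) by (intro exI[of _ "l + (g j - l)"]) auto
qed

lemma conic_multiples:
  fixes G :: "('n::finite \<Rightarrow>\<^sub>0 nat) list"
  assumes G: "\<And>g. g \<in> set G \<Longrightarrow> Poly_Mapping.keys g \<subseteq> V"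
  shows "conic (card (- V) + length G div 2) (part True V G)"
proof -
  \<comment> \<open>\<open>M\<close> is the odd one of \<open>length G\<close> and
    \<open>length G + 1\<close>. In the second case the additional index stands for no generator and
    belongs to no set \<open>T a\<close>.\<close>
  define M where "M = Suc (2 * (length G div 2))"
  have M: "odd M" "length G \<le> M" by (auto simp: M_def)
  define T where "T a = {i. i < length G \<and> G ! i \<preceq> a}" for a
  have T: "T a \<subseteq> {..<M}" for a using M by (auto simp: T_def)
  have mult: "a \<in> multiples G \<longleftrightarrow> T a \<noteq> {}" for a
    unfolding multiples_def T_def by (auto simp: in_set_conv_nth) (metis in_set_conv_nth)
  define J where "J = {Q. \<exists>X\<subseteq>{..<M}. X \<noteq> {} \<and> tiling M X Q}"
  define W where "W Q = {a. Poly_Mapping.keys a \<subseteq> V \<and> T a \<noteq> {} \<and> tiling M (T a) Q}" for Q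
  have fin: "finite J"
    by (rule finite_subset[of _ "Pow {..<M}"]) (auto simp: J_def tiling_def)
  have disj: "W Q \<inter> W R = {}" if "Q \<noteq> R" for Q R
    using that tiling_unique T by (fastforce simp: W_def)
  have "a \<in> (\<Union>Q\<in>J. W Q)" if a: "a \<in> part True V G" for a
  proof -
    have "T a \<noteq> {}" using a by (simp add: part_def mult)
    then obtain x where "x \<in> T a" "x < M" using T by fast
    then obtain Q where "tiling M (T a) Q" using ex_tiling by blast
    moreover from this have "Q \<in> J" using T \<open>T a \<noteq> {}\<close> unfolding J_def by blast
    ultimately show ?thesis using a \<open>T a \<noteq> {}\<close> by (auto simp: W_def part_def)
  qed
  moreover have "W Q \<subseteq> part True V G" for Q
    by (auto simp: W_def part_def mult)
  ultimately have eq: "part True V G = (\<Union>Q\<in>J. W Q)" by blast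
  have "conic (card (- V) + length G div 2) (W Q)" if Q: "Q \<in> J" for Q
  proof -
    obtain X where X: "tiling M X Q" using Q unfolding J_def by blast
    \<comment> \<open>The positions outside all tiles form the lower end of the interval; its upper
      end is the complement of \<open>Q\<close>.\<close>
    define A where "A = {i. \<exists>j<M. i = Suc j mod M \<and> j \<notin> Q \<and> i \<notin> Q}"
    have W: "a \<in> W Q \<longleftrightarrow> Poly_Mapping.keys a \<subseteq> V \<and> A \<subseteq> T a \<and> T a \<inter> Q = {}" for a
      using tiling_interval[OF M(1) X T[of a]] by (auto simp: W_def A_def)
    show ?thesis
    proof (cases "A \<subseteq> {..<length G}")
      \<comment> \<open>The lower end contains the additional index, so no monomial has its divisor
        set in this interval.\<close>
      case False
      hence "W Q = {}" using W by (auto simp: T_def)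
      thus ?thesis by (simp add: conic_empty)
    next
      case True
      hence "finite A" using finite_subset by blast
      moreover have "Poly_Mapping.keys (G ! i) \<subseteq> V" if "i \<in> A" for i
        using that True G by (meson lessThan_iff nth_mem subsetD)
      ultimately have "\<exists>l. Poly_Mapping.keys l \<subseteq> V \<and> (\<forall>a. (\<forall>i\<in>A. G ! i \<preceq> a) \<longleftrightarrow> l \<preceq> a)"
        by (rule exp_lcm)
      then obtain l where l: "Poly_Mapping.keys l \<subseteq> V" "\<And>a. (\<forall>i\<in>A. G ! i \<preceq> a) \<longleftrightarrow> l \<preceq> a"
        by blast
      \<comment> \<open>After division by \<open>l\<close>, each marked index of a generator
        contributes one generator to be avoided. There is at most one per tile, hence at most
        \<open>length G div 2\<close> in all.\<close>
      define H where "H = map (\<lambda>i. G ! i - l) (filter (\<lambda>i. i < length G) (sorted_list_of_set Q))"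
      have finQ: "finite Q" using X finite_subset by (auto simp: tiling_def)
      have "l + b \<in> W Q \<longleftrightarrow> b \<in> part False V H" for b
      proof -
        have "A \<subseteq> T (l + b)"
          using l(2)[of "l + b"] True exp_dvd_add(1)[of l b] by (auto simp: T_def)
        moreover have "T (l + b) \<inter> Q = {} \<longleftrightarrow> b \<notin> multiples H"
          using finQ by (auto simp: T_def H_def multiples_def exp_dvd_diff_iff)
        moreover have "Poly_Mapping.keys (l + b) \<subseteq> V \<longleftrightarrow> Poly_Mapping.keys b \<subseteq> V"
          using l(1) by (auto simp: keys_subset_iff lookup_add)
        ultimately show ?thesis by (simp add: W part_def)
      qed
      moreover have "\<exists>b. a = l + b" if "a \<in> W Q" for a
        using that l(2)[of a] True unfolding W by (auto simp: T_def simp flip: exp_dvd_iff)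
      ultimately have WQ: "W Q = (+) l ` part False V H" by blast
      have "length H \<le> card Q"
        using length_filter_le[of _ "sorted_list_of_set Q"] by (simp add: H_def)
      also have "card Q \<le> length G div 2"
        using tiling_card(1)[OF X] by (simp add: M_def)
      finally have "length H \<le> length G div 2" .
      moreover have "conic (card (- V) + length H) (part False V H)"
        using G by (intro conic_nonmultiples) (auto simp: H_def in_keys_iff keys_subset_iff lookup_minus)
      ultimately show ?thesis
        unfolding WQ by (intro conic_shift) (rule conic_mono, auto)
    qed
  qed
  thus ?thesis
    unfolding eq using fin disj by (intro conic_UN) auto
qed

lemma conic_part:
  fixes G :: "('n::finite \<Rightarrow>\<^sub>0 nat) list"
  assumes "\<And>g. g \<in> set G \<Longrightarrow> Poly_Mapping.keys g \<subseteq> V"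
  shows "conic (card (- V) + (if b then length G div 2 else length G)) (part b V G)"
  using conic_multiples[OF assms] conic_nonmultiples[OF assms] by (cases b) simp_all

text \<open>Says on monomials that \<open>I : x^u\<close> is the prime generated by the variables in
  \<open>V\<close>, which makes this prime associated to \<open>S/I\<close>.\<close>

definition colon_support :: "('n \<Rightarrow>\<^sub>0 nat) list \<Rightarrow> ('n \<Rightarrow>\<^sub>0 nat) \<Rightarrow> 'n set \<Rightarrow> bool"
  where "colon_support G u V \<longleftrightarrow>
    (\<forall>a. u + a \<in> multiples G \<longleftrightarrow> (\<exists>i\<in>V. Poly_Mapping.lookup a i \<noteq> 0))"

lemma finite_bounded_exponents:
  "finite {u :: 'n::finite \<Rightarrow>\<^sub>0 nat. \<forall>i. Poly_Mapping.lookup u i \<le> N}" (is "finite ?U")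
proof (rule finite_imageD)
  have "Poly_Mapping.lookup ` ?U \<subseteq> PiE UNIV (\<lambda>_. {..N})"
    by auto
  thus "finite (Poly_Mapping.lookup ` ?U)"
    by (rule finite_subset) (simp add: finite_PiE)
qed (auto simp: inj_on_def poly_mapping_eqI)

text \<open>A monomial of maximal degree among those outside the ideal whose exponents are bounded by
  those of the generators has a prime annihilator.\<close>

lemma ex_colon_support:
  fixes G :: "('n::finite \<Rightarrow>\<^sub>0 nat) list"
  assumes "0 \<notin> multiples G"
  shows "\<exists>u V. colon_support G u V"
proof -
  define N where "N = sum_list (map deg G)"
  define U where "U = {u. (\<forall>i. Poly_Mapping.lookup u i \<le> N) \<and> u \<notin> multiples G}"
  have N: "Poly_Mapping.lookup g i \<le> N" if "g \<in> set G" for g i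
  proof -
    have "Poly_Mapping.lookup g i \<le> deg g" unfolding deg_def by (rule member_le_sum) auto
    also have "\<dots> \<le> N" unfolding N_def using that by (intro member_le_sum_list) auto
    finally show ?thesis .
  qed
  have fin: "finite (deg ` U)" and "0 \<in> U"
    using finite_bounded_exponents[of N] assms by (auto simp: U_def intro: finite_subset)
  hence "Max (deg ` U) \<in> deg ` U" by (intro Max_in) auto
  then obtain u where u: "u \<in> U" "deg u = Max (deg ` U)" by auto
  have max: "deg v \<le> deg u" if "v \<in> U" for v
    using that fin u by simp
  let ?e = "\<lambda>i. Poly_Mapping.single i (1::nat)"
  define V where "V = {i. u + ?e i \<in> multiples G}"
  have "u + a \<in> multiples G \<longleftrightarrow> (\<exists>i\<in>V. Poly_Mapping.lookup a i \<noteq> 0)" for a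
  proof
    assume "\<exists>i\<in>V. Poly_Mapping.lookup a i \<noteq> 0"
    then obtain i where i: "i \<in> V" "Poly_Mapping.lookup a i \<noteq> 0" by blast
    hence "a = ?e i + (a - ?e i)"
      by (intro poly_mapping_eqI) (auto simp: lookup_add lookup_minus lookup_single when_def)
    hence "u + a = (u + ?e i) + (a - ?e i)" by (metis add.assoc)
    thus "u + a \<in> multiples G" using i(1) by (simp add: V_def multiples_add)
  next
    assume "u + a \<in> multiples G"
    then obtain g where g: "g \<in> set G" "g \<preceq> u + a" by (auto simp: multiples_def)
    show "\<exists>i\<in>V. Poly_Mapping.lookup a i \<noteq> 0"
    proof (rule ccontr)
      assume *: "\<not> ?thesis"
      have "Poly_Mapping.lookup g i \<le> Poly_Mapping.lookup u i" for i
      proof (cases "Poly_Mapping.lookup a i = 0")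
        case True
        thus ?thesis using g(2) unfolding exp_dvd_def by (metis add.right_neutral lookup_add)
      next
        case False
        hence "i \<notin> V" using * by blast
        moreover have "deg (u + ?e i) = deg u + 1"
          by (simp add: deg_def lookup_add sum.distrib lookup_single when_def)
        \<comment> \<open>By maximality of the degree \<open>u + ?e i\<close> leaves
          \<open>U\<close>, yet it is not in the ideal, so it must violate the bound
          \<open>N\<close>. Hence the exponent of \<open>u\<close> at \<open>i\<close> is already
          \<open>N\<close>, no smaller than that of any generator.\<close>
        ultimately have "u + ?e i \<notin> U" "u + ?e i \<notin> multiples G"
          using max[of "u + ?e i"] by (auto simp: V_def)
        then obtain l where "Poly_Mapping.lookup (u + ?e i) l > N"
          by (auto simp: U_def not_le)
        moreover have "Poly_Mapping.lookup u l \<le> N" for l using u(1) by (simp add: U_def)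
        ultimately have "Poly_Mapping.lookup u i = N"
          by (auto simp: lookup_add lookup_single when_def split: if_splits)
             (metis Suc_leI antisym less_Suc_eq_le not_less)+
        thus ?thesis using N[OF g(1)] by simp
      qed
      hence "u \<in> multiples G" using g(1) by (auto simp: multiples_def exp_dvd_def)
      thus False using u(1) by (simp add: U_def)
    qed
  qed
  thus ?thesis unfolding colon_support_def by blast
qed

text \<open>For a generator \<open>g\<close> the vector \<open>u + g\<close> is a multiple, so
  \<open>g\<close> involves \<open>V\<close>; the estimate is the pigeonhole bound
  \<open>m - m/k\<close> cleared of its denominator. The generator involving \<open>x_j\<close> is
  what makes the total degree drop later.\<close>

lemma ex_frequent_variable:
  fixes G :: "('n::finite \<Rightarrow>\<^sub>0 nat) list"
  assumes u: "colon_support G u V" and V: "card V \<le> k" and "G \<noteq> []"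
  shows "\<exists>j\<in>V. \<exists>g\<in>set G. Poly_Mapping.lookup g j \<noteq> 0 \<and>
    k * length (avoiding j G) \<le> (k - 1) * length G"
proof -
  define hits where "hits j = length (filter (\<lambda>g. Poly_Mapping.lookup g j \<noteq> 0) G)" for j
  have G: "\<exists>i\<in>V. Poly_Mapping.lookup g i \<noteq> 0" if "g \<in> set G" for g
    using u that exp_dvd_add(2)[of g u] unfolding colon_support_def multiples_def by blast
  have "length G \<le> (\<Sum>j\<in>V. length (filter (\<lambda>g. Poly_Mapping.lookup g j \<noteq> 0) G))"
    using G
  proof (induction G)
    case (Cons g G)
    obtain i where i: "i \<in> V" "Poly_Mapping.lookup g i \<noteq> 0" using Cons.prems by auto
    have "(\<Sum>j\<in>V. length (filter (\<lambda>g. Poly_Mapping.lookup g j \<noteq> 0) (g # G))) =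
        (\<Sum>j\<in>V. (if Poly_Mapping.lookup g j \<noteq> 0 then 1 else 0)) +
        (\<Sum>j\<in>V. length (filter (\<lambda>g. Poly_Mapping.lookup g j \<noteq> 0) G))"
      by (subst sum.distrib[symmetric], intro sum.cong) auto
    moreover have "(1::nat) \<le> (\<Sum>j\<in>V. (if Poly_Mapping.lookup g j \<noteq> 0 then 1 else 0))"
      using member_le_sum[of i V "\<lambda>j. if Poly_Mapping.lookup g j \<noteq> 0 then 1 else (0::nat)"] i by simp
    moreover have "length G \<le> (\<Sum>j\<in>V. length (filter (\<lambda>g. Poly_Mapping.lookup g j \<noteq> 0) G))"
      using Cons by simp
    ultimately show ?case by (simp only: list.size)
  qed simp
  hence hits: "length G \<le> (\<Sum>j\<in>V. hits j)" by (simp only: hits_def)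
  have "\<exists>j\<in>V. length G \<le> k * hits j"
  proof (rule ccontr)
    assume *: "\<not> ?thesis"
    have "V \<noteq> {}" using G \<open>G \<noteq> []\<close> by (metis empty_iff last_in_set)
    have "k * (\<Sum>j\<in>V. hits j) < (\<Sum>j\<in>V. length G)"
      unfolding sum_distrib_left using * \<open>V \<noteq> {}\<close> by (intro sum_strict_mono) auto
    also have "\<dots> \<le> k * length G" using V by simp
    finally show False using hits mult_le_mono2[OF hits, of k] by linarith
  qed
  then obtain j where j: "j \<in> V" "length G \<le> k * hits j" by blast
  have "hits j \<noteq> 0" using j(2) \<open>G \<noteq> []\<close> by (intro notI) simp
  hence "\<exists>g\<in>set G. Poly_Mapping.lookup g j \<noteq> 0"
    by (auto simp: hits_def filter_empty_conv)
  moreover have "hits j + length (avoiding j G) = length G"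
    using sum_length_filter_compl[of "\<lambda>g. Poly_Mapping.lookup g j \<noteq> 0" G]
    by (simp add: hits_def avoiding_def)
  hence "k * hits j + k * length (avoiding j G) = k * length G"
    by (metis distrib_left)
  hence "k * length (avoiding j G) \<le> (k - 1) * length G"
    using j(2) by (simp add: diff_mult_distrib)
  ultimately show ?thesis using j(1) by blast
qed

text \<open>In the hypothesis on \<open>c\<close>, \<open>m\<close> is the number of generators free
  of \<open>x_j\<close>, and \<open>Suc\<close> accounts for \<open>x_j\<close> itself. With no such
  generator the ideal summand is empty and costs nothing, whence the alternative
  \<open>m = 0\<close>. A colon support of the divided list at \<open>v\<close> is one of
  \<open>G\<close> at \<open>x_j\<close> times \<open>v\<close>, so \<open>k\<close> remains a
  bound.\<close>

lemma conic_of_colon_supports: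
  fixes G :: "('n::finite \<Rightarrow>\<^sub>0 nat) list"
  assumes k: "\<And>u V. colon_support G u V \<Longrightarrow> card V \<le> k"
    and c: "\<And>m. k * m \<le> (k - 1) * length G \<Longrightarrow>
      m = 0 \<and> b \<or> Suc (if b then m div 2 else m) \<le> c"
  shows "conic c (part b UNIV G)"
  using assms
proof (induction "sum_list (map deg G)" arbitrary: G rule: less_induct)
  case less
  show ?case
  proof (cases "G = [] \<or> 0 \<in> multiples G")
    case True
    have "x \<in> multiples G \<longleftrightarrow> G \<noteq> []" for x
      using True multiples_add[of 0 G x] by (auto simp: multiples_def)
    hence "part b UNIV G = {} \<or> part b UNIV G = cone 0 UNIV"
      by (cases "G = []"; cases b) (auto simp: part_def cone_zero)
    thus ?thesis by (auto simp: conic_empty conic_cone)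
  next
    case False
    then obtain u V where u: "colon_support G u V" using ex_colon_support by blast
    then obtain j g where g: "g \<in> set G" "Poly_Mapping.lookup g j \<noteq> 0"
      and j: "k * length (avoiding j G) \<le> (k - 1) * length G"
      using ex_frequent_variable[OF u less.prems(1)[OF u]] False by blast
    have 1: "conic c (part b (UNIV - {j}) (avoiding j G))"
      using less.prems(2)[OF j]
    proof
      assume "length (avoiding j G) = 0 \<and> b"
      hence "part b (UNIV - {j}) (avoiding j G) = {}" by (simp add: part_def multiples_def)
      thus ?thesis by (simp add: conic_empty)
    next
      assume "Suc (if b then length (avoiding j G) div 2 else length (avoiding j G)) \<le> c"
      moreover have "card (- (UNIV - {j})) = 1" by (simp add: Compl_Diff_eq)
      moreover have "conic (card (- (UNIV - {j})) +
          (if b then length (avoiding j G) div 2 else length (avoiding j G)))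
          (part b (UNIV - {j}) (avoiding j G))"
        by (intro conic_part) (auto simp: avoiding_def in_keys_iff)
      ultimately show ?thesis by (elim conic_mono) simp
    qed
    let ?G = "map (\<lambda>g. g - Poly_Mapping.single j 1) G"
    have "conic c (part b UNIV ?G)"
    proof (rule less.hyps[OF sum_list_deg_diff_less[OF g]])
      show "card W \<le> k" if "colon_support ?G v W" for v W
      proof (rule less.prems(1))
        show "colon_support G (Poly_Mapping.single j 1 + v) W"
          using that unfolding colon_support_def multiples_diff add.assoc .
      qed
    qed (use less.prems(2) in simp)
    hence 2: "conic c ((+) (Poly_Mapping.single j 1) ` part b UNIV ?G)"
      by (rule conic_shift)
    show ?thesis
      unfolding part_split(1)[OF UNIV_I, of b G j]
      by (rule conic_Un[OF 1 2 part_split(2)[OF UNIV_I]])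
  qed
qed

section \<open>Grade over a Noetherian ring\<close>

text \<open>The ring as a module over itself: \<open>idl.subspace\<close> means ideal, and
  \<open>idl.span\<close> is the ideal generated by a set.\<close>

interpretation idl: Modules.module "(*) :: 'a::comm_ring_1 \<Rightarrow> 'a \<Rightarrow> 'a"
  by unfold_locales (simp_all add: algebra_simps)

declare idl.scale_scale [simp del]  \<comment> \<open>loops with \<open>mult.assoc\<close>\<close>

text \<open>A module of the form \<open>A/B\<close>, for ideals \<open>B \<subseteq> A\<close>, is represented by the pair of \<open>A\<close> and \<open>B\<close>.\<close>

definition regular_on :: "'a::comm_ring_1 set \<Rightarrow> 'a set \<Rightarrow> 'a \<Rightarrow> bool"
  where "regular_on A B f \<longleftrightarrow> (\<forall>x\<in>A. f * x \<in> B \<longrightarrow> x \<in> B)"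

text \<open>The ideal \<open>B + fA\<close>. Thus \<open>(A/B)/f(A/B)\<close> is again a pair, with
  the same \<open>A\<close>, and reduction modulo an element only enlarges the denominator.\<close>

definition adjoin :: "'a::comm_ring_1 set \<Rightarrow> 'a \<Rightarrow> 'a set \<Rightarrow> 'a set"
  where "adjoin A f B = {b + f * a | a b. a \<in> A \<and> b \<in> B}"

definition annihilator :: "'a::comm_ring_1 set \<Rightarrow> 'a \<Rightarrow> 'a set"
  where "annihilator B a = {r. r * a \<in> B}"

definition prime_set :: "'a::comm_ring_1 set \<Rightarrow> bool"
  where "prime_set P \<longleftrightarrow> idl.subspace P \<and> 1 \<notin> P \<and> (\<forall>a b. a * b \<in> P \<longrightarrow> a \<in> P \<or> b \<in> P)"

text \<open>Existence of a regular sequence of length \<open>t\<close> in \<open>\<mm>\<close> on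
  \<open>A/B\<close>, leaving open whether the last quotient vanishes. For \<open>S/I\<close> its
  non-vanishing is recovered at the end from \<open>1 \<notin> \<mm>\<close>.\<close>

primrec grade_ge :: "'a::comm_ring_1 set \<Rightarrow> 'a set \<Rightarrow> nat \<Rightarrow> 'a set \<Rightarrow> bool" where
  "grade_ge \<mm> A 0 B = True"
| "grade_ge \<mm> A (Suc t) B = (\<exists>f\<in>\<mm>. regular_on A B f \<and> grade_ge \<mm> A t (adjoin A f B))"

lemma ideal_mult: "idl.subspace B \<Longrightarrow> b \<in> B \<Longrightarrow> r * b \<in> B" "idl.subspace B \<Longrightarrow> b \<in> B \<Longrightarrow> b * r \<in> B"
  using idl.subspace_scale[of B b r] by (simp_all add: mult.commute)

lemma adjoinI: "a \<in> A \<Longrightarrow> b \<in> B \<Longrightarrow> b + f * a \<in> adjoin A f B"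
  by (auto simp: adjoin_def)

lemma adjoinE:
  assumes "x \<in> adjoin A f B"
  obtains a b where "a \<in> A" "b \<in> B" "x = b + f * a"
  using assms by (auto simp: adjoin_def)

lemma subspace_adjoin:
  assumes "idl.subspace A" "idl.subspace B"
  shows "idl.subspace (adjoin A f B)"
proof (rule idl.subspaceI)
  show "0 \<in> adjoin A f B"
    using assms by (force simp: adjoin_def intro: idl.subspace_0)
next
  fix x y assume "x \<in> adjoin A f B" "y \<in> adjoin A f B"
  then obtain a b a' b' where *: "a \<in> A" "b \<in> B" "a' \<in> A" "b' \<in> B"
    "x = b + f * a" "y = b' + f * a'" by (metis adjoinE)
  have "(b + b') + f * (a + a') \<in> adjoin A f B"
    using * assms by (intro adjoinI idl.subspace_add)
  also have "(b + b') + f * (a + a') = x + y" using * by (simp add: algebra_simps)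
  finally show "x + y \<in> adjoin A f B" .
next
  fix c x assume "x \<in> adjoin A f B"
  then obtain a b where *: "a \<in> A" "b \<in> B" "x = b + f * a" by (rule adjoinE)
  have "c * b + f * (c * a) \<in> adjoin A f B"
    using * assms by (intro adjoinI idl.subspace_scale)
  also have "c * b + f * (c * a) = c * x" using * by (simp add: algebra_simps)
  finally show "c * x \<in> adjoin A f B" .
qed

lemma subspace_annihilator:
  assumes "idl.subspace B"
  shows "idl.subspace (annihilator B a)"
  using assms
  by (auto simp: annihilator_def idl.subspace_def distrib_right mult.assoc)

lemma adjoin_superset: "idl.subspace A \<Longrightarrow> B \<subseteq> adjoin A f B"
  by (force simp: adjoin_def intro: idl.subspace_0)

lemma adjoin_subset: "idl.subspace A \<Longrightarrow> B \<subseteq> A \<Longrightarrow> adjoin A f B \<subseteq> A"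
  by (auto simp: adjoin_def intro!: idl.subspace_add idl.subspace_scale)

lemma adjoin_commute: "adjoin A f (adjoin A g B) = adjoin A g (adjoin A f B)"
  by (auto simp: adjoin_def) (metis add.assoc add.commute)+

text \<open>Modulo \<open>B\<close>, let \<open>g x = h a\<close>. Regularity of \<open>h\<close>
  modulo \<open>g\<close> gives \<open>a = g a'\<close>, and cancelling \<open>g\<close> gives
  \<open>x = h a'\<close>.\<close>

lemma regular_on_swap:
  assumes A: "idl.subspace A" and B: "idl.subspace B" "B \<subseteq> A"
    and g: "regular_on A B g" and h: "regular_on A (adjoin A g B) h" "regular_on A B h"
  shows "regular_on A (adjoin A h B) g"
  unfolding regular_on_def
proof (intro ballI impI)
  fix x assume x: "x \<in> A" "g * x \<in> adjoin A h B"
  then obtain a b where ab: "a \<in> A" "b \<in> B" "g * x = b + h * a" by (auto elim: adjoinE)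
  have "- b + g * x \<in> adjoin A g B"
    using x ab B by (intro adjoinI idl.subspace_neg)
  hence "h * a \<in> adjoin A g B" using ab by simp
  hence "a \<in> adjoin A g B" using h ab by (auto simp: regular_on_def)
  then obtain a' b' where ab': "a' \<in> A" "b' \<in> B" "a = b' + g * a'" by (auto elim: adjoinE)
  have "g * (x - h * a') = b + h * b'" using ab ab' by (simp add: algebra_simps)
  hence "g * (x - h * a') \<in> B" using ab ab' B by (auto intro!: idl.subspace_add idl.subspace_scale)
  moreover have "x - h * a' \<in> A" using x ab' A by (auto intro!: idl.subspace_diff idl.subspace_scale)
  ultimately have "x - h * a' \<in> B" using g by (auto simp: regular_on_def)
  hence "(x - h * a') + h * a' \<in> adjoin A h B" using ab' by (intro adjoinI)
  thus "x \<in> adjoin A h B" by simp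
qed

lemma prime_set_INT_subset:
  assumes P: "prime_set P" and "finite J" and Q: "\<And>j. j \<in> J \<Longrightarrow> idl.subspace (Q j)"
    and sub: "(\<Inter>j\<in>J. Q j) \<subseteq> P"
  shows "\<exists>j\<in>J. Q j \<subseteq> P"
proof (rule ccontr)
  assume "\<not> ?thesis"
  hence "\<forall>j\<in>J. \<exists>q. q \<in> Q j \<and> q \<notin> P" by blast
  then obtain q where q: "\<And>j. j \<in> J \<Longrightarrow> q j \<in> Q j \<and> q j \<notin> P" by metis
  have "(\<Prod>j\<in>J'. q j) \<notin> P" if "finite J'" "J' \<subseteq> J" for J'
    using that
  proof (induction J' rule: finite_induct)
    case (insert j J')
    thus ?case using P q[of j] by (auto simp: prime_set_def)
  qed (use P in \<open>auto simp: prime_set_def\<close>)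
  moreover have "(\<Prod>j\<in>J. q j) \<in> Q j" if "j \<in> J" for j
    using that \<open>finite J\<close> q Q by (simp add: prod.remove ideal_mult)
  ultimately show False using sub \<open>finite J\<close> by blast
qed

text \<open>If the element \<open>h\<close> avoiding the earlier primes lies in the new prime
  \<open>P\<close>, it is corrected by some \<open>y\<close> in \<open>\<mm>\<close> and in all
  earlier primes but not in \<open>P\<close>. Such a \<open>y\<close> exists because in an antichain
  \<open>P\<close> contains none of the others.\<close>

lemma prime_avoidance_antichain:
  fixes \<mm> :: "'a::comm_ring_1 set"
  assumes "finite Ps" "idl.subspace \<mm>"
    and "\<And>P. P \<in> Ps \<Longrightarrow> prime_set P \<and> \<not> \<mm> \<subseteq> P"
    and "\<And>P Q. P \<in> Ps \<Longrightarrow> Q \<in> Ps \<Longrightarrow> P \<subseteq> Q \<Longrightarrow> P = Q"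
  shows "\<exists>h\<in>\<mm>. h \<notin> \<Union>Ps"
  using assms
proof (induction Ps rule: finite_induct)
  case empty
  thus ?case by (auto intro: idl.subspace_0)
next
  case (insert P Ps)
  then obtain h where h: "h \<in> \<mm>" "h \<notin> \<Union>Ps" by auto
  have P: "prime_set P" "\<not> \<mm> \<subseteq> P" using insert.prems by auto
  show ?case
  proof (cases "h \<in> P")
    case True
    have "\<not> (\<mm> \<inter> \<Inter>Ps \<subseteq> P)"
    proof
      assume "\<mm> \<inter> \<Inter>Ps \<subseteq> P"
      hence "\<exists>Q\<in>insert \<mm> Ps. id Q \<subseteq> P"
        using insert P by (intro prime_set_INT_subset) (auto simp: prime_set_def)
      thus False using P insert by auto
    qed
    then obtain y where y: "y \<in> \<mm>" "y \<in> \<Inter>Ps" "y \<notin> P" by blast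
    have "h + y \<notin> P"
      using P True y idl.subspace_diff[of P "h + y" h] by (auto simp: prime_set_def)
    moreover have "h + y \<notin> Q" if "Q \<in> Ps" for Q
      using h y that insert.prems(2)[of Q] idl.subspace_diff[of Q "h + y" y] by (auto simp: prime_set_def)
    moreover have "h + y \<in> \<mm>" using h y insert.prems(1) by (simp add: idl.subspace_add)
    ultimately show ?thesis by blast
  qed (use h in auto)
qed

lemma prime_avoidance:
  assumes "finite Ps" "idl.subspace \<mm>"
    and "\<And>P. P \<in> Ps \<Longrightarrow> prime_set P \<and> \<not> \<mm> \<subseteq> P"
  shows "\<exists>h\<in>\<mm>. h \<notin> \<Union>Ps"
proof -
  let ?Qs = "{P \<in> Ps. \<forall>Q\<in>Ps. P \<subseteq> Q \<longrightarrow> P = Q}"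
  have "\<exists>h\<in>\<mm>. h \<notin> \<Union>?Qs"
    by (rule prime_avoidance_antichain) (use assms in auto)
  moreover have "\<exists>Q\<in>?Qs. P \<subseteq> Q" if P: "P \<in> Ps" for P
    using finite_has_maximal2[OF assms(1) P] by auto
  ultimately show ?thesis by blast
qed

text \<open>The chain condition for sequences of elements: some member lies in the ideal generated
  by its predecessors. This form gives both maximal members of families of ideals and the finiteness
  of the set of maximal annihilators.\<close>

locale noetherian_ideal =
  fixes \<mm> :: "'a::comm_ring_1 set"
  assumes ideal_m: "idl.subspace \<mm>"
    and noetherian: "\<And>h :: nat \<Rightarrow> 'a. \<exists>i. h i \<in> idl.span (h ` {..<i})"
begin

lemma ex_maximal_ideal:
  fixes F :: "'a set set"
  assumes F: "\<And>P. P \<in> F \<Longrightarrow> idl.subspace P" and P: "P \<in> F"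
  shows "\<exists>Q\<in>F. P \<subseteq> Q \<and> (\<forall>R\<in>F. Q \<subseteq> R \<longrightarrow> R = Q)"
proof (rule ccontr)
  assume *: "\<not> ?thesis"
  have "\<exists>f. \<forall>n. (f n \<in> F \<and> P \<subseteq> f n) \<and> f n \<subset> f (Suc n)"
  proof (rule dependent_nat_choice)
    show "\<exists>Q. Q \<in> F \<and> P \<subseteq> Q" using P by blast
  next
    fix Q and n :: nat assume "Q \<in> F \<and> P \<subseteq> Q"
    moreover from this have "\<not> (\<forall>R\<in>F. Q \<subseteq> R \<longrightarrow> R = Q)" using * by blast
    ultimately show "\<exists>R. (R \<in> F \<and> P \<subseteq> R) \<and> Q \<subset> R" by blast
  qed
  then obtain f where f: "\<And>n. f n \<in> F" "\<And>n. f n \<subset> f (Suc n)" by blast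
  have mono: "f i \<subseteq> f j" if "i \<le> j" for i j
    by (rule lift_Suc_mono_le[of f]) (use f(2) that in auto)
  have "\<forall>n. \<exists>x. x \<in> f (Suc n) \<and> x \<notin> f n" using f(2) by blast
  then obtain h where h: "\<And>n. h n \<in> f (Suc n) \<and> h n \<notin> f n" by metis
  obtain i where "h i \<in> idl.span (h ` {..<i})" using noetherian[of h] ..
  moreover have "h ` {..<i} \<subseteq> f i" using h mono[OF Suc_leI] by blast
  hence "idl.span (h ` {..<i}) \<subseteq> f i" using F[OF f(1)] by (rule idl.span_minimal)
  ultimately show False using h by blast
qed

text \<open>The maximal associated primes of \<open>A/B\<close>; their union is the set of zero
  divisors on \<open>A/B\<close>.\<close>

definition max_annihilators :: "'a set \<Rightarrow> 'a set \<Rightarrow> 'a set set"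
  where "max_annihilators A B = {P \<in> annihilator B ` (A - B). \<forall>R\<in>annihilator B ` (A - B). P \<subseteq> R \<longrightarrow> R = P}"

context
  fixes A B :: "'a set"
  assumes A: "idl.subspace A" and B: "idl.subspace B"
begin

text \<open>If \<open>r s\<close> kills \<open>a\<close> and \<open>r\<close> does not, then
  \<open>r a\<close> is nonzero in \<open>A/B\<close> and its annihilator contains both
  \<open>P\<close> and \<open>s\<close>. By maximality it equals \<open>P\<close>.\<close>

lemma prime_max_annihilator:
  assumes P: "P \<in> max_annihilators A B"
  shows "prime_set P"
proof -
  obtain a where a: "a \<in> A" "a \<notin> B" "P = annihilator B a"
    using P by (auto simp: max_annihilators_def)
  have "s \<in> P" if rs: "r * s \<in> P" "r \<notin> P" for r s
  proof -
    have "r * a \<in> A - B" using rs a A by (auto simp: annihilator_def ideal_mult)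
    moreover have "P \<subseteq> annihilator B (r * a)"
    proof
      fix x assume "x \<in> P"
      hence "r * (x * a) \<in> B" using a B by (simp add: annihilator_def ideal_mult)
      thus "x \<in> annihilator B (r * a)" by (simp add: annihilator_def mult.left_commute)
    qed
    ultimately have "annihilator B (r * a) = P"
      using P unfolding max_annihilators_def by blast
    moreover have "s * (r * a) \<in> B" using rs(1) a(3) by (simp add: annihilator_def mult.assoc mult.left_commute)
    hence "s \<in> annihilator B (r * a)" by (simp add: annihilator_def)
    ultimately show ?thesis by (simp only:)
  qed
  thus ?thesis
    unfolding prime_set_def using a B subspace_annihilator by (auto simp: annihilator_def)
qed

lemma max_annihilator_superset:
  assumes "a \<in> A" "a \<notin> B"
  shows "\<exists>P\<in>max_annihilators A B. annihilator B a \<subseteq> P"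
  using ex_maximal_ideal[of "annihilator B ` (A - B)" "annihilator B a"] assms subspace_annihilator[OF B]
  by (auto simp: max_annihilators_def)

text \<open>Given infinitely many, with witnesses \<open>a i\<close>, some \<open>a i\<close> lies
  in the ideal generated by its predecessors. Whatever kills all of these kills \<open>a i\<close>,
  so \<open>P i\<close> contains the intersection of the earlier primes, hence one of them, against
  maximality and distinctness.\<close>

lemma finite_max_annihilators: "finite (max_annihilators A B)"
proof (rule ccontr)
  assume "infinite (max_annihilators A B)"
  then obtain P :: "nat \<Rightarrow> 'a set" where P: "inj P" "range P \<subseteq> max_annihilators A B"
    using infinite_countable_subset by blast
  hence "P i \<in> max_annihilators A B" for i by blast
  hence "\<forall>i. \<exists>a. P i = annihilator B a" unfolding max_annihilators_def by blast
  then obtain a where a: "\<And>i. P i = annihilator B (a i)" by metis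
  obtain i where i: "a i \<in> idl.span (a ` {..<i})" using noetherian[of a] ..
  have "(\<Inter>j\<in>{..<i}. P j) \<subseteq> P i"
  proof
    fix r assume r: "r \<in> (\<Inter>j\<in>{..<i}. P j)"
    have "idl.subspace {x. r * x \<in> B}"
      using subspace_annihilator[OF B, of r] by (simp add: annihilator_def mult.commute)
    moreover have "a ` {..<i} \<subseteq> {x. r * x \<in> B}"
      using r by (auto simp: a annihilator_def)
    ultimately have "a i \<in> {x. r * x \<in> B}" using i idl.span_minimal by blast
    thus "r \<in> P i" by (simp add: a annihilator_def)
  qed
  hence "\<exists>j\<in>{..<i}. P j \<subseteq> P i"
    using P(2) prime_max_annihilator
    by (intro prime_set_INT_subset) (auto simp: a subspace_annihilator[OF B])
  then obtain j where j: "j < i" "P j \<subseteq> P i" by blast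
  have "P j \<in> max_annihilators A B" "P i \<in> max_annihilators A B" using P(2) by auto
  hence "P i = P j" using j(2) unfolding max_annihilators_def by blast
  thus False using P(1) j(1) by (auto dest: injD)
qed

end

text \<open>By prime avoidance this amounts to the existence of a regular element in
  \<open>\<mm>\<close>. Stated without such an element, it can be transferred from one quotient to
  another.\<close>

definition socle_free :: "'a set \<Rightarrow> 'a set \<Rightarrow> bool"
  where "socle_free A B \<longleftrightarrow> (\<forall>x\<in>A. (\<forall>r\<in>\<mm>. r * x \<in> B) \<longrightarrow> x \<in> B)"

lemma socle_freeI_regular: "f \<in> \<mm> \<Longrightarrow> regular_on A B f \<Longrightarrow> socle_free A B"
  by (auto simp: socle_free_def regular_on_def)

lemma grade_ge_Suc_socle_free: "grade_ge \<mm> A (Suc t) B \<Longrightarrow> socle_free A B"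
  by (auto intro: socle_freeI_regular)

text \<open>Socle-freeness keeps \<open>\<mm>\<close> from being contained in any maximal
  annihilator. All modules together have finitely many of these, and an element of
  \<open>\<mm>\<close> outside all of them is regular on every module.\<close>

lemma ex_common_regular:
  assumes "finite J" and AB: "\<And>A B. (A, B) \<in> J \<Longrightarrow> idl.subspace A \<and> idl.subspace B \<and> socle_free A B"
  shows "\<exists>h\<in>\<mm>. \<forall>(A, B)\<in>J. regular_on A B h"
proof -
  let ?Ps = "\<Union>(A, B)\<in>J. max_annihilators A B"
  have "\<exists>h\<in>\<mm>. h \<notin> \<Union>?Ps"
  proof (rule prime_avoidance[OF _ ideal_m])
    show "finite ?Ps"
      using assms by (intro finite_UN_I) (auto intro: finite_max_annihilators)
  next
    fix P assume "P \<in> ?Ps"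
    then obtain A B where J: "(A, B) \<in> J" "P \<in> max_annihilators A B" by auto
    then obtain a where "a \<in> A" "a \<notin> B" "P = annihilator B a" by (auto simp: max_annihilators_def)
    hence "\<not> \<mm> \<subseteq> P" using AB[OF J(1)] by (auto simp: socle_free_def annihilator_def)
    thus "prime_set P \<and> \<not> \<mm> \<subseteq> P" using AB[OF J(1)] J(2) prime_max_annihilator by blast
  qed
  then obtain h where h: "h \<in> \<mm>" "h \<notin> \<Union>?Ps" by blast
  have "regular_on A B h" if J: "(A, B) \<in> J" for A B
    unfolding regular_on_def
  proof (intro ballI impI)
    fix x assume x: "x \<in> A" "h * x \<in> B"
    show "x \<in> B"
    proof (rule ccontr)
      assume "x \<notin> B"
      then obtain P where "P \<in> max_annihilators A B" "annihilator B x \<subseteq> P"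
        using max_annihilator_superset AB[OF J] x by blast
      thus False using h J x by (auto simp: annihilator_def)
    qed
  qed
  thus ?thesis using h(1) by blast
qed

text \<open>The elements killed by \<open>\<mm>\<close> modulo \<open>f\<close> and modulo
  \<open>g\<close> both form \<open>Ext^1(R/\<mm>, A/B)\<close>. Elementwise: if
  \<open>\<mm> x\<close> is zero modulo \<open>f\<close>, write \<open>g x = f y\<close>; cancelling
  \<open>f\<close> shows that \<open>\<mm> y\<close> is zero modulo \<open>g\<close>. So
  \<open>y = g w\<close>, and cancelling \<open>g\<close> gives \<open>x = f w\<close>.\<close>

lemma socle_free_adjoin:
  assumes A: "idl.subspace A" and B: "idl.subspace B" "B \<subseteq> A"
    and g: "regular_on A B g" "g \<in> \<mm>" and f: "regular_on A B f" "f \<in> \<mm>"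
    and s: "socle_free A (adjoin A g B)"
  shows "socle_free A (adjoin A f B)"
  unfolding socle_free_def
proof (intro ballI impI)
  fix x assume x: "x \<in> A" and m: "\<forall>r\<in>\<mm>. r * x \<in> adjoin A f B"
  obtain y b where y: "y \<in> A" "b \<in> B" "g * x = b + f * y" using bspec[OF m g(2)] by (rule adjoinE)
  have "r * y \<in> adjoin A g B" if r: "r \<in> \<mm>" for r
  proof -
    obtain z b' where z: "z \<in> A" "b' \<in> B" "r * x = b' + f * z" using bspec[OF m r] by (rule adjoinE)
    have "r * (g * x) = g * (r * x)" by (simp add: algebra_simps)
    hence "r * (b + f * y) = g * (b' + f * z)" using y z by simp
    hence "f * (r * y - g * z) = g * b' - r * b" by (simp add: algebra_simps)
    moreover have "g * b' - r * b \<in> B" using z y B by (simp add: idl.subspace_diff ideal_mult)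
    moreover have "r * y - g * z \<in> A" using z y A by (simp add: idl.subspace_diff ideal_mult)
    ultimately have "r * y - g * z \<in> B" using f by (simp add: regular_on_def)
    hence "(r * y - g * z) + g * z \<in> adjoin A g B" using z by (intro adjoinI)
    thus ?thesis by simp
  qed
  hence "y \<in> adjoin A g B" using s y by (simp add: socle_free_def)
  then obtain w b' where w: "w \<in> A" "b' \<in> B" "y = b' + g * w" by (auto elim: adjoinE)
  have "g * (x - f * w) = b + f * b'" using y w by (simp add: algebra_simps)
  moreover have "b + f * b' \<in> B" using y w B by (simp add: idl.subspace_add ideal_mult)
  moreover have "x - f * w \<in> A" using x w A by (simp add: idl.subspace_diff ideal_mult)
  ultimately have "x - f * w \<in> B" using g by (simp add: regular_on_def)
  hence "(x - f * w) + f * w \<in> adjoin A f B" using w by (intro adjoinI)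
  thus "x \<in> adjoin A f B" by simp
qed

text \<open>The elements \<open>g\<close> and \<open>f\<close> are linked by an \<open>h\<close>
  regular on \<open>A/B\<close> and modulo each of them. Induction takes out \<open>h\<close> after
  \<open>g\<close>, the pair \<open>g, h\<close> is swapped, induction takes out \<open>f\<close>
  after \<open>h\<close>, and \<open>h, f\<close> is swapped to \<open>f, h\<close>.\<close>

lemma grade_ge_adjoin:
  assumes A: "idl.subspace A" and "idl.subspace B" "B \<subseteq> A"
    and "grade_ge \<mm> A (Suc t) B" "f \<in> \<mm>" "regular_on A B f"
  shows "grade_ge \<mm> A t (adjoin A f B)"
  using assms(2-)
proof (induction t arbitrary: B f)
  case (Suc t)
  obtain g where g: "g \<in> \<mm>" "regular_on A B g" "grade_ge \<mm> A (Suc t) (adjoin A g B)"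
    using Suc.prems by auto
  have sg: "socle_free A (adjoin A g B)" using g by (blast dest: grade_ge_Suc_socle_free)
  hence sf: "socle_free A (adjoin A f B)"
    using A Suc.prems g by (intro socle_free_adjoin[of A B g f]) auto
  have sub: "idl.subspace (adjoin A x B)" "adjoin A x B \<subseteq> A" for x
    using A Suc.prems by (simp_all add: subspace_adjoin adjoin_subset)
  have "\<exists>h\<in>\<mm>. \<forall>(A, B)\<in>{(A, B), (A, adjoin A g B), (A, adjoin A f B)}. regular_on A B h"
    by (rule ex_common_regular)
      (use A Suc.prems sub sg sf socle_freeI_regular[OF g(1,2)] in auto)
  then obtain h where h: "h \<in> \<mm>" "regular_on A B h" "regular_on A (adjoin A g B) h"
    "regular_on A (adjoin A f B) h" by auto
  have "grade_ge \<mm> A t (adjoin A h (adjoin A g B))"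
    by (rule Suc.IH[OF sub g(3) h(1,3)])
  moreover have "regular_on A (adjoin A h B) g" "regular_on A (adjoin A h B) f"
    using regular_on_swap[OF A Suc.prems(1,2)] g h Suc.prems by blast+
  ultimately have "grade_ge \<mm> A (Suc t) (adjoin A h B)"
    using g(1) by (auto simp: adjoin_commute[of A h g])
  hence "grade_ge \<mm> A t (adjoin A f (adjoin A h B))"
    using Suc.IH[OF sub] \<open>regular_on A (adjoin A h B) f\<close> Suc.prems(4) by blast
  thus ?case using h by (auto simp: adjoin_commute[of A h f])
qed simp

text \<open>Invariance under the isomorphism \<open>N/(N \<inter> C) \<cong> (N + C)/C\<close>.\<close>

lemma grade_ge_second_iso:
  assumes N: "idl.subspace N" and "idl.subspace C" "idl.subspace B" and "N \<inter> C = B"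
    and "\<And>x. x \<in> N' \<longleftrightarrow> (\<exists>n\<in>N. \<exists>c\<in>C. x = n + c)" and "grade_ge \<mm> N t B"
  shows "grade_ge \<mm> N' t C"
  using assms(2-)
proof (induction t arbitrary: B C)
  case (Suc t)
  obtain f where f: "f \<in> \<mm>" "regular_on N B f" "grade_ge \<mm> N t (adjoin N f B)"
    using Suc.prems by auto
  have reg: "regular_on N' C f"
    unfolding regular_on_def
  proof (intro ballI impI)
    fix x assume x: "x \<in> N'" "f * x \<in> C"
    then obtain n c where n: "n \<in> N" "c \<in> C" "x = n + c" using Suc.prems by blast
    have "f * n = f * x - f * c" using n by (simp add: algebra_simps)
    hence "f * n \<in> C" using n x Suc.prems by (simp add: idl.subspace_diff ideal_mult)
    hence "f * n \<in> B" using n N Suc.prems by (auto simp: ideal_mult)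
    hence "n \<in> B" using f n by (simp add: regular_on_def)
    thus "x \<in> C" using n Suc.prems by (auto simp: idl.subspace_add)
  qed
  have eq: "adjoin N' f C = adjoin N f C"
  proof (rule subset_antisym; rule subsetI)
    fix x assume "x \<in> adjoin N' f C"
    then obtain y c where y: "y \<in> N'" "c \<in> C" "x = c + f * y" by (auto elim: adjoinE)
    then obtain n c' where n: "n \<in> N" "c' \<in> C" "y = n + c'" using Suc.prems by blast
    have "x = (c + f * c') + f * n" using y n by (simp add: algebra_simps)
    moreover have "c + f * c' \<in> C" using y n Suc.prems by (simp add: idl.subspace_add ideal_mult)
    ultimately show "x \<in> adjoin N f C" using n by (auto intro: adjoinI)
  next
    fix x assume "x \<in> adjoin N f C"
    then obtain n c where n: "n \<in> N" "c \<in> C" "x = c + f * n" by (auto elim: adjoinE)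
    have "n + 0 \<in> N'" using Suc.prems n idl.subspace_0 by blast
    thus "x \<in> adjoin N' f C" using n by (auto intro: adjoinI)
  qed
  have "grade_ge \<mm> N' t (adjoin N f C)"
  proof (rule Suc.IH[OF _ _ _ _ f(3)])
    show "N \<inter> adjoin N f C = adjoin N f B"
    proof (rule subset_antisym; rule subsetI)
      fix x assume "x \<in> N \<inter> adjoin N f C"
      then obtain n c where n: "x \<in> N" "n \<in> N" "c \<in> C" "x = c + f * n" by (auto elim: adjoinE)
      hence "x - f * n \<in> N" using N by (intro idl.subspace_diff ideal_mult)
      hence "c \<in> N" using n(4) by simp
      thus "x \<in> adjoin N f B" using n Suc.prems by (auto intro: adjoinI)
    next
      fix x assume "x \<in> adjoin N f B"
      thus "x \<in> N \<inter> adjoin N f C"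
        using N Suc.prems(3) by (auto elim!: adjoinE intro: adjoinI simp: idl.subspace_add ideal_mult)
    qed
  next
    fix x
    show "x \<in> N' \<longleftrightarrow> (\<exists>n\<in>N. \<exists>c\<in>adjoin N f C. x = n + c)"
    proof
      assume "x \<in> N'"
      then obtain n c where "n \<in> N" "c \<in> C" "x = n + c" using Suc.prems by blast
      moreover have "C \<subseteq> adjoin N f C" using N by (rule adjoin_superset)
      ultimately show "\<exists>n\<in>N. \<exists>c\<in>adjoin N f C. x = n + c" by blast
    next
      assume "\<exists>n\<in>N. \<exists>c\<in>adjoin N f C. x = n + c"
      then obtain n n' c where n: "n \<in> N" "n' \<in> N" "c \<in> C" "x = n + (c + f * n')"
        by (auto elim: adjoinE)
      hence "x = (n + f * n') + c" by (simp add: algebra_simps)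
      moreover have "n + f * n' \<in> N" using n N by (simp add: idl.subspace_add ideal_mult)
      ultimately show "x \<in> N'" using Suc.prems n by blast
    qed
  qed (use N Suc.prems subspace_adjoin in auto)
  thus ?case using f reg eq by auto
qed simp

text \<open>Comparison along the exact sequence \<open>0 \<rightarrow> N/B \<rightarrow> A/B \<rightarrow> A/N \<rightarrow> 0\<close>.\<close>

lemma grade_ge_quotient:
  assumes A: "idl.subspace A" and "idl.subspace N" "idl.subspace B" "B \<subseteq> N" "N \<subseteq> A"
    and "grade_ge \<mm> A (Suc t) B" "grade_ge \<mm> N (Suc t) B"
  shows "grade_ge \<mm> A t N"
  using assms(2-)
proof (induction t arbitrary: N B)
  case (Suc t)
  note N = Suc.prems(1) and B = Suc.prems(2) and BN = Suc.prems(3) and NA = Suc.prems(4)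
  obtain f where f: "f \<in> \<mm>" "regular_on A B f" using Suc.prems by auto
  hence fN: "regular_on N B f" using NA by (auto simp: regular_on_def)
  have "grade_ge \<mm> N (Suc t) (adjoin N f B)"
    by (rule grade_ge_adjoin[OF N B BN Suc.prems(6) f(1) fN])
  hence soc: "socle_free N (adjoin N f B)" by (rule grade_ge_Suc_socle_free)
  \<comment> \<open>If \<open>\<mm> x\<close> lies in \<open>N\<close>, then \<open>f x\<close> is
    killed by \<open>\<mm>\<close> in \<open>N/(B + fN)\<close>. So \<open>f x = f n\<close> modulo
    \<open>B\<close>, and cancelling \<open>f\<close> puts \<open>x\<close> into
    \<open>N\<close>.\<close>
  have AN: "socle_free A N"
    unfolding socle_free_def
  proof (intro ballI impI)
    fix x assume x: "x \<in> A" "\<forall>r\<in>\<mm>. r * x \<in> N"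
    have "f * x \<in> N" using x f by blast
    moreover have "r * (f * x) \<in> adjoin N f B" if "r \<in> \<mm>" for r
    proof -
      have "0 + f * (r * x) \<in> adjoin N f B" using x that B by (intro adjoinI) (auto intro: idl.subspace_0)
      thus ?thesis by (simp add: mult.left_commute)
    qed
    ultimately have "f * x \<in> adjoin N f B" using soc by (auto simp: socle_free_def)
    then obtain n b where n: "n \<in> N" "b \<in> B" "f * x = b + f * n" by (auto elim: adjoinE)
    hence "f * (x - n) \<in> B" by (simp add: algebra_simps)
    moreover have "x - n \<in> A" using x n NA A by (auto simp: idl.subspace_diff)
    ultimately have "x - n \<in> N" using f BN by (auto simp: regular_on_def)
    hence "(x - n) + n \<in> N" using n N by (intro idl.subspace_add)
    thus "x \<in> N" by simp
  qed
  have "\<exists>h\<in>\<mm>. \<forall>(A, B)\<in>{(A, B), (A, N)}. regular_on A B h"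
    by (rule ex_common_regular) (use A N B AN socle_freeI_regular[OF f] in auto)
  then obtain h where h: "h \<in> \<mm>" "regular_on A B h" "regular_on A N h" by auto
  have hN: "regular_on N B h" using h NA by (auto simp: regular_on_def)
  have 1: "grade_ge \<mm> A (Suc t) (adjoin A h B)"
    using grade_ge_adjoin[OF A B _ Suc.prems(5) h(1,2)] BN NA by blast
  have 2: "grade_ge \<mm> N (Suc t) (adjoin N h B)"
    by (rule grade_ge_adjoin[OF N B BN Suc.prems(6) h(1) hN])
  \<comment> \<open>As \<open>h\<close> is regular on \<open>A/N\<close>, the image of
    \<open>N\<close> in \<open>A/(B + hA)\<close> is \<open>N/(B + hN)\<close>. It is the submodule
    in the reduced exact sequence, to which the induction hypothesis applies.\<close>
  have "grade_ge \<mm> (adjoin A h N) (Suc t) (adjoin A h B)"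
  proof (rule grade_ge_second_iso[OF N _ _ _ _ 2])
    show "N \<inter> adjoin A h B = adjoin N h B"
    proof (rule subset_antisym; rule subsetI)
      fix x assume "x \<in> N \<inter> adjoin A h B"
      then obtain a b where a: "x \<in> N" "a \<in> A" "b \<in> B" "x = b + h * a" by (auto elim: adjoinE)
      hence "x - b \<in> N" using BN N by (intro idl.subspace_diff) auto
      hence "h * a \<in> N" using a(4) by simp
      hence "a \<in> N" using h a by (simp add: regular_on_def)
      thus "x \<in> adjoin N h B" using a by (auto intro: adjoinI)
    next
      fix x assume "x \<in> adjoin N h B"
      thus "x \<in> N \<inter> adjoin A h B"
        using N BN NA by (auto elim!: adjoinE intro!: adjoinI simp: idl.subspace_add ideal_mult subset_eq)
    qed
  next
    fix x
    show "x \<in> adjoin A h N \<longleftrightarrow> (\<exists>n\<in>N. \<exists>c\<in>adjoin A h B. x = n + c)"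
    proof
      assume "x \<in> adjoin A h N"
      then obtain a n where a: "a \<in> A" "n \<in> N" "x = n + h * a" by (auto elim: adjoinE)
      moreover have "0 + h * a \<in> adjoin A h B" using a B by (intro adjoinI) (auto intro: idl.subspace_0)
      ultimately show "\<exists>n\<in>N. \<exists>c\<in>adjoin A h B. x = n + c" by auto
    next
      assume "\<exists>n\<in>N. \<exists>c\<in>adjoin A h B. x = n + c"
      then obtain n a b where n: "n \<in> N" "a \<in> A" "b \<in> B" "x = n + (b + h * a)" by (auto elim: adjoinE)
      have "n + b \<in> N" using n BN N by (auto simp: idl.subspace_add)
      hence "(n + b) + h * a \<in> adjoin A h N" using n by (intro adjoinI)
      thus "x \<in> adjoin A h N" using n by (simp add: add.assoc)
    qed
  qed (use A N B subspace_adjoin in auto)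
  moreover have "adjoin A h B \<subseteq> adjoin A h N" using BN by (auto simp: adjoin_def)
  ultimately have "grade_ge \<mm> A t (adjoin A h N)"
    using A N B NA 1 by (intro Suc.IH[of _ "adjoin A h B"]) (auto simp: subspace_adjoin adjoin_subset)
  thus ?case using h by auto
qed simp

end

section \<open>The polynomial ring is Noetherian\<close>

lemma deg_add: "deg (a + b) = deg a + deg b"
  by (simp add: deg_def lookup_add sum.distrib)

lemma lookup_le_deg: "Poly_Mapping.lookup a i \<le> deg a"
  unfolding deg_def by (rule member_le_sum) auto

text \<open>Degree is compared first so that every vector has finitely many predecessors, which
  makes the order well-founded. The variables are ordered by \<open>to_nat\<close>.\<close>

definition deglex :: "('n::finite \<Rightarrow>\<^sub>0 nat) \<Rightarrow> ('n \<Rightarrow>\<^sub>0 nat) \<Rightarrow> bool"  (infix \<open>\<prec>\<close> 50)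
  where "a \<prec> b \<longleftrightarrow> deg a < deg b \<or> deg a = deg b \<and>
    (\<exists>i. Poly_Mapping.lookup a i < Poly_Mapping.lookup b i \<and>
      (\<forall>j. to_nat j < to_nat i \<longrightarrow> Poly_Mapping.lookup a j = Poly_Mapping.lookup b j))"

lemma deglex_irrefl: "\<not> a \<prec> a"
  by (simp add: deglex_def)

lemma deglex_trans:
  assumes "a \<prec> b" "b \<prec> c"
  shows "a \<prec> c"
proof (cases "deg a < deg c")
  case False
  hence d: "deg a = deg b" "deg b = deg c" using assms by (auto simp: deglex_def)
  then obtain i k where
    i: "Poly_Mapping.lookup a i < Poly_Mapping.lookup b i"
       "\<And>j. to_nat j < to_nat i \<Longrightarrow> Poly_Mapping.lookup a j = Poly_Mapping.lookup b j" and
    k: "Poly_Mapping.lookup b k < Poly_Mapping.lookup c k"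
       "\<And>j. to_nat j < to_nat k \<Longrightarrow> Poly_Mapping.lookup b j = Poly_Mapping.lookup c j"
    using assms by (auto simp: deglex_def)
  define l where "l = (if to_nat i \<le> to_nat k then i else k)"
  have "Poly_Mapping.lookup a l < Poly_Mapping.lookup c l"
  proof (cases "to_nat i" "to_nat k" rule: linorder_cases)
    case less
    thus ?thesis using i(1) k(2)[of i] by (simp add: l_def)
  next
    case equal
    hence "i = k" by simp
    thus ?thesis using i(1) k(1) by (simp add: l_def)
  next
    case greater
    thus ?thesis using k(1) i(2)[of k] by (simp add: l_def)
  qed
  moreover have "Poly_Mapping.lookup a j = Poly_Mapping.lookup c j" if "to_nat j < to_nat l" for j
    using that i(2)[of j] k(2)[of j] by (auto simp: l_def split: if_splits)
  ultimately show ?thesis using d by (auto simp: deglex_def)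
qed (simp add: deglex_def)

lemma deglex_total:
  assumes "a \<noteq> b"
  shows "a \<prec> b \<or> b \<prec> a"
proof (cases "deg a = deg b")
  case True
  obtain i where i: "Poly_Mapping.lookup a i \<noteq> Poly_Mapping.lookup b i"
    using assms poly_mapping_eqI[of a b] by blast
  then obtain l where l: "Poly_Mapping.lookup a l \<noteq> Poly_Mapping.lookup b l"
    "\<And>j. to_nat j < to_nat l \<Longrightarrow> Poly_Mapping.lookup a j = Poly_Mapping.lookup b j"
    using ex_has_least_nat[of "\<lambda>j. Poly_Mapping.lookup a j \<noteq> Poly_Mapping.lookup b j" i to_nat]
    by (metis not_less)
  thus ?thesis using True unfolding deglex_def by (metis nat_neq_iff)
qed (auto simp: deglex_def)

lemma deglex_add: "a \<prec> b \<Longrightarrow> c + a \<prec> c + b"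
  by (auto simp: deglex_def deg_add lookup_add)

lemma wfP_deglex: "wfP ((\<prec>) :: ('n::finite \<Rightarrow>\<^sub>0 nat) \<Rightarrow> _)"
proof -
  have fin: "finite {b. b \<prec> a}" for a :: "'n \<Rightarrow>\<^sub>0 nat"
  proof (rule finite_subset[OF _ finite_bounded_exponents[of "deg a"]])
    have "Poly_Mapping.lookup b i \<le> deg a" if "b \<prec> a" for b i
      using that lookup_le_deg[of b i] by (auto simp: deglex_def)
    thus "{b. b \<prec> a} \<subseteq> {u. \<forall>i. Poly_Mapping.lookup u i \<le> deg a}" by auto
  qed
  have "card {c. c \<prec> a} < card {c. c \<prec> b}" if "a \<prec> b" for a b :: "'n \<Rightarrow>\<^sub>0 nat"
    using that fin deglex_irrefl deglex_trans by (intro psubset_card_mono) blast+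
  thus ?thesis by (rule wfp_if_convertible_to_nat)
qed

lemma ex_deglex_max:
  assumes "finite A" "A \<noteq> {}"
  shows "\<exists>l\<in>A. \<forall>a\<in>A. a \<noteq> l \<longrightarrow> a \<prec> l"
  using assms
proof (induction A rule: finite_ne_induct)
  case (insert x A)
  then obtain l where l: "l \<in> A" "\<And>a. a \<in> A \<Longrightarrow> a \<noteq> l \<Longrightarrow> a \<prec> l" by blast
  show ?case
  proof (cases "x \<prec> l")
    case True
    thus ?thesis using l by (intro bexI[of _ l]) auto
  next
    case False
    hence "x = l \<or> l \<prec> x" using deglex_total[of x l] by blast
    hence "a = x \<or> a \<prec> x" if "a \<in> A" for a
      using l(2)[OF that] deglex_trans[of a l x] by blast
    thus ?thesis by (intro bexI[of _ x]) auto
  qed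
qed auto

definition lead :: "('n::finite, 'k::field) mpoly \<Rightarrow> 'n \<Rightarrow>\<^sub>0 nat"
  where "lead f = (SOME l. l \<in> Poly_Mapping.keys f \<and> (\<forall>a\<in>Poly_Mapping.keys f. a \<noteq> l \<longrightarrow> a \<prec> l))"

lemma lead:
  assumes "f \<noteq> 0"
  shows "lead f \<in> Poly_Mapping.keys f"
    and "\<And>a. a \<in> Poly_Mapping.keys f \<Longrightarrow> a \<noteq> lead f \<Longrightarrow> a \<prec> lead f"
proof -
  have "\<exists>l. l \<in> Poly_Mapping.keys f \<and> (\<forall>a\<in>Poly_Mapping.keys f. a \<noteq> l \<longrightarrow> a \<prec> l)"
    using ex_deglex_max[of "Poly_Mapping.keys f"] assms by auto
  from someI_ex[OF this] show "lead f \<in> Poly_Mapping.keys f"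
    and "\<And>a. a \<in> Poly_Mapping.keys f \<Longrightarrow> a \<noteq> lead f \<Longrightarrow> a \<prec> lead f"
    unfolding lead_def by blast+
qed

lemma mpoly_eq_sum: "f = (\<Sum>a\<in>Poly_Mapping.keys f. Poly_Mapping.single a (Poly_Mapping.lookup f a))"
  by (intro poly_mapping_eqI) (auto simp: lookup_sum lookup_single when_def sum.delta in_keys_iff)

lemma single_mult_eq_sum:
  fixes f :: "('n::finite, 'k::field) mpoly"
  shows "Poly_Mapping.single b c * f =
    (\<Sum>a\<in>Poly_Mapping.keys f. Poly_Mapping.single (b + a) (c * Poly_Mapping.lookup f a))"
  by (subst mpoly_eq_sum[of f]) (simp only: sum_distrib_left mult_single)

lemma lookup_single_mult:
  fixes f :: "('n::finite, 'k::field) mpoly"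
  shows "Poly_Mapping.lookup (Poly_Mapping.single b c * f) (b + a) = c * Poly_Mapping.lookup f a"
proof -
  have "Poly_Mapping.lookup (Poly_Mapping.single b c * f) (b + a) =
      (\<Sum>a'\<in>Poly_Mapping.keys f. if a' = a then c * Poly_Mapping.lookup f a' else 0)"
    unfolding single_mult_eq_sum lookup_sum
    by (intro sum.cong) (auto simp: lookup_single when_def)
  thus ?thesis by (simp add: sum.delta in_keys_iff)
qed

lemma keys_single_mult:
  fixes f :: "('n::finite, 'k::field) mpoly"
  shows "Poly_Mapping.keys (Poly_Mapping.single b c * f) \<subseteq> (+) b ` Poly_Mapping.keys f"
  using keys_mult[of "Poly_Mapping.single b c" f] by (auto split: if_splits)

text \<open>Every other pair of exponents has a smaller sum, so nothing cancels the product of the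
  leading coefficients.\<close>

lemma mpoly_no_zero_divisors:
  fixes f g :: "('n::finite, 'k::field) mpoly"
  assumes f: "f \<noteq> 0" and g: "g \<noteq> 0"
  shows "lead f + lead g \<in> Poly_Mapping.keys (f * g)"
proof -
  let ?c = "\<lambda>a. Poly_Mapping.single a (Poly_Mapping.lookup f a) * g"
  have zero: "Poly_Mapping.lookup (?c a) (lead f + lead g) = 0" if a: "a \<in> Poly_Mapping.keys f" "a \<noteq> lead f" for a
  proof (rule ccontr)
    assume "\<not> ?thesis"
    then obtain b where b: "b \<in> Poly_Mapping.keys g" "lead f + lead g = a + b"
      using keys_single_mult by (fastforce simp flip: in_keys_iff)
    have "b + a \<prec> b + lead f" using lead(2)[OF f a] by (rule deglex_add)
    moreover have "b = lead g \<or> lead f + b \<prec> lead f + lead g"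
      using lead(2)[OF g b(1)] deglex_add by blast
    ultimately have "a + b \<prec> lead f + lead g"
      using deglex_trans by (metis add.commute)
    thus False using b(2) deglex_irrefl by metis
  qed
  have "f * g = (\<Sum>a\<in>Poly_Mapping.keys f. ?c a)"
    by (subst mpoly_eq_sum[of f]) (simp only: sum_distrib_right)
  hence "Poly_Mapping.lookup (f * g) (lead f + lead g) =
      (\<Sum>a\<in>Poly_Mapping.keys f. Poly_Mapping.lookup (?c a) (lead f + lead g))"
    by (simp only: lookup_sum)
  also have "\<dots> = (\<Sum>a\<in>{lead f}. Poly_Mapping.lookup (?c a) (lead f + lead g))"
    using zero lead(1)[OF f] by (intro sum.mono_neutral_right) auto
  also have "\<dots> = Poly_Mapping.lookup f (lead f) * Poly_Mapping.lookup g (lead g)"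
    by (simp add: lookup_single_mult)
  also have "\<dots> \<noteq> 0" using lead(1)[OF f] lead(1)[OF g] by (simp add: in_keys_iff)
  finally show ?thesis by (simp add: in_keys_iff)
qed

lemma mono_subsequence_nat:
  fixes s :: "nat \<Rightarrow> nat"
  obtains f :: "nat \<Rightarrow> nat" where "strict_mono f" "mono (\<lambda>n. s (f n))"
proof -
  obtain f where f: "strict_mono f" "monoseq (\<lambda>n. s (f n))" using seq_monosub by blast
  show ?thesis
  proof (cases "\<forall>m n. m \<le> n \<longrightarrow> s (f m) \<le> s (f n)")
    case True
    thus ?thesis using f that[of f] by (simp add: mono_def)
  next
    case False
    hence dec: "s (f n) \<le> s (f m)" if "m \<le> n" for m n
      using f that by (auto simp: monoseq_def)
    \<comment> \<open>A non-increasing sequence of naturals is constant from a minimum on.\<close>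
    obtain N where N: "\<And>n. s (f N) \<le> s (f n)"
      using ex_has_least_nat[of "\<lambda>_. True" 0 "\<lambda>n. s (f n)"] by auto
    have "s (f (n + N)) = s (f N)" for n using N[of "n + N"] dec[of N "n + N"] by simp
    moreover have "strict_mono (\<lambda>n. f (n + N))" using f by (simp add: strict_mono_def)
    ultimately show ?thesis using that[of "\<lambda>n. f (n + N)"] by (simp add: mono_def)
  qed
qed

lemma dickson:
  fixes a :: "nat \<Rightarrow> 'n::finite \<Rightarrow>\<^sub>0 nat"
  shows "\<exists>i j. i < j \<and> a i \<preceq> a j"
proof -
  have "\<exists>f :: nat \<Rightarrow> nat. strict_mono f \<and> (\<forall>v\<in>A. mono (\<lambda>n. Poly_Mapping.lookup (a (f n)) v))" if "finite A" for A :: "'n set"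
    using that
  proof (induction A rule: finite_induct)
    case empty
    show ?case by (rule exI[of _ "id :: nat \<Rightarrow> nat"]) (simp add: strict_mono_def)
  next
    case (insert v A)
    then obtain f :: "nat \<Rightarrow> nat" where f: "strict_mono f" "\<forall>v\<in>A. mono (\<lambda>n. Poly_Mapping.lookup (a (f n)) v)" by blast
    obtain g :: "nat \<Rightarrow> nat" where g: "strict_mono g" "mono (\<lambda>n. Poly_Mapping.lookup (a (f (g n))) v)"
      using mono_subsequence_nat[of "\<lambda>n. Poly_Mapping.lookup (a (f n)) v"] by auto
    have "g m \<le> g n" if "m \<le> n" for m n using g(1) that by (simp add: strict_mono_less_eq)
    hence "\<forall>v\<in>insert v A. mono (\<lambda>n. Poly_Mapping.lookup (a ((f \<circ> g) n)) v)"
      using f(2) g(2) by (simp add: mono_def)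
    thus ?case using strict_mono_o[OF f(1) g(1)] by blast
  qed
  from this[of UNIV] obtain f :: "nat \<Rightarrow> nat" where f: "strict_mono f"
    "\<And>v. mono (\<lambda>n. Poly_Mapping.lookup (a (f n)) v)" by auto
  have "f 0 < f 1" using f(1) by (simp add: strict_mono_def)
  moreover have "a (f 0) \<preceq> a (f 1)" using f(2) by (auto simp: exp_dvd_def mono_def)
  ultimately show ?thesis by blast
qed

text \<open>Otherwise choose in each coset of \<open>h i\<close> modulo its predecessors a
  representative \<open>r i\<close> with minimal leading exponent. Some leading exponent divides a
  later one, and subtracting a multiple of \<open>r i\<close> from \<open>r j\<close> stays in the
  coset of \<open>h j\<close> but lowers the leading exponent. All representatives are nonzero, so
  \<open>lead\<close> is meaningful on them.\<close>

lemma mpoly_noetherian: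
  fixes h :: "nat \<Rightarrow> ('n::finite, 'k::field) mpoly"
  shows "\<exists>i. h i \<in> idl.span (h ` {..<i})"
proof (rule ccontr)
  assume "\<nexists>i. h i \<in> idl.span (h ` {..<i})"
  hence *: "h i \<notin> idl.span (h ` {..<i})" for i by blast
  let ?J = "\<lambda>i. idl.span (h ` {..<i})"
  have "\<exists>r. r - h i \<in> ?J i \<and> (\<forall>r'. r' - h i \<in> ?J i \<longrightarrow> \<not> lead r' \<prec> lead r)" for i
  proof -
    have "h i - h i \<in> ?J i" by (simp add: idl.span_zero)
    hence "lead (h i) \<in> lead ` {r. r - h i \<in> ?J i}" by blast
    then obtain z where "z \<in> lead ` {r. r - h i \<in> ?J i}" "\<And>y. y \<prec> z \<Longrightarrow> y \<notin> lead ` {r. r - h i \<in> ?J i}"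
      using wfP_deglex[unfolded wfp_iff_ex_minimal, rule_format, of "lead ` {r. r - h i \<in> ?J i}"] by blast
    thus ?thesis by blast
  qed
  then obtain r where r: "\<And>i. r i - h i \<in> ?J i"
    and min: "\<And>i r'. r' - h i \<in> ?J i \<Longrightarrow> \<not> lead r' \<prec> lead (r i)" by metis
  have nz: "r i \<noteq> 0" for i
    using r[of i] *[of i] idl.span_neg[of "- h i" "h ` {..<i}"] by auto
  obtain i j where ij: "i < j" "lead (r i) \<preceq> lead (r j)" using dickson[of "\<lambda>i. lead (r i)"] by blast
  then obtain b where b: "lead (r j) = b + lead (r i)" by (auto simp: exp_dvd_iff add.commute)
  define c where "c = Poly_Mapping.lookup (r j) (lead (r j)) / Poly_Mapping.lookup (r i) (lead (r i))"
  define r' where "r' = r j - Poly_Mapping.single b c * r i"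
  have "?J i \<subseteq> ?J j" using ij(1) by (intro idl.span_mono) auto
  moreover have "h i \<in> ?J j" using ij(1) by (intro idl.span_base) auto
  ultimately have "(r i - h i) + h i \<in> ?J j" using r[of i] by (intro idl.span_add) auto
  hence "(r j - h j) - Poly_Mapping.single b c * r i \<in> ?J j"
    by (intro idl.span_diff[OF r] idl.span_scale) simp
  hence r': "r' - h j \<in> ?J j" by (simp add: r'_def algebra_simps)
  have "r' \<noteq> 0"
    using r' *[of j] idl.span_neg[of "- h j" "h ` {..<j}"] by auto
  have "Poly_Mapping.lookup (Poly_Mapping.single b c * r i) (lead (r j)) = c * Poly_Mapping.lookup (r i) (lead (r i))"
    by (simp only: b lookup_single_mult)
  also have "\<dots> = Poly_Mapping.lookup (r j) (lead (r j))"
    using lead(1)[OF nz[of i]] by (simp add: c_def in_keys_iff)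
  finally have "Poly_Mapping.lookup r' (lead (r j)) = 0" by (simp add: r'_def lookup_minus)
  hence "lead r' \<noteq> lead (r j)" using lead(1)[OF \<open>r' \<noteq> 0\<close>] by (auto simp: in_keys_iff)
  have "lead r' \<in> Poly_Mapping.keys (r j) \<union> Poly_Mapping.keys (Poly_Mapping.single b c * r i)"
    using lead(1)[OF \<open>r' \<noteq> 0\<close>] keys_diff[of "r j" "Poly_Mapping.single b c * r i"] by (auto simp: r'_def)
  hence "lead r' \<prec> lead (r j)"
  proof
    assume "lead r' \<in> Poly_Mapping.keys (Poly_Mapping.single b c * r i)"
    then obtain a where a: "a \<in> Poly_Mapping.keys (r i)" "lead r' = b + a"
      using keys_single_mult by blast
    hence "a \<noteq> lead (r i)" using \<open>lead r' \<noteq> lead (r j)\<close> b by auto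
    thus ?thesis using lead(2)[OF nz a(1)] a b by (simp add: deglex_add)
  qed (use lead(2)[OF nz] \<open>lead r' \<noteq> lead (r j)\<close> in blast)
  thus False using min[OF r'] by blast
qed

section \<open>Regular sequences of polynomials\<close>

definition supported :: "('n \<Rightarrow>\<^sub>0 nat) set \<Rightarrow> ('n::finite, 'k::field) mpoly set"
  where "supported E = {f. Poly_Mapping.keys f \<subseteq> E}"

definition keep :: "('n \<Rightarrow>\<^sub>0 nat) set \<Rightarrow> ('n::finite, 'k::field) mpoly \<Rightarrow> ('n, 'k) mpoly"
  where "keep E f = (\<Sum>a\<in>Poly_Mapping.keys f \<inter> E. Poly_Mapping.single a (Poly_Mapping.lookup f a))"

lemma lookup_keep: "Poly_Mapping.lookup (keep E f) a = (if a \<in> E then Poly_Mapping.lookup f a else 0)"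
  by (auto simp: keep_def lookup_sum lookup_single when_def sum.delta in_keys_iff)

lemma keys_keep: "Poly_Mapping.keys (keep E f) = Poly_Mapping.keys f \<inter> E"
  by (auto simp: in_keys_iff lookup_keep split: if_splits)

lemma keep_supported: "keep E f \<in> supported E"
  by (simp add: supported_def keys_keep)

lemma keep_split: "f = keep E f + keep (- E) f"
  by (intro poly_mapping_eqI) (simp add: lookup_keep lookup_add)

lemma keep_eq_0_iff: "keep E f = 0 \<longleftrightarrow> f \<in> supported (- E)"
  by (auto simp: supported_def simp flip: keys_eq_empty[of "keep E f"] simp: keys_keep)

lemma monomial_in_supported: "monomial a \<in> supported E \<longleftrightarrow> a \<in> E"
  by (simp add: supported_def monomial_def)

lemma subspaceI_single:
  assumes "idl.subspace A" "\<And>a. a \<in> Poly_Mapping.keys f \<Longrightarrow> Poly_Mapping.single a (Poly_Mapping.lookup f a) \<in> A"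
  shows "f \<in> A"
  by (subst mpoly_eq_sum[of f]) (use assms in \<open>intro idl.subspace_sum\<close>)

lemma subspace_supported:
  assumes "\<And>a b. a \<in> E \<Longrightarrow> a + b \<in> E"
  shows "idl.subspace (supported E :: ('n::finite, 'k::field) mpoly set)"
proof (rule idl.subspaceI)
  fix x y :: "('n, 'k) mpoly" assume "x \<in> supported E" "y \<in> supported E"
  thus "x + y \<in> supported E" using keys_add[of x y] by (auto simp: supported_def)
next
  fix c x :: "('n, 'k) mpoly" assume "x \<in> supported E"
  thus "c * x \<in> supported E"
    using keys_mult[of c x] assms by (force simp: supported_def add.commute)
qed (simp add: supported_def)

lemma span_monomials:
  fixes G :: "('n::finite \<Rightarrow>\<^sub>0 nat) set"
  shows "idl.span (monomial ` G :: ('n, 'k::field) mpoly set) = supported {a. \<exists>g\<in>G. g \<preceq> a}"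
    (is "_ = supported ?E")
proof (rule subset_antisym)
  have "idl.subspace (supported ?E :: ('n, 'k) mpoly set)"
    by (rule subspace_supported) (use exp_dvd_trans exp_dvd_add in blast)
  moreover have "monomial ` G \<subseteq> (supported ?E :: ('n, 'k) mpoly set)"
    by (rule image_subsetI) (use exp_dvd_refl in \<open>unfold monomial_in_supported, blast\<close>)
  ultimately show "idl.span (monomial ` G) \<subseteq> (supported ?E :: ('n, 'k) mpoly set)"
    by (rule idl.span_minimal[rotated])
  show "supported ?E \<subseteq> idl.span (monomial ` G :: ('n, 'k) mpoly set)"
  proof
    fix f :: "('n, 'k) mpoly" assume f: "f \<in> supported ?E"
    show "f \<in> idl.span (monomial ` G)"
    proof (rule subspaceI_single[OF idl.subspace_span])
      fix a assume "a \<in> Poly_Mapping.keys f"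
      then obtain g b where g: "g \<in> G" "a = g + b" using f by (auto simp: supported_def exp_dvd_iff)
      have "Poly_Mapping.single a (Poly_Mapping.lookup f a) = Poly_Mapping.single b (Poly_Mapping.lookup f a) * monomial g"
        by (simp add: g monomial_def mult_single add.commute)
      thus "Poly_Mapping.single a (Poly_Mapping.lookup f a) \<in> idl.span (monomial ` G)"
        using g by (simp add: idl.span_scale idl.span_base)
    qed
  qed
qed

text \<open>\<open>supported (touching V)\<close> is the ideal generated by the variables in
  \<open>V\<close>.\<close>

definition touching :: "'n set \<Rightarrow> ('n \<Rightarrow>\<^sub>0 nat) set"
  where "touching V = {a. \<exists>i\<in>V. Poly_Mapping.lookup a i \<noteq> 0}"

lemma touching_add: "a + b \<in> touching V \<longleftrightarrow> a \<in> touching V \<or> b \<in> touching V"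
  by (auto simp: touching_def lookup_add)

lemma single_exp_dvd_iff: "Poly_Mapping.single i 1 \<preceq> a \<longleftrightarrow> Poly_Mapping.lookup a i \<noteq> 0"
  by (auto simp: exp_dvd_def lookup_single when_def)

lemma span_vars: "idl.span (var ` V) = supported (touching V)"
proof -
  have eq: "var ` V = monomial ` ((\<lambda>i. Poly_Mapping.single i 1) ` V)"
    by (auto simp: var_def)
  show ?thesis
    unfolding eq span_monomials touching_def by (simp add: single_exp_dvd_iff del: One_nat_def)
qed

lemma subspace_touching: "idl.subspace (supported (touching V))"
  by (rule subspace_supported) (simp add: touching_add)

text \<open>Modulo the ideal, \<open>f\<close> and \<open>g\<close> may be replaced by their parts
  free of \<open>V\<close>. If both parts are nonzero, the leading exponent of their product is a
  sum of two exponents free of \<open>V\<close>, so the product is not in the ideal.\<close>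

lemma prime_touching: "prime_set (supported (touching V) :: ('n::finite, 'k::field) mpoly set)"
proof -
  let ?P = "supported (touching V) :: ('n, 'k) mpoly set"
  let ?N = "- touching V"
  have "f \<in> ?P \<or> g \<in> ?P" if fg: "f * g \<in> ?P" for f g
  proof (rule ccontr)
    assume "\<not> ?thesis"
    hence "keep ?N f \<noteq> 0" "keep ?N g \<noteq> 0" by (simp_all add: keep_eq_0_iff)
    hence "lead (keep ?N f) + lead (keep ?N g) \<in> Poly_Mapping.keys (keep ?N f * keep ?N g)"
      by (rule mpoly_no_zero_divisors)
    moreover have "lead (keep ?N f) \<in> ?N" "lead (keep ?N g) \<in> ?N"
      using lead(1)[OF \<open>keep ?N f \<noteq> 0\<close>] lead(1)[OF \<open>keep ?N g \<noteq> 0\<close>] by (auto simp: keys_keep)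
    moreover have "keep ?N f * keep ?N g \<in> ?P"
    proof -
      have "f - keep ?N f \<in> ?P" "g - keep ?N g \<in> ?P"
        using keep_split[of f "touching V"] keep_split[of g "touching V"]
          keep_supported[of "touching V"] by (metis add_diff_cancel_right')+
      moreover have "keep ?N f * keep ?N g = f * g - (f - keep ?N f) * g - keep ?N f * (g - keep ?N g)"
        by (simp add: algebra_simps)
      ultimately show ?thesis
        using idl.subspace_diff[OF subspace_touching idl.subspace_diff[OF subspace_touching fg
            ideal_mult(2)[OF subspace_touching]] ideal_mult(1)[OF subspace_touching]] by metis
    qed
    ultimately show False by (auto simp: supported_def touching_add)
  qed
  moreover have "1 \<notin> ?P"
    by (simp add: supported_def touching_def flip: single_one)
  ultimately show ?thesis by (auto simp: prime_set_def subspace_touching)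
qed

lemma adjoin_var:
  "adjoin UNIV (var j) (supported (touching V)) = (supported (touching (insert j V)) :: ('n::finite, 'k::field) mpoly set)"
proof (rule subset_antisym; rule subsetI)
  fix x :: "('n, 'k) mpoly" assume "x \<in> adjoin UNIV (var j) (supported (touching V))"
  then obtain a b where x: "b \<in> supported (touching V)" "x = b + var j * a" by (auto elim: adjoinE)
  have "b \<in> supported (touching (insert j V))"
    using x(1) by (auto simp: supported_def touching_def)
  moreover have "var j \<in> supported (touching (insert j V))"
    by (simp add: var_def monomial_in_supported touching_def)
  ultimately show "x \<in> supported (touching (insert j V))"
    unfolding x(2) by (intro idl.subspace_add ideal_mult subspace_touching)
next
  fix f :: "('n, 'k) mpoly" assume f: "f \<in> supported (touching (insert j V))"
  show "f \<in> adjoin UNIV (var j) (supported (touching V))"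
  proof (rule subspaceI_single)
    show "idl.subspace (adjoin UNIV (var j) (supported (touching V)) :: ('n, 'k) mpoly set)"
      by (intro subspace_adjoin subspace_touching idl.subspace_UNIV)
    fix a assume a: "a \<in> Poly_Mapping.keys f"
    let ?c = "Poly_Mapping.lookup f a"
    show "Poly_Mapping.single a ?c \<in> adjoin UNIV (var j) (supported (touching V))"
    proof (cases "a \<in> touching V")
      case True
      hence "Poly_Mapping.single a ?c + var j * 0 \<in> adjoin UNIV (var j) (supported (touching V))"
        by (intro adjoinI) (auto simp: supported_def)
      thus ?thesis by simp
    next
      case False
      hence "Poly_Mapping.single j 1 \<preceq> a"
        using a f unfolding single_exp_dvd_iff by (auto simp: supported_def touching_def)
      then obtain b where b: "a = Poly_Mapping.single j 1 + b" by (auto simp: exp_dvd_iff)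
      have "0 + var j * Poly_Mapping.single b ?c \<in> adjoin UNIV (var j) (supported (touching V))"
        by (intro adjoinI) (auto simp: supported_def)
      moreover have "var j * Poly_Mapping.single b ?c = Poly_Mapping.single a ?c"
        by (simp add: var_def monomial_def mult_single b)
      ultimately show ?thesis by simp
    qed
  qed
qed

lemma regular_on_var:
  assumes "j \<notin> V"
  shows "regular_on UNIV (supported (touching V)) (var j)"
  unfolding regular_on_def
proof (intro ballI impI)
  fix x assume x: "var j * x \<in> supported (touching V)"
  have "a \<in> touching V" if "a \<in> Poly_Mapping.keys x" for a
  proof -
    have "Poly_Mapping.single j 1 + a \<in> Poly_Mapping.keys (var j * x)"
      using that lookup_single_mult[of "Poly_Mapping.single j 1" 1 x a]
      by (simp add: in_keys_iff var_def monomial_def)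
    hence "Poly_Mapping.single j 1 + a \<in> touching V" using x by (auto simp: supported_def)
    thus ?thesis using assms by (auto simp: touching_def lookup_add lookup_single when_def split: if_splits)
  qed
  thus "x \<in> supported (touching V)" by (auto simp: supported_def)
qed

lemma grade_ge_vars:
  assumes "W \<inter> V = {}"
  shows "grade_ge (supported (touching UNIV)) UNIV (card W)
    (supported (touching V) :: ('n::finite, 'k::field) mpoly set)"
  using finite[of W] assms
proof (induction W arbitrary: V rule: finite_induct)
  case (insert j W)
  have "grade_ge (supported (touching UNIV)) UNIV (card W)
      (supported (touching (insert j V)) :: ('n, 'k) mpoly set)"
    using insert by (intro insert.IH) auto
  moreover have "(var j :: ('n, 'k) mpoly) \<in> supported (touching UNIV)"
    by (auto simp: var_def monomial_in_supported touching_def lookup_single when_def)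
  ultimately show ?case
    using insert regular_on_var[of j V] by (auto simp: adjoin_var)
qed simp

lemma supported_empty: "supported {} = {0}"
  by (auto simp: supported_def)

lemma grade_ge_Suc: "grade_ge \<mm> A (Suc t) B \<Longrightarrow> grade_ge \<mm> A t B"
  by (induction t arbitrary: B) auto

lemma grade_ge_mono: "grade_ge \<mm> A t B \<Longrightarrow> s \<le> t \<Longrightarrow> grade_ge \<mm> A s B"
  by (induction t) (use grade_ge_Suc le_Suc_eq in blast)+

lemma grade_ge_mpoly:
  assumes "t \<le> CARD('n)"
  shows "grade_ge (supported (touching UNIV)) UNIV t {0 :: ('n::finite, 'k::field) mpoly}"
proof -
  have "touching {} = ({} :: ('n \<Rightarrow>\<^sub>0 nat) set)" by (simp add: touching_def)
  hence "grade_ge (supported (touching UNIV)) UNIV (CARD('n)) {0 :: ('n::finite, 'k::field) mpoly}"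
    using grade_ge_vars[of "UNIV :: 'n set" "{}"] by (simp add: supported_empty)
  thus ?thesis using assms by (rule grade_ge_mono)
qed

section \<open>Regular sequences as lists, and the bound on their length\<close>

primrec regular_list :: "'a::comm_ring_1 set \<Rightarrow> 'a set \<Rightarrow> 'a list \<Rightarrow> bool" where
  "regular_list A B [] = True"
| "regular_list A B (f # fs) = (regular_on A B f \<and> regular_list A (adjoin A f B) fs)"

primrec adjoin_list :: "'a::comm_ring_1 set \<Rightarrow> 'a list \<Rightarrow> 'a set \<Rightarrow> 'a set" where
  "adjoin_list A [] B = B"
| "adjoin_list A (f # fs) B = adjoin_list A fs (adjoin A f B)"

lemma grade_ge_iff_regular_list:
  "grade_ge \<mm> A t B \<longleftrightarrow> (\<exists>fs. length fs = t \<and> set fs \<subseteq> \<mm> \<and> regular_list A B fs)"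
proof (induction t arbitrary: B)
  case (Suc t)
  have "(\<exists>fs. length fs = Suc t \<and> P fs) \<longleftrightarrow> (\<exists>f gs. length gs = t \<and> P (f # gs))" for P :: "'a list \<Rightarrow> bool"
    by (metis length_Suc_conv)
  thus ?case by (auto simp: Suc)
qed simp

text \<open>The monomial with exponents \<open>l\<close> evaluated at \<open>fs\<close>. The last
  clause supplies the empty product; in all uses the lists have equal length.\<close>

fun power_product :: "'a::comm_ring_1 list \<Rightarrow> nat list \<Rightarrow> 'a" where
  "power_product (f # fs) (e # l) = f ^ e * power_product fs l"
| "power_product _ _ = 1"

definition box :: "nat \<Rightarrow> nat \<Rightarrow> nat list set"
  where "box e t = {l. set l \<subseteq> {..<e} \<and> length l = t}"

lemma finite_box: "finite (box e t)" and card_box: "card (box e t) = e ^ t"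
  by (simp_all add: box_def finite_lists_length_eq card_lists_length_eq)

lemma box_Suc: "box e (Suc t) = (\<lambda>(i, l). i # l) ` ({..<e} \<times> box e t)"
  by (auto simp: box_def length_Suc_conv image_iff)

lemma regular_on_power:
  assumes "regular_on A B f" "idl.subspace A" "x \<in> A" "f ^ i * x \<in> B"
  shows "x \<in> B"
  using assms(4)
proof (induction i)
  case (Suc i)
  have "f * (f ^ i * x) \<in> B" using Suc.prems by (simp add: mult.assoc)
  moreover have "f ^ i * x \<in> A" using assms by (simp add: ideal_mult)
  ultimately show ?case using assms(1) Suc.IH by (simp add: regular_on_def)
qed simp

text \<open>A regular sequence is algebraically independent over the base field.\<close>

lemma regular_list_independent:
  fixes v :: "('n::finite, 'k::field) mpoly"
  assumes A: "idl.subspace A" and "idl.subspace B" and v: "v \<in> A"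
    and "v \<notin> adjoin_list A fs B" "regular_list A B fs"
    and "(\<Sum>l\<in>box e (length fs). Poly_Mapping.single 0 (c l) * (power_product fs l * v)) \<in> B"
    and "l \<in> box e (length fs)"
  shows "c l = 0"
  using assms(2,4-)
proof (induction fs arbitrary: B c l)
  case Nil
  have l: "box e 0 = {[]}" by (auto simp: box_def)
  show ?case
  proof (rule ccontr)
    assume "c l \<noteq> 0"
    moreover have "Poly_Mapping.single 0 (c l) * v \<in> B" using Nil.prems l by simp
    hence "Poly_Mapping.single 0 (inverse (c l)) * (Poly_Mapping.single 0 (c l) * v) \<in> B"
      using Nil.prems(1) by (rule ideal_mult(1)[rotated])
    ultimately have "v \<in> B" by (simp add: mult_single flip: mult.assoc)
    thus False using Nil.prems by simp
  qed
next
  case (Cons f fs)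
  \<comment> \<open>\<open>Q i\<close> is the coefficient of \<open>f ^ i\<close>, an expression in
    the remaining elements \<open>fs\<close>.\<close>
  define Q where "Q i = (\<Sum>l\<in>box e (length fs). Poly_Mapping.single 0 (c (i # l)) * (power_product fs l * v))" for i
  have QA: "Q i \<in> A" for i
    unfolding Q_def using A v by (intro idl.subspace_sum ideal_mult)
  have total: "(\<Sum>l\<in>box e (length (f # fs)). Poly_Mapping.single 0 (c l) * (power_product (f # fs) l * v)) =
      (\<Sum>i<e. f ^ i * Q i)"
  proof -
    have "inj_on (\<lambda>(i, l). i # l) ({..<e} \<times> box e (length fs))" by (auto simp: inj_on_def)
    hence "(\<Sum>l\<in>box e (length (f # fs)). Poly_Mapping.single 0 (c l) * (power_product (f # fs) l * v)) =
        (\<Sum>(i, l)\<in>{..<e} \<times> box e (length fs). Poly_Mapping.single 0 (c (i # l)) * (f ^ i * power_product fs l * v))"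
      by (simp add: box_Suc sum.reindex case_prod_unfold)
    also have "\<dots> = (\<Sum>i<e. f ^ i * Q i)"
      unfolding Q_def by (simp add: sum.cartesian_product[symmetric] sum_distrib_left mult_ac)
    finally show ?thesis .
  qed
  have "\<forall>l\<in>box e (length fs). c (i # l) = 0" if "i < e" for i
    using that
  proof (induction i rule: less_induct)
    case (less i)
    have zero: "Q i' = 0" if "i' < i" for i'
      unfolding Q_def using less that by (intro sum.neutral) simp
    \<comment> \<open>The earlier coefficients vanish, so the sum is
      \<open>f ^ i * (Q i + f * R)\<close>. Cancelling \<open>f ^ i\<close> leaves
      \<open>Q i\<close> in \<open>B + fA\<close>, where the induction hypothesis for
      \<open>fs\<close> applies.\<close>
    define R where "R = (\<Sum>i'\<in>{Suc i..<e}. f ^ (i' - Suc i) * Q i')"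
    have RA: "R \<in> A" unfolding R_def using A QA by (intro idl.subspace_sum ideal_mult)
    have "(\<Sum>i<e. f ^ i * Q i) = (\<Sum>i'\<in>{i..<e}. f ^ i' * Q i')"
      using zero by (intro sum.mono_neutral_right) auto
    also have "\<dots> = f ^ i * Q i + (\<Sum>i'\<in>{Suc i..<e}. f ^ i' * Q i')"
      using less.prems by (rule sum.atLeast_Suc_lessThan)
    also have "(\<Sum>i'\<in>{Suc i..<e}. f ^ i' * Q i') = f ^ i * (f * R)"
      unfolding R_def sum_distrib_left
    proof (intro sum.cong refl)
      fix i' assume "i' \<in> {Suc i..<e}"
      hence "f ^ i' = f ^ (i + Suc (i' - Suc i))" by simp
      thus "f ^ i' * Q i' = f ^ i * (f * (f ^ (i' - Suc i) * Q i'))"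
        by (simp only: power_add power_Suc mult.assoc)
    qed
    finally have "f ^ i * (Q i + f * R) \<in> B"
      using Cons.prems(4) total by (simp add: distrib_left)
    moreover have "Q i + f * R \<in> A" using A QA RA by (intro idl.subspace_add ideal_mult)
    ultimately have "Q i + f * R \<in> B"
      using regular_on_power[OF _ A] Cons.prems(3) by auto
    hence "(Q i + f * R) + f * (- R) \<in> adjoin A f B"
      using RA A by (intro adjoinI idl.subspace_neg)
    hence "Q i \<in> adjoin A f B" by simp
    thus ?case
      using Cons.IH[of "adjoin A f B" "\<lambda>l. c (i # l)"] Cons.prems A
      by (auto simp: Q_def subspace_adjoin)
  qed
  thus ?case using Cons.prems(5) by (auto simp: box_Suc)
qed

lemma card_bounded_exponents:
  "card {u :: 'n::finite \<Rightarrow>\<^sub>0 nat. \<forall>i. Poly_Mapping.lookup u i \<le> N} \<le> Suc N ^ CARD('n)" (is "card ?U \<le> _")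
proof -
  have "card ?U = card (Poly_Mapping.lookup ` ?U)"
    by (rule card_image[symmetric]) (auto simp: inj_on_def poly_mapping_eqI)
  also have "\<dots> \<le> card (PiE (UNIV :: 'n set) (\<lambda>_. {..N}))"
    by (rule card_mono) (auto simp: finite_PiE)
  also have "\<dots> = Suc N ^ CARD('n)" by (simp add: card_PiE)
  finally show ?thesis .
qed

definition degree_le :: "nat \<Rightarrow> ('n::finite, 'k::field) mpoly \<Rightarrow> bool"
  where "degree_le N f \<longleftrightarrow> (\<forall>a\<in>Poly_Mapping.keys f. deg a \<le> N)"

lemma degree_le_mult:
  assumes "degree_le M f" "degree_le N g"
  shows "degree_le (M + N) (f * g)"
  unfolding degree_le_def
proof
  fix a assume "a \<in> Poly_Mapping.keys (f * g)"
  then obtain b c where "b \<in> Poly_Mapping.keys f" "c \<in> Poly_Mapping.keys g" "a = b + c"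
    using keys_mult[of f g] by blast
  thus "deg a \<le> M + N" using assms by (simp add: degree_le_def deg_add add_mono)
qed

lemma degree_le_one: "degree_le N 1"
  by (auto simp: degree_le_def deg_def)

lemma degree_le_power: "degree_le N f \<Longrightarrow> degree_le (i * N) (f ^ i)"
  by (induction i) (auto simp: degree_le_one intro: degree_le_mult)

lemma degree_le_mono: "degree_le M f \<Longrightarrow> M \<le> N \<Longrightarrow> degree_le N f"
  by (auto simp: degree_le_def)

lemma degree_le_power_product:
  assumes "\<And>f. f \<in> set fs \<Longrightarrow> degree_le D f" "l \<in> box e (length fs)"
  shows "degree_le (length fs * (e * D)) (power_product fs l)"
  using assms
proof (induction fs arbitrary: l)
  case (Cons f fs)
  then obtain i l' where l: "l = i # l'" "i < e" "l' \<in> box e (length fs)" by (auto simp: box_Suc)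
  have "degree_le (e * D) (f ^ i)"
    using Cons.prems(1)[of f] l(2) by (intro degree_le_mono[OF degree_le_power[of D f i]]) auto
  thus ?case using Cons l by (auto intro: degree_le_mult)
qed (simp add: degree_le_one)

text \<open>With \<open>t = length fs\<close>, the \<open>e ^ t\<close> power products with
  exponents below \<open>e\<close> are linearly independent. Their degrees grow only linearly in
  \<open>e\<close>, so they lie in a space of dimension at most a constant times
  \<open>e ^ n\<close>; for large \<open>e\<close> this forces \<open>t \<le> n\<close>.\<close>

lemma regular_list_length_le:
  fixes v :: "('n::finite, 'k::field) mpoly"
  assumes A: "idl.subspace A" and B: "idl.subspace B" and v: "v \<in> A" "v \<notin> adjoin_list A fs B"
    and fs: "regular_list A B fs"
  shows "length fs \<le> CARD('n)"
proof (rule ccontr)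
  let ?n = "CARD('n)" and ?t = "length fs"
  assume "\<not> ?thesis"
  hence t: "Suc ?n \<le> ?t" by simp
  interpret mp: vector_space "\<lambda>(c::'k) (f::('n, 'k) mpoly). Poly_Mapping.single 0 c * f"
  proof
    fix a b :: 'k and x y :: "('n, 'k) mpoly"
    show "Poly_Mapping.single 0 a * (x + y) = Poly_Mapping.single 0 a * x + Poly_Mapping.single 0 a * y"
      by (rule distrib_left)
    show "Poly_Mapping.single 0 (a + b) * x = Poly_Mapping.single 0 a * x + Poly_Mapping.single 0 b * x"
      by (simp only: single_add distrib_right)
    show "Poly_Mapping.single 0 a * (Poly_Mapping.single 0 b * x) = Poly_Mapping.single 0 (a * b) * x"
      by (simp only: mult_single mult.assoc[symmetric] add_0)
    show "Poly_Mapping.single 0 1 * x = x" by simp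
  qed
  define D where "D = Max (insert 0 (\<Union>f\<in>set fs. deg ` Poly_Mapping.keys f))"
  have D: "degree_le D f" if "f \<in> set fs" for f
    unfolding degree_le_def D_def using that by (auto intro!: Max_ge)
  \<comment> \<open>The choice gives \<open>N + 1 \<le> K * e\<close> and \<open>K ^ n < e\<close>,
    hence \<open>(N + 1) ^ n \<le> K ^ n * e ^ n < e ^ (n + 1)\<close>.\<close>
  define K where "K = Suc (?t * D)"
  define e where "e = Suc (K ^ ?n)"
  define N where "N = ?t * (e * D)"
  let ?g = "power_product fs" and ?L = "box e ?t"
  have indep: "c l = 0" if "(\<Sum>l\<in>?L. Poly_Mapping.single 0 (c l) * ?g l) = 0" "l \<in> ?L" for c l
  proof (rule regular_list_independent[OF A B v fs _ that(2)])
    have "(\<Sum>l\<in>?L. Poly_Mapping.single 0 (c l) * (?g l * v)) = 0 * v"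
      unfolding that(1)[symmetric] by (simp add: sum_distrib_right mult.assoc)
    thus "(\<Sum>l\<in>?L. Poly_Mapping.single 0 (c l) * (?g l * v)) \<in> B" using B by (simp add: idl.subspace_0)
  qed
  have inj: "inj_on ?g ?L"
  proof (rule inj_onI, rule ccontr)
    fix l l' assume l: "l \<in> ?L" "l' \<in> ?L" "?g l = ?g l'" "l \<noteq> l'"
    let ?c = "\<lambda>x. (if x = l then 1 else 0) - (if x = l' then 1 else 0) :: 'k"
    have "(\<Sum>x\<in>?L. Poly_Mapping.single 0 (?c x) * ?g x) =
        (\<Sum>x\<in>?L. (if x = l then ?g x else 0) - (if x = l' then ?g x else 0))"
      by (intro sum.cong) (auto simp: single_diff algebra_simps)
    also have "\<dots> = 0" using l finite_box[of e ?t] by (simp add: sum_subtractf)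
    finally have "?c l = 0" using l(1) by (rule indep)
    thus False using l(4) by simp
  qed
  have "mp.independent (?g ` ?L)"
    unfolding mp.dependent_finite[OF finite_imageI[OF finite_box]]
    using indep[of "\<lambda>l. u (?g l)" for u] by (auto simp: sum.reindex[OF inj])
  moreover have "?g ` ?L \<subseteq> mp.span (monomial ` {u. \<forall>i. Poly_Mapping.lookup u i \<le> N})" (is "_ \<subseteq> mp.span ?T")
  proof (rule image_subsetI)
    fix l assume "l \<in> ?L"
    hence g: "degree_le N (?g l)" unfolding N_def using D by (intro degree_le_power_product)
    show "?g l \<in> mp.span ?T"
    proof (subst mpoly_eq_sum[of "?g l"], rule mp.span_sum)
      fix a assume "a \<in> Poly_Mapping.keys (?g l)"
      hence "deg a \<le> N" using g by (simp add: degree_le_def)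
      hence "Poly_Mapping.lookup a i \<le> N" for i using lookup_le_deg[of a i] by linarith
      hence "monomial a \<in> ?T" by blast
      hence "Poly_Mapping.single 0 (Poly_Mapping.lookup (?g l) a) * monomial a \<in> mp.span ?T"
        by (intro mp.span_scale mp.span_base)
      thus "Poly_Mapping.single a (Poly_Mapping.lookup (?g l) a) \<in> mp.span ?T"
        by (simp add: monomial_def mult_single)
    qed
  qed
  ultimately have "card (?g ` ?L) \<le> card ?T"
    using mp.independent_span_bound[of ?T "?g ` ?L"] finite_bounded_exponents by blast
  also have "\<dots> \<le> Suc N ^ ?n"
    using card_image_le[OF finite_bounded_exponents] card_bounded_exponents by (rule order.trans)
  also have "Suc N \<le> K * e" by (simp add: N_def K_def e_def algebra_simps)
  hence "Suc N ^ ?n \<le> (K * e) ^ ?n" by (rule power_mono) simp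
  also have "(K * e) ^ ?n = K ^ ?n * e ^ ?n" by (rule power_mult_distrib)
  also have "\<dots> < e * e ^ ?n" by (simp add: e_def)
  also have "e * e ^ ?n \<le> e ^ ?t" using t power_increasing[OF t, of e] by (simp add: e_def)
  also have "e ^ ?t = card (?g ` ?L)" by (simp add: card_image[OF inj] card_box)
  finally show False by simp
qed

section \<open>The modules \<open>I\<close> and \<open>S/I\<close>\<close>

lemma mpoly_ring_simps [simp]:
  "carrier \<S> = UNIV" "f \<otimes>\<^bsub>\<S>\<^esub> g = f * g" "\<one>\<^bsub>\<S>\<^esub> = 1" "\<zero>\<^bsub>\<S>\<^esub> = 0" "f \<oplus>\<^bsub>\<S>\<^esub> g = f + g"
  by (simp_all add: mpoly_ring_def)

lemma ideal_mpoly_ring_iff: "ideal I \<S> \<longleftrightarrow> idl.subspace (I :: ('n::finite, 'k::field) mpoly set)"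
proof
  interpret R: cring "\<S> :: ('n, 'k) mpoly ring" by (rule cring_mpoly_ring)
  {
    assume "ideal I \<S>"
    then interpret ideal I "\<S> :: ('n, 'k) mpoly ring" .
    have "x + y \<in> I" if "x \<in> I" "y \<in> I" for x y
      using additive_subgroup.a_closed[OF additive_subgroup_axioms that] by simp
    moreover have "0 \<in> I"
      using additive_subgroup.zero_closed[OF additive_subgroup_axioms] by simp
    moreover have "c * x \<in> I" if "x \<in> I" for c x
      using I_l_closed[OF that, of c] by simp
    ultimately show "idl.subspace I" unfolding idl.subspace_def by blast
  next
    assume I: "idl.subspace I"
    have "subgroup I (add_monoid \<S>)"
    proof (rule R.add.subgroupI)
      fix a assume "a \<in> I"
      moreover have "\<ominus>\<^bsub>\<S>\<^esub> a = - a"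
        by (rule R.minus_equality) auto
      ultimately show "\<ominus>\<^bsub>\<S>\<^esub> a \<in> I" using I by (simp add: idl.subspace_neg)
    qed (use I in \<open>auto simp: idl.subspace_add dest: idl.subspace_0\<close>)
    thus "ideal I \<S>"
      using I by (intro idealI R.ring_axioms) (auto simp: ideal_mult)
  }
qed

lemma genideal_mpoly_ring: "Idl\<^bsub>\<S>\<^esub> G = idl.span G"
  unfolding genideal_def ideal_mpoly_ring_iff
  by (rule subset_antisym)
    (auto intro: Inter_lower idl.subspace_span idl.span_base dest: idl.span_minimal)

lemma max_ideal_eq: "max_ideal = supported (touching UNIV)"
  by (simp add: max_ideal_def genideal_mpoly_ring span_vars)

definition coset :: "('n::finite, 'k::field) mpoly set \<Rightarrow> ('n, 'k) mpoly \<Rightarrow> ('n, 'k) mpoly set"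
  where "coset I f = I +>\<^bsub>\<S>\<^esub> f"

lemma coset_eq_iff:
  assumes "idl.subspace I"
  shows "coset I f = coset I g \<longleftrightarrow> f - g \<in> I"
proof -
  have coset: "coset I f = {h + f | h. h \<in> I}" for f
    by (auto simp: coset_def a_r_coset_def' )
  show ?thesis
  proof
    assume "coset I f = coset I g"
    moreover have "0 + f \<in> coset I f" using assms coset idl.subspace_0 by blast
    ultimately show "f - g \<in> I" by (auto simp: coset)
  next
    assume fg: "f - g \<in> I"
    have "h + f = (h + (f - g)) + g" "h + g = (h - (f - g)) + f" for h by simp_all
    thus "coset I f = coset I g"
      unfolding coset using fg assms idl.subspace_add idl.subspace_diff by blast
  qed
qed

lemma quot_module_simps:
  assumes "idl.subspace I"
  shows "carrier (quot_module I) = range (coset I)"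
    and "coset I f \<oplus>\<^bsub>quot_module I\<^esub> coset I g = coset I (f + g)"
    and "\<zero>\<^bsub>quot_module I\<^esub> = coset I 0"
    and "f \<odot>\<^bsub>quot_module I\<^esub> coset I g = coset I (f * g)"
proof -
  have I: "ideal I \<S>" using assms by (simp add: ideal_mpoly_ring_iff)
  interpret h: ring_hom_ring \<S> "\<S> Quot I" "(+>\<^bsub>\<S>\<^esub>) I"
    by (rule ideal.rcos_ring_hom_ring[OF I])
  show "carrier (quot_module I) = range (coset I)"
    by (auto simp: quot_module_def FactRing_def A_RCOSETS_def' coset_def)
  show "coset I f \<oplus>\<^bsub>quot_module I\<^esub> coset I g = coset I (f + g)"
    using h.hom_add[of f g] by (simp add: quot_module_def coset_def)
  show "\<zero>\<^bsub>quot_module I\<^esub> = coset I 0"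
    using h.hom_zero by (simp add: quot_module_def coset_def)
  show "f \<odot>\<^bsub>quot_module I\<^esub> coset I g = coset I (f * g)"
    using h.hom_mult[of f g] by (simp add: quot_module_def coset_def)
qed

lemma ideal_module_simps [simp]:
  "carrier (ideal_module I) = I" "f \<oplus>\<^bsub>ideal_module I\<^esub> g = f + g"
  "\<zero>\<^bsub>ideal_module I\<^esub> = 0" "f \<odot>\<^bsub>ideal_module I\<^esub> g = f * g"
  by (simp_all add: ideal_module_def)

lemma abelian_monoid_modules:
  assumes "idl.subspace I"
  shows "abelian_monoid (quot_module I)" "abelian_monoid (ideal_module I)"
  using assms module_quot_module[of I] module_ideal_module[of I]
  by (auto simp: ideal_mpoly_ring_iff Module.module_def abelian_group_def)

lemma primeideal_mpoly_ring_iff: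
  "primeideal P \<S> \<longleftrightarrow> prime_set (P :: ('n::finite, 'k::field) mpoly set)"
proof
  assume "primeideal P \<S>"
  then interpret primeideal P "\<S> :: ('n, 'k) mpoly ring" .
  have P: "idl.subspace P" using is_ideal by (simp add: ideal_mpoly_ring_iff)
  have "1 \<notin> P"
  proof
    assume "1 \<in> P"
    hence "r * 1 \<in> P" for r using P by (intro ideal_mult(1))
    thus False using I_notcarr by auto
  qed
  thus "prime_set P" using P I_prime by (auto simp: prime_set_def)
next
  assume "prime_set P"
  thus "primeideal P \<S>"
    by (intro primeidealI cring_mpoly_ring) (auto simp: prime_set_def ideal_mpoly_ring_iff)
qed

lemma num_vars_touching: "num_vars (supported (touching V) :: ('n::finite, 'k::field) mpoly set) = card V"
proof -
  have mem: "(var i :: ('n, 'k) mpoly) \<in> supported (touching W) \<longleftrightarrow> i \<in> W" for i W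
    by (auto simp: var_def monomial_in_supported touching_def lookup_single when_def)
  have "W = V" if "supported (touching V) = (supported (touching W) :: ('n, 'k) mpoly set)" for W
    using mem[of _ V] mem[of _ W] that by blast
  hence "(THE W. supported (touching V) = (supported (touching W) :: ('n, 'k) mpoly set)) = V"
    by (intro the_equality) auto
  thus ?thesis by (simp add: num_vars_def genideal_mpoly_ring span_vars)
qed

lemma subspace_multiples: "idl.subspace (supported (multiples G))"
  by (rule subspace_supported) (rule multiples_add)

lemma keys_mult_monomial:
  fixes f :: "('n::finite, 'k::field) mpoly"
  shows "Poly_Mapping.keys (f * monomial u) = (+) u ` Poly_Mapping.keys f"
proof (rule subset_antisym)
  show "Poly_Mapping.keys (f * monomial u) \<subseteq> (+) u ` Poly_Mapping.keys f"
    using keys_single_mult[of u 1 f] by (simp add: monomial_def mult.commute)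
  show "(+) u ` Poly_Mapping.keys f \<subseteq> Poly_Mapping.keys (f * monomial u)"
    using lookup_single_mult[of u 1 f] by (auto simp: monomial_def mult.commute[of f] in_keys_iff)
qed

text \<open>The prime is the annihilator of the class of \<open>x^u\<close>. Multiplication by a
  monomial only shifts exponents, so membership of \<open>f x^u\<close> in the ideal can be tested
  term by term.\<close>

lemma associated_prime_of_colon_support:
  assumes "colon_support G u V"
  shows "(supported (touching V) :: ('n::finite, 'k::field) mpoly set) \<in>
    associated_primes (quot_module (supported (multiples G)))"
proof -
  let ?I = "supported (multiples G) :: ('n, 'k) mpoly set"
  note I = subspace_multiples[of G, where ?'b = 'k]
  have "f * monomial u \<in> ?I \<longleftrightarrow> f \<in> supported (touching V)" for f
    using assms by (auto simp: supported_def keys_mult_monomial colon_support_def touching_def)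
  hence "supported (touching V) = {f. f \<odot>\<^bsub>quot_module ?I\<^esub> coset ?I (monomial u) = \<zero>\<^bsub>quot_module ?I\<^esub>}"
    by (simp add: quot_module_simps[OF I] coset_eq_iff[OF I])
  moreover have "coset ?I (monomial u) \<in> carrier (quot_module ?I)"
    by (simp add: quot_module_simps[OF I])
  ultimately show ?thesis
    unfolding associated_primes_def primeideal_mpoly_ring_iff using prime_touching by blast
qed

lemma inj_monomial: "inj monomial"
  by (rule injI) (metis keys_single monomial_def singleton_inject zero_neq_one)

lemma minimal_monomial_generators_list:
  assumes "minimal_monomial_generators I G"
  obtains E where "I = supported (multiples E)" "length E = card G"
proof -
  obtain A where A: "G = monomial ` A"
    using assms by (auto simp: minimal_monomial_generators_def subset_image_iff)
  have inj: "inj_on (monomial :: _ \<Rightarrow> ('a, 'b) mpoly) A" using inj_monomial by (rule inj_on_subset) simp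
  have "finite A" using assms inj A by (auto simp: minimal_monomial_generators_def dest: finite_imageD)
  then obtain E where E: "set E = A" "distinct E" using finite_distinct_list by blast
  have "I = supported {a. \<exists>g\<in>A. g \<preceq> a}"
    using assms A by (simp add: minimal_monomial_generators_def genideal_mpoly_ring span_monomials)
  hence "I = supported (multiples E)" by (simp add: multiples_def E)
  moreover have "length E = card A" using distinct_card[OF E(2)] E(1) by simp
  hence "length E = card G" by (simp add: A card_image[OF inj])
  ultimately show ?thesis by (rule that)
qed

text \<open>Settles the zero ideal, for which \<open>k = 0\<close> and the denominator
  \<open>k - 1\<close> is \<open>- 1\<close>.\<close>

lemma num_vars_zero_of_zero_ideal:
  assumes P: "P \<in> associated_primes (quot_module ({0} :: ('n::finite, 'k::field) mpoly set))"
  shows "num_vars P = 0"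
proof -
  have I: "idl.subspace ({0} :: ('n, 'k) mpoly set)" by (rule idl.subspace_single_0)
  obtain x where prime: "prime_set P" and x: "x \<in> carrier (quot_module {0})"
    and P: "P = {f. f \<odot>\<^bsub>quot_module {0}\<^esub> x = \<zero>\<^bsub>quot_module {0}\<^esub>}"
    using P by (auto simp: associated_primes_def primeideal_mpoly_ring_iff)
  obtain g where "x = coset {0} g" using x by (auto simp: quot_module_simps[OF I])
  hence P: "P = {f. f * g = 0}"
    using P by (simp add: quot_module_simps[OF I] coset_eq_iff[OF I])
  hence "g \<noteq> 0" using prime by (auto simp: prime_set_def)
  hence "P = {0}" using P mpoly_no_zero_divisors by fastforce
  also have "{0} = supported (touching {})" by (simp add: touching_def supported_empty)
  finally show ?thesis by (simp add: num_vars_touching)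
qed

section \<open>Stanley decompositions from cone partitions\<close>

lemma finsum_image:
  assumes M: "abelian_monoid M" and S: "0 \<in> S" "\<And>f g. f \<in> S \<Longrightarrow> g \<in> S \<Longrightarrow> f + g \<in> S"
    and \<phi>: "\<phi> ` S \<subseteq> carrier M" "\<phi> 0 = \<zero>\<^bsub>M\<^esub>" "\<And>f g. f \<in> S \<Longrightarrow> g \<in> S \<Longrightarrow> \<phi> (f + g) = \<phi> f \<oplus>\<^bsub>M\<^esub> \<phi> g"
    and "finite F" "\<And>i. i \<in> F \<Longrightarrow> g i \<in> S"
  shows "(\<Oplus>\<^bsub>M\<^esub>i\<in>F. \<phi> (g i)) = \<phi> (\<Sum>i\<in>F. g i)" "(\<Sum>i\<in>F. g i) \<in> S"
proof -
  interpret abelian_monoid M by (rule M)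
  have "(\<Oplus>\<^bsub>M\<^esub>i\<in>F. \<phi> (g i)) = \<phi> (\<Sum>i\<in>F. g i) \<and> (\<Sum>i\<in>F. g i) \<in> S"
    using assms(7-)
  proof (induction F rule: finite_induct)
    case (insert x F)
    hence "(\<lambda>i. \<phi> (g i)) \<in> F \<rightarrow> carrier M" "\<phi> (g x) \<in> carrier M" using \<phi>(1) by auto
    thus ?case using insert S \<phi> by simp
  qed (use S \<phi> in simp)
  thus "(\<Oplus>\<^bsub>M\<^esub>i\<in>F. \<phi> (g i)) = \<phi> (\<Sum>i\<in>F. g i)" "(\<Sum>i\<in>F. g i) \<in> S" by blast+
qed

text \<open>A list, to match \<open>stanley_decomposition\<close>. Disjointness refers to positions,
  so it also excludes listing a cone twice.\<close>

definition cone_partition :: "('n \<Rightarrow>\<^sub>0 nat) set \<Rightarrow> (('n \<Rightarrow>\<^sub>0 nat) \<times> 'n set) list \<Rightarrow> bool"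
  where "cone_partition C D \<longleftrightarrow> C = (\<Union>(a, Z)\<in>set D. cone a Z) \<and>
    (\<forall>i<length D. \<forall>j<length D. i \<noteq> j \<longrightarrow>
      cone (fst (D ! i)) (snd (D ! i)) \<inter> cone (fst (D ! j)) (snd (D ! j)) = {})"

lemma conic_cone_partition:
  assumes "conic c C"
  shows "\<exists>D. cone_partition C D \<and> (\<forall>(a, Z)\<in>set D. card (- Z) \<le> c)"
  using assms
proof (induction rule: conic.induct)
  case conic_empty
  show ?case by (rule exI[of _ "[]"]) (simp add: cone_partition_def)
next
  case (conic_insert X a Z)
  then obtain D where D: "cone_partition X D" "\<forall>(a, Z)\<in>set D. card (- Z) \<le> c" by blast
  have X: "X = (\<Union>(a, Z)\<in>set D. cone a Z)" using D(1) by (simp add: cone_partition_def)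
  have "cone (fst (D ! i)) (snd (D ! i)) \<subseteq> X" if "i < length D" for i
    using nth_mem[OF that] unfolding X by force
  hence disj: "cone a Z \<inter> cone (fst (D ! i)) (snd (D ! i)) = {}" if "i < length D" for i
    using conic_insert.hyps(2) that by blast
  have "cone_partition (cone a Z \<union> X) ((a, Z) # D)"
    using D(1) disj unfolding cone_partition_def by (auto simp: nth_Cons less_Suc_eq_0_disj split: nat.splits)
  thus ?case using D(2) conic_insert.hyps(3) by (intro exI[of _ "(a, Z) # D"]) auto
qed

lemma subpoly_mult_monomial:
  "{f * monomial a | f. f \<in> subpoly Z} = (supported (cone a Z) :: ('n::finite, 'k::field) mpoly set)"
proof (rule subset_antisym; rule subsetI)
  fix g :: "('n, 'k) mpoly" assume "g \<in> {f * monomial a | f. f \<in> subpoly Z}"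
  thus "g \<in> supported (cone a Z)"
    by (auto simp: supported_def subpoly_def keys_mult_monomial cone_def)
next
  fix g :: "('n, 'k) mpoly" assume g: "g \<in> supported (cone a Z)"
  define f where "f = (\<Sum>b\<in>Poly_Mapping.keys g. Poly_Mapping.single (b - a) (Poly_Mapping.lookup g b))"
  have b: "\<exists>z. b = a + z \<and> Poly_Mapping.keys z \<subseteq> Z" if "b \<in> Poly_Mapping.keys g" for b
    using g that by (auto simp: supported_def cone_def)
  have "f * monomial a = (\<Sum>b\<in>Poly_Mapping.keys g. Poly_Mapping.single b (Poly_Mapping.lookup g b))"
    unfolding f_def sum_distrib_right
    by (intro sum.cong refl) (auto simp: monomial_def mult_single add.commute dest!: b)
  also have "\<dots> = g" by (rule mpoly_eq_sum[symmetric])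
  finally have "g = f * monomial a" by (rule sym)
  moreover have "f \<in> subpoly Z"
  proof -
    have "Poly_Mapping.keys c \<subseteq> Z" if "c \<in> Poly_Mapping.keys f" for c
    proof -
      have "a + c \<in> Poly_Mapping.keys g" using \<open>g = f * monomial a\<close> that by (simp add: keys_mult_monomial)
      thus ?thesis using b by fastforce
    qed
    thus ?thesis by (simp add: subpoly_def)
  qed
  ultimately show "g \<in> {f * monomial a | f. f \<in> subpoly Z}" by blast
qed

text \<open>\<open>\<phi>\<close> identifies \<open>M\<close> with the polynomials supported in
  \<open>C\<close>; it will be the identity for \<open>I\<close> and the residue class map for
  \<open>S/I\<close>. The component in a Stanley space is obtained by \<open>keep\<close> on its
  cone, which gives existence and uniqueness at once.\<close>

lemma stanley_decomposition_cone_partition: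
  fixes M :: "('n::finite, 'k::field, 'm) mpoly_module" and \<phi> :: "('n, 'k) mpoly \<Rightarrow> 'm"
  assumes M: "abelian_monoid M" and bij: "bij_betw \<phi> (supported C) (carrier M)"
    and zero: "\<phi> 0 = \<zero>\<^bsub>M\<^esub>"
    and add: "\<And>f g. f \<in> supported C \<Longrightarrow> g \<in> supported C \<Longrightarrow> \<phi> (f + g) = \<phi> f \<oplus>\<^bsub>M\<^esub> \<phi> g"
    and smult: "\<And>f a. a \<in> C \<Longrightarrow> f * monomial a \<in> supported C \<Longrightarrow> f \<odot>\<^bsub>M\<^esub> \<phi> (monomial a) = \<phi> (f * monomial a)"
    and D: "cone_partition C D"
  shows "stanley_decomposition M (map (\<lambda>(a, Z). (\<phi> (monomial a), Z)) D)"
proof -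
  let ?D = "map (\<lambda>(a, Z). (\<phi> (monomial a), Z)) D"
  let ?c = "\<lambda>i. cone (fst (D ! i)) (snd (D ! i))"
  have C: "C = (\<Union>(a, Z)\<in>set D. cone a Z)" using D by (simp add: cone_partition_def)
  have cone_sub: "cone a Z \<subseteq> C" if "(a, Z) \<in> set D" for a Z
    using that unfolding C by blast
  have base: "a \<in> cone a Z" for a :: "'n \<Rightarrow>\<^sub>0 nat" and Z
    unfolding cone_def by (auto intro!: exI[of _ 0])
  have sub_mult: "f * monomial a \<in> supported C" if "(a, Z) \<in> set D" "f \<in> subpoly Z" for a Z f
    using cone_sub[OF that(1)] subpoly_mult_monomial[of a Z] that(2) by (fastforce simp: supported_def)
  have sp: "stanley_space M (?D ! i) = \<phi> ` supported (?c i)" if i: "i < length D" for i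
  proof -
    obtain a Z where aZ: "D ! i = (a, Z)" by fastforce
    hence mem: "(a, Z) \<in> set D" using i nth_mem by metis
    have "stanley_space M (?D ! i) = {f \<odot>\<^bsub>M\<^esub> \<phi> (monomial a) | f. f \<in> subpoly Z}"
      using i by (simp add: stanley_space_def aZ)
    also have "\<dots> = {\<phi> (f * monomial a) | f. f \<in> subpoly Z}"
      using smult[OF subsetD[OF cone_sub[OF mem] base] sub_mult[OF mem]] by force
    also have "\<dots> = \<phi> ` {f * monomial a | f. f \<in> subpoly Z}" by blast
    finally show ?thesis by (simp add: subpoly_mult_monomial aZ)
  qed
  have c_sub: "?c i \<subseteq> C" if "i < length D" for i
    using cone_sub nth_mem[OF that] by (metis prod.collapse)
  have sum: "(\<Oplus>\<^bsub>M\<^esub>i\<in>{..<length D}. \<phi> (g i)) = \<phi> (\<Sum>i<length D. g i)" "(\<Sum>i<length D. g i) \<in> supported C"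
    if "\<And>i. i < length D \<Longrightarrow> g i \<in> supported (?c i)" for g
  proof -
    have S: "f + h \<in> supported C" if "f \<in> supported C" "h \<in> supported C" for f h :: "('n, 'k) mpoly"
      using that keys_add[of f h] by (auto simp: supported_def)
    have "g i \<in> supported C" if "i \<in> {..<length D}" for i
      using that \<open>\<And>i. i < length D \<Longrightarrow> g i \<in> supported (?c i)\<close> c_sub by (fastforce simp: supported_def)
    note * = finsum_image[where \<phi> = \<phi> and S = "supported C" and g = g, OF M _ S _ zero add finite_lessThan this]
    show "(\<Oplus>\<^bsub>M\<^esub>i\<in>{..<length D}. \<phi> (g i)) = \<phi> (\<Sum>i<length D. g i)" "(\<Sum>i<length D. g i) \<in> supported C"
      using * bij by (auto simp: supported_def bij_betw_def)
  qed
  have keep_sum: "keep (?c i) (\<Sum>j<length D. g j) = g i"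
    if "\<And>i. i < length D \<Longrightarrow> g i \<in> supported (?c i)" "i < length D" for g i
  proof (rule poly_mapping_eqI)
    fix a
    have "Poly_Mapping.lookup (g j) a = 0" if "a \<in> ?c i" "j < length D" "j \<noteq> i" for j
      using D that \<open>\<And>i. i < length D \<Longrightarrow> g i \<in> supported (?c i)\<close>[of j] \<open>i < length D\<close>
      by (auto simp: cone_partition_def supported_def simp flip: not_in_keys_iff_lookup_eq_zero)
    hence "(\<Sum>j<length D. Poly_Mapping.lookup (g j) a) = (\<Sum>j\<in>{i}. Poly_Mapping.lookup (g j) a)" if "a \<in> ?c i"
      using that \<open>i < length D\<close> by (intro sum.mono_neutral_right) auto
    moreover have "Poly_Mapping.lookup (g i) a = 0" if "a \<notin> ?c i"
      using that \<open>\<And>i. i < length D \<Longrightarrow> g i \<in> supported (?c i)\<close>[of i] \<open>i < length D\<close>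
      by (auto simp: supported_def simp flip: not_in_keys_iff_lookup_eq_zero)
    ultimately show "Poly_Mapping.lookup (keep (?c i) (\<Sum>j<length D. g j)) a = Poly_Mapping.lookup (g i) a"
      by (auto simp: lookup_keep lookup_sum)
  qed
  have sum_keep: "(\<Sum>i<length D. keep (?c i) h) = h" if h: "h \<in> supported C" for h :: "('n, 'k) mpoly"
  proof (rule poly_mapping_eqI)
    fix a
    show "Poly_Mapping.lookup (\<Sum>i<length D. keep (?c i) h) a = Poly_Mapping.lookup h a"
    proof (cases "a \<in> C")
      case True
      then obtain i where i: "i < length D" "a \<in> ?c i" unfolding C by (force simp: in_set_conv_nth)
      hence "a \<notin> ?c j" if "j < length D" "j \<noteq> i" for j
        using D that by (auto simp: cone_partition_def)
      hence "(\<Sum>j<length D. Poly_Mapping.lookup (keep (?c j) h) a) = (\<Sum>j\<in>{i}. Poly_Mapping.lookup (keep (?c j) h) a)"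
        using i by (intro sum.mono_neutral_right) (auto simp: lookup_keep)
      thus ?thesis using i by (simp add: lookup_sum lookup_keep)
    next
      case False
      hence "Poly_Mapping.lookup h a = 0" using h by (auto simp: supported_def in_keys_iff)
      thus ?thesis by (auto simp: lookup_sum lookup_keep intro!: sum.neutral)
    qed
  qed
  show ?thesis
    unfolding stanley_decomposition_def
  proof (intro conjI)
    show "\<forall>(m, Z)\<in>set ?D. m \<in> carrier M"
    proof clarsimp
      fix a Z assume "(a, Z) \<in> set D"
      hence "monomial a \<in> (supported C :: ('n, 'k) mpoly set)"
        using cone_sub base[of a Z] by (auto simp: monomial_in_supported)
      thus "\<phi> (monomial a) \<in> carrier M" using bij by (auto simp: bij_betw_def)
    qed
  next
    show "\<forall>(m, Z)\<in>set ?D. \<forall>f\<in>subpoly Z. f \<odot>\<^bsub>M\<^esub> m = \<zero>\<^bsub>M\<^esub> \<longrightarrow> f = 0"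
    proof clarsimp
      fix a Z f assume aZ: "(a, Z) \<in> set D" and f: "f \<in> subpoly Z" "f \<odot>\<^bsub>M\<^esub> \<phi> (monomial a) = \<zero>\<^bsub>M\<^esub>"
      have "\<phi> (f * monomial a) = \<phi> 0"
        using f(2) smult[OF subsetD[OF cone_sub[OF aZ] base] sub_mult[OF aZ f(1)]] zero by simp
      moreover have "0 \<in> (supported C :: ('n, 'k) mpoly set)" by (simp add: supported_def)
      ultimately have "f * monomial a = 0"
        using bij sub_mult[OF aZ f(1)] by (auto simp: bij_betw_def dest: inj_onD)
      thus "f = 0" using keys_mult_monomial[of f a] by simp
    qed
  next
    show "\<forall>x\<in>carrier M. \<exists>!y. y \<in> (\<Pi>\<^sub>E i\<in>{..<length ?D}. stanley_space M (?D ! i)) \<and>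
        x = (\<Oplus>\<^bsub>M\<^esub>i\<in>{..<length ?D}. y i)"
    proof
      fix x assume "x \<in> carrier M"
      then obtain h where h: "h \<in> supported C" "x = \<phi> h" using bij by (auto simp: bij_betw_def)
      let ?y = "\<lambda>i\<in>{..<length D}. \<phi> (keep (?c i) h)"
      interpret abelian_monoid M by (rule M)
      have fin: "(\<Oplus>\<^bsub>M\<^esub>i\<in>{..<length D}. y i) = \<phi> (\<Sum>i<length D. g i)" "(\<Sum>i<length D. g i) \<in> supported C"
        if y: "\<And>i. i < length D \<Longrightarrow> y i = \<phi> (g i)" and g: "\<And>i. i < length D \<Longrightarrow> g i \<in> supported (?c i)" for y g
      proof -
        have "g i \<in> supported C" if "i < length D" for i
          using g[OF that] c_sub[OF that] by (auto simp: supported_def)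
        hence "(\<Oplus>\<^bsub>M\<^esub>i\<in>{..<length D}. y i) = (\<Oplus>\<^bsub>M\<^esub>i\<in>{..<length D}. \<phi> (g i))"
          using y bij by (intro finsum_cong') (auto simp: bij_betw_def)
        thus "(\<Oplus>\<^bsub>M\<^esub>i\<in>{..<length D}. y i) = \<phi> (\<Sum>i<length D. g i)" using sum(1)[OF g] by simp
        show "(\<Sum>i<length D. g i) \<in> supported C" using sum(2)[OF g] .
      qed
      show "\<exists>!y. y \<in> (\<Pi>\<^sub>E i\<in>{..<length ?D}. stanley_space M (?D ! i)) \<and>
        x = (\<Oplus>\<^bsub>M\<^esub>i\<in>{..<length ?D}. y i)"
      proof (rule ex1I[of _ ?y], intro conjI)
        show "?y \<in> (\<Pi>\<^sub>E i\<in>{..<length ?D}. stanley_space M (?D ! i))"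
          by (auto simp del: nth_map simp: sp intro!: imageI keep_supported)
        have "(\<Oplus>\<^bsub>M\<^esub>i\<in>{..<length D}. ?y i) = \<phi> (\<Sum>i<length D. keep (?c i) h)"
          by (rule fin(1)) (simp_all add: keep_supported)
        thus "x = (\<Oplus>\<^bsub>M\<^esub>i\<in>{..<length ?D}. ?y i)"
          by (simp only: length_map sum_keep[OF h(1)] h(2))
      next
        fix y assume y: "y \<in> (\<Pi>\<^sub>E i\<in>{..<length ?D}. stanley_space M (?D ! i)) \<and>
          x = (\<Oplus>\<^bsub>M\<^esub>i\<in>{..<length ?D}. y i)"
        hence "\<forall>i<length D. \<exists>g. g \<in> supported (?c i) \<and> y i = \<phi> g"
          using sp by (auto simp del: nth_map simp: PiE_iff image_iff)
        then obtain g where g: "\<And>i. i < length D \<Longrightarrow> g i \<in> supported (?c i) \<and> y i = \<phi> (g i)" by metis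
        hence "\<phi> h = \<phi> (\<Sum>i<length D. g i)" "(\<Sum>i<length D. g i) \<in> supported C"
          using fin[of y g] y h by auto
        hence "h = (\<Sum>i<length D. g i)" using bij h(1) by (auto simp: bij_betw_def dest: inj_onD)
        hence "y i = ?y i" if "i < length D" for i
          using keep_sum[of g i] g that by simp
        thus "y = ?y" using y by (intro extensionalityI[of _ "{..<length D}"]) (auto simp: PiE_iff)
      qed
    qed
  qed
qed

text \<open>A nonzero element rules out the empty decomposition. Hence every \<open>Min\<close> is
  the size of an actual set of variables, at most \<open>n\<close>, and the \<open>Max\<close> is
  over a finite set.\<close>

lemma sdepth_ge:
  fixes M :: "('n::finite, 'k::field, 'm) mpoly_module"
  assumes M: "abelian_monoid M" and x: "x \<in> carrier M" "x \<noteq> \<zero>\<^bsub>M\<^esub>"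
    and D: "stanley_decomposition M D" "\<And>m Z. (m, Z) \<in> set D \<Longrightarrow> c \<le> card Z"
  shows "c \<le> sdepth M"
proof -
  interpret abelian_monoid M by (rule M)
  have ne: "{card Z | m Z. (m, Z) \<in> set E} \<noteq> {}" "finite {card Z | m Z. (m, Z) \<in> set E}"
    "sdepth_decomposition E \<in> {card Z | m Z. (m, Z) \<in> set E}"
    if E: "stanley_decomposition M E" for E
  proof -
    have "E \<noteq> []"
    proof
      assume "E = []"
      hence "x = \<zero>\<^bsub>M\<^esub>" using E x(1) by (auto simp: stanley_decomposition_def)
      thus False using x(2) by simp
    qed
    then obtain m Z where "(m, Z) \<in> set E" by (cases E) auto
    thus "{card Z | m Z. (m, Z) \<in> set E} \<noteq> {}" by blast
    have "{card Z | m Z. (m, Z) \<in> set E} = (\<lambda>(m, Z). card Z) ` set E" by force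
    thus "finite {card Z | m Z. (m, Z) \<in> set E}" by simp
    with \<open>{card Z | m Z. (m, Z) \<in> set E} \<noteq> {}\<close>
    show "sdepth_decomposition E \<in> {card Z | m Z. (m, Z) \<in> set E}"
      unfolding sdepth_decomposition_def by (intro Min_in)
  qed
  have "c \<le> sdepth_decomposition D" using ne(3)[OF D(1)] D(2) by auto
  also have "\<dots> \<le> sdepth M"
    unfolding sdepth_def
  proof (rule Max_ge)
    have "sdepth_decomposition E \<le> CARD('n)" if "stanley_decomposition M E" for E
      using ne(3)[OF that] card_mono[of "UNIV :: 'n set"] by auto
    hence "{sdepth_decomposition D | D. stanley_decomposition M D} \<subseteq> {..CARD('n)}" by blast
    thus "finite {sdepth_decomposition D | D. stanley_decomposition M D}"
      using finite_subset by blast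
  qed (use D(1) in blast)
  finally show ?thesis .
qed

lemma sdepth_ge_of_conic:
  fixes M :: "('n::finite, 'k::field, 'm) mpoly_module" and \<phi> :: "('n, 'k) mpoly \<Rightarrow> 'm"
  assumes M: "abelian_monoid M" and "bij_betw \<phi> (supported C) (carrier M)"
    and "\<phi> 0 = \<zero>\<^bsub>M\<^esub>"
    and "\<And>f g. f \<in> supported C \<Longrightarrow> g \<in> supported C \<Longrightarrow> \<phi> (f + g) = \<phi> f \<oplus>\<^bsub>M\<^esub> \<phi> g"
    and "\<And>f a. a \<in> C \<Longrightarrow> f * monomial a \<in> supported C \<Longrightarrow> f \<odot>\<^bsub>M\<^esub> \<phi> (monomial a) = \<phi> (f * monomial a)"
    and x: "x \<in> carrier M" "x \<noteq> \<zero>\<^bsub>M\<^esub>" and c: "conic c C"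
  shows "CARD('n) - c \<le> sdepth M"
proof -
  obtain D where D: "cone_partition C D" "\<And>a Z. (a, Z) \<in> set D \<Longrightarrow> card (- Z) \<le> c"
    using conic_cone_partition[OF c] by blast
  have "CARD('n) - c \<le> card Z" if "(a, Z) \<in> set D" for a Z
    using D(2)[OF that] by (simp add: Compl_eq_Diff_UNIV card_Diff_subset)
  thus ?thesis
    using stanley_decomposition_cone_partition[OF assms(1-5) D(1)]
    by (intro sdepth_ge[OF M x]) auto
qed

lemma sdepth_ideal_module_ge:
  assumes c: "conic c (part True UNIV G)" and "multiples G \<noteq> {}"
  shows "CARD('n) - c \<le> sdepth (ideal_module (supported (multiples G) :: ('n::finite, 'k::field) mpoly set))"
proof -
  obtain a where a: "a \<in> multiples G" using assms(2) by blast
  have nz: "monomial a \<noteq> (0 :: ('n, 'k) mpoly)"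
    by (simp add: monomial_def flip: keys_eq_empty)
  have "part True UNIV G = multiples G" by (auto simp: part_def)
  thus ?thesis
    using c a nz
    by (intro sdepth_ge_of_conic[where \<phi> = id and C = "multiples G" and x = "monomial a"]
          abelian_monoid_modules subspace_multiples)
      (auto simp: monomial_in_supported)
qed

lemma sdepth_quot_module_ge:
  assumes c: "conic c (part False UNIV G)" and "0 \<notin> multiples G"
  shows "CARD('n) - c \<le> sdepth (quot_module (supported (multiples G) :: ('n::finite, 'k::field) mpoly set))"
proof -
  let ?I = "supported (multiples G) :: ('n, 'k) mpoly set"
  note I = subspace_multiples[of G, where ?'b = 'k]
  note simps = quot_module_simps[OF I] coset_eq_iff[OF I]
  have C: "part False UNIV G = - multiples G" by (auto simp: part_def)
  have "bij_betw (coset ?I) (supported (- multiples G)) (carrier (quot_module ?I))"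
  proof (rule bij_betw_imageI)
    show "inj_on (coset ?I) (supported (- multiples G))"
    proof (rule inj_onI)
      fix f g :: "('n, 'k) mpoly"
      assume "f \<in> supported (- multiples G)" "g \<in> supported (- multiples G)" "coset ?I f = coset ?I g"
      moreover from this have "f - g \<in> ?I" by (simp add: coset_eq_iff[OF I])
      ultimately have "Poly_Mapping.keys (f - g) \<subseteq> - multiples G" "Poly_Mapping.keys (f - g) \<subseteq> multiples G"
        using keys_diff[of f g] by (auto simp: supported_def)
      hence "Poly_Mapping.keys (f - g) = {}" by blast
      thus "f = g" by simp
    qed
    have *: "coset ?I f = coset ?I (keep (- multiples G) f)" for f
      using keep_split[of f "multiples G"] keep_supported[of "multiples G" f]
      by (simp add: simps) (metis add_diff_cancel_right')
    show "coset ?I ` supported (- multiples G) = carrier (quot_module ?I)"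
      unfolding quot_module_simps(1)[OF I]
    proof (rule subset_antisym)
      show "range (coset ?I) \<subseteq> coset ?I ` supported (- multiples G)"
        by (rule image_subsetI) (subst *, intro imageI keep_supported)
    qed blast
  qed
  moreover have "coset ?I 1 \<noteq> \<zero>\<^bsub>quot_module ?I\<^esub>"
    using assms(2) by (simp add: simps) (simp add: supported_def)
  ultimately show ?thesis
    using c unfolding C
    by (intro sdepth_ge_of_conic[where \<phi> = "coset ?I" and C = "- multiples G" and x = "coset ?I 1"]
          abelian_monoid_modules I)
      (auto simp: simps)
qed

section \<open>Depth of \<open>I\<close> and \<open>S/I\<close>\<close>

lemma subspace_adjoin_list:
  "idl.subspace A \<Longrightarrow> idl.subspace B \<Longrightarrow> idl.subspace (adjoin_list A fs B)"
  by (induction fs arbitrary: B) (simp_all add: subspace_adjoin)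

lemma adjoin_list_superset: "idl.subspace A \<Longrightarrow> B \<subseteq> adjoin_list A fs B"
  by (induction fs arbitrary: B) (use adjoin_superset in fastforce)+

lemma adjoin_list_subset:
  assumes "idl.subspace J" "B \<subseteq> J" "set fs \<subseteq> J"
  shows "adjoin_list A fs B \<subseteq> J"
  using assms(2,3)
proof (induction fs arbitrary: B)
  case (Cons f fs)
  have "adjoin A f B \<subseteq> J"
    using Cons.prems assms(1) by (auto simp: adjoin_def intro!: idl.subspace_add ideal_mult(2))
  thus ?case using Cons by simp
qed simp

lemma adjoin_list_eq:
  "adjoin_list A fs B = {b + (\<Sum>i<length fs. fs ! i * y i) | b y. b \<in> B \<and> y \<in> {..<length fs} \<rightarrow> A}"
proof (induction fs arbitrary: B)
  case (Cons f fs)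
  show ?case
  proof (rule subset_antisym; rule subsetI)
    fix x assume "x \<in> adjoin_list A (f # fs) B"
    then obtain b y a where *: "b \<in> B" "a \<in> A" "y \<in> {..<length fs} \<rightarrow> A"
      "x = (b + f * a) + (\<Sum>i<length fs. fs ! i * y i)"
      by (auto simp: Cons adjoin_def)
    let ?y = "case_nat a y"
    have "x = b + (\<Sum>i<length (f # fs). (f # fs) ! i * ?y i)"
      using * by (simp del: sum.lessThan_Suc add: sum.lessThan_Suc_shift add.assoc)
    moreover have "?y \<in> {..<length (f # fs)} \<rightarrow> A" using * by (auto split: nat.split)
    ultimately show "x \<in> {b + (\<Sum>i<length (f # fs). (f # fs) ! i * y i) | b y. b \<in> B \<and> y \<in> {..<length (f # fs)} \<rightarrow> A}"
      using *(1) by blast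
  next
    fix x assume "x \<in> {b + (\<Sum>i<length (f # fs). (f # fs) ! i * y i) | b y. b \<in> B \<and> y \<in> {..<length (f # fs)} \<rightarrow> A}"
    then obtain b y where *: "b \<in> B" "y \<in> {..<length (f # fs)} \<rightarrow> A"
      "x = b + (\<Sum>i<length (f # fs). (f # fs) ! i * y i)" by blast
    have "x = (b + f * y 0) + (\<Sum>i<length fs. fs ! i * y (Suc i))"
      using * by (simp del: sum.lessThan_Suc add: sum.lessThan_Suc_shift add.assoc)
    moreover have "b + f * y 0 \<in> adjoin A f B" using * by (intro adjoinI) auto
    moreover have "(\<lambda>i. y (Suc i)) \<in> {..<length fs} \<rightarrow> A" using * by auto
    ultimately show "x \<in> adjoin_list A (f # fs) B"
      unfolding adjoin_list.simps Cons
      by (intro CollectI exI[of _ "b + f * y 0"] exI[of _ "\<lambda>i. y (Suc i)"] conjI)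
  qed
qed simp

lemma regular_list_iff:
  "regular_list A B fs \<longleftrightarrow> (\<forall>i<length fs. regular_on A (adjoin_list A (take i fs) B) (fs ! i))"
  by (induction fs arbitrary: B) (simp_all add: All_less_Suc2)

text \<open>Together with its analogue for the quotient, this translates module records into pairs:
  \<open>I\<close> is \<open>I/0\<close>, and \<open>S/I\<close> is \<open>UNIV/I\<close>.\<close>

lemma ideal_smult_ideal_module:
  fixes I :: "('n::finite, 'k::field) mpoly set"
  assumes I: "idl.subspace I"
  shows "ideal_smult fs (ideal_module I) = adjoin_list I fs {0}"
proof -
  have sum: "(\<Oplus>\<^bsub>ideal_module I\<^esub>i\<in>{..<length fs}. (fs ! i) \<odot>\<^bsub>ideal_module I\<^esub> y i) = (\<Sum>i<length fs. fs ! i * y i)"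
    if "y \<in> {..<length fs} \<rightarrow> I" for y
    using finsum_image(1)[where \<phi> = id and S = I and M = "ideal_module I" and F = "{..<length fs}" and g = "\<lambda>i. fs ! i * y i"]
      abelian_monoid_modules(2)[OF I] I that
    by (auto simp: idl.subspace_0 idl.subspace_add ideal_mult Pi_iff)
  show ?thesis
  proof (rule subset_antisym; rule subsetI)
    fix x assume "x \<in> ideal_smult fs (ideal_module I)"
    then obtain y where y: "y \<in> {..<length fs} \<rightarrow> I"
      "x = (\<Oplus>\<^bsub>ideal_module I\<^esub>i\<in>{..<length fs}. (fs ! i) \<odot>\<^bsub>ideal_module I\<^esub> y i)"
      unfolding ideal_smult_def ideal_module_simps by blast
    have "x = 0 + (\<Sum>i<length fs. fs ! i * y i)" using y(2) sum[OF y(1)] by simp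
    thus "x \<in> adjoin_list I fs {0}" unfolding adjoin_list_eq using y(1) by blast
  next
    fix x assume "x \<in> adjoin_list I fs {0}"
    then obtain y where y: "y \<in> {..<length fs} \<rightarrow> I" "x = (\<Sum>i<length fs. fs ! i * y i)"
      unfolding adjoin_list_eq by auto
    hence "x = (\<Oplus>\<^bsub>ideal_module I\<^esub>i\<in>{..<length fs}. (fs ! i) \<odot>\<^bsub>ideal_module I\<^esub> y i)"
      using sum by simp
    thus "x \<in> ideal_smult fs (ideal_module I)"
      unfolding ideal_smult_def using y(1) by auto
  qed
qed

lemma ideal_smult_quot_module:
  fixes I :: "('n::finite, 'k::field) mpoly set"
  assumes I: "idl.subspace I"
  shows "ideal_smult fs (quot_module I) = coset I ` adjoin_list UNIV fs I"
proof -
  note simps = quot_module_simps[OF I]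
  have sum: "(\<Oplus>\<^bsub>quot_module I\<^esub>i\<in>{..<length fs}. (fs ! i) \<odot>\<^bsub>quot_module I\<^esub> coset I (z i)) =
      coset I (\<Sum>i<length fs. fs ! i * z i)" for z
    using finsum_image(1)[where \<phi> = "coset I" and S = UNIV and M = "quot_module I" and F = "{..<length fs}" and g = "\<lambda>i. fs ! i * z i"]
      abelian_monoid_modules(1)[OF I] by (simp add: simps)
  have cong: "(\<Oplus>\<^bsub>quot_module I\<^esub>i\<in>{..<length fs}. (fs ! i) \<odot>\<^bsub>quot_module I\<^esub> y i) =
      (\<Oplus>\<^bsub>quot_module I\<^esub>i\<in>{..<length fs}. (fs ! i) \<odot>\<^bsub>quot_module I\<^esub> coset I (z i))"
    if "\<And>i. i < length fs \<Longrightarrow> y i = coset I (z i)" for y z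
  proof -
    interpret abelian_monoid "quot_module I" by (rule abelian_monoid_modules(1)[OF I])
    show ?thesis using that by (intro finsum_cong') (auto simp: simps)
  qed
  have shift: "coset I (b + f) = coset I f" if "b \<in> I" for b f
    using that by (simp add: coset_eq_iff[OF I])
  show ?thesis
  proof (rule subset_antisym; rule subsetI)
    fix X assume "X \<in> ideal_smult fs (quot_module I)"
    then obtain y where y: "y \<in> {..<length fs} \<rightarrow> range (coset I)"
      "X = (\<Oplus>\<^bsub>quot_module I\<^esub>i\<in>{..<length fs}. (fs ! i) \<odot>\<^bsub>quot_module I\<^esub> y i)"
      unfolding ideal_smult_def quot_module_simps(1)[OF I] by blast
    hence "\<forall>i<length fs. \<exists>z. y i = coset I z" by (auto simp: Pi_iff)
    then obtain z where z: "\<And>i. i < length fs \<Longrightarrow> y i = coset I (z i)" by metis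
    note y(2)
    also have "(\<Oplus>\<^bsub>quot_module I\<^esub>i\<in>{..<length fs}. (fs ! i) \<odot>\<^bsub>quot_module I\<^esub> y i) =
        (\<Oplus>\<^bsub>quot_module I\<^esub>i\<in>{..<length fs}. (fs ! i) \<odot>\<^bsub>quot_module I\<^esub> coset I (z i))"
      by (rule cong) (rule z)
    also note sum
    finally have "X = coset I (0 + (\<Sum>i<length fs. fs ! i * z i))" by simp
    moreover have "0 + (\<Sum>i<length fs. fs ! i * z i) \<in> adjoin_list UNIV fs I"
      unfolding adjoin_list_eq using idl.subspace_0[OF I] by blast
    ultimately show "X \<in> coset I ` adjoin_list UNIV fs I" by blast
  next
    fix X assume "X \<in> coset I ` adjoin_list UNIV fs I"
    then obtain b z where b: "b \<in> I" "X = coset I (b + (\<Sum>i<length fs. fs ! i * z i))"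
      unfolding adjoin_list_eq by blast
    hence "X = (\<Oplus>\<^bsub>quot_module I\<^esub>i\<in>{..<length fs}. (fs ! i) \<odot>\<^bsub>quot_module I\<^esub> coset I (z i))"
      by (simp only: shift sum)
    moreover have "(\<lambda>i. coset I (z i)) \<in> {..<length fs} \<rightarrow> range (coset I)" by simp
    ultimately show "X \<in> ideal_smult fs (quot_module I)"
      unfolding ideal_smult_def quot_module_simps(1)[OF I]
      by (intro CollectI exI[of _ "\<lambda>i. coset I (z i)"] conjI)
  qed
qed

lemma coset_mem_image_iff:
  assumes I: "idl.subspace I" and J: "idl.subspace J" "I \<subseteq> J"
  shows "coset I x \<in> coset I ` J \<longleftrightarrow> x \<in> J"
proof
  assume "coset I x \<in> coset I ` J"
  then obtain y where "y \<in> J" "x - y \<in> I" by (auto simp: coset_eq_iff[OF I])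
  hence "(x - y) + y \<in> J" using J by (intro idl.subspace_add) auto
  thus "x \<in> J" by simp
qed simp

lemma regular_sequence_ideal_module_iff:
  assumes "idl.subspace I"
  shows "regular_sequence (ideal_module I) fs \<longleftrightarrow> regular_list I {0} fs \<and> adjoin_list I fs {0} \<noteq> I"
  unfolding regular_sequence_def ideal_smult_ideal_module[OF assms] regular_list_iff regular_on_def
    ideal_module_simps ..

lemma regular_sequence_quot_module_iff:
  fixes I :: "('n::finite, 'k::field) mpoly set"
  assumes I: "idl.subspace I"
  shows "regular_sequence (quot_module I) fs \<longleftrightarrow> regular_list UNIV I fs \<and> adjoin_list UNIV fs I \<noteq> UNIV"
proof -
  have mem: "coset I x \<in> coset I ` adjoin_list UNIV gs I \<longleftrightarrow> x \<in> adjoin_list UNIV gs I" for x gs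
    by (intro coset_mem_image_iff I subspace_adjoin_list adjoin_list_superset idl.subspace_UNIV)
  have "coset I ` adjoin_list UNIV fs I = range (coset I) \<longleftrightarrow> adjoin_list UNIV fs I = UNIV"
  proof
    assume eq: "coset I ` adjoin_list UNIV fs I = range (coset I)"
    have "coset I x \<in> coset I ` adjoin_list UNIV fs I" for x unfolding eq by (rule rangeI)
    thus "adjoin_list UNIV fs I = UNIV" using mem by blast
  qed simp
  thus ?thesis
    unfolding regular_sequence_def ideal_smult_quot_module[OF I] regular_list_iff regular_on_def
    by (simp add: quot_module_simps[OF I] mem)
qed

lemma noetherian_ideal_touching:
  "noetherian_ideal (supported (touching V) :: ('n::finite, 'k::field) mpoly set)"
  by unfold_locales (rule subspace_touching, rule mpoly_noetherian)

lemma depth_ideal_module_le: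
  fixes I :: "('n::finite, 'k::field) mpoly set"
  assumes I: "idl.subspace I" and sub: "I \<subseteq> max_ideal" and "I \<noteq> {0}"
  shows "depth (ideal_module I) \<le> depth (quot_module I) + 1"
proof -
  let ?m = "max_ideal :: ('n, 'k) mpoly set"
  let ?L = "{length fs | fs. set fs \<subseteq> ?m \<and> regular_sequence (ideal_module I) fs}"
  let ?Q = "{length fs | fs. set fs \<subseteq> ?m \<and> regular_sequence (quot_module I) fs}"
  interpret noetherian_ideal ?m unfolding max_ideal_eq by (rule noetherian_ideal_touching)
  have "1 \<notin> ?m" unfolding max_ideal_eq using prime_touching by (auto simp: prime_set_def)
  \<comment> \<open>This makes both sets of lengths finite, so that \<open>Max\<close> can be
    used.\<close>
  have le_n: "length fs \<le> CARD('n)"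
    if *: "regular_list A B fs" "adjoin_list A fs B \<noteq> A" "idl.subspace A" "idl.subspace B" "B \<subseteq> A" for A B and fs :: "('n, 'k) mpoly list"
  proof -
    have "adjoin_list A fs B \<subseteq> A"
      using *(3,5) by (induction fs arbitrary: B) (simp_all add: adjoin_subset)
    then obtain v where "v \<in> A" "v \<notin> adjoin_list A fs B" using *(2) by blast
    thus ?thesis using * by (intro regular_list_length_le[of A B]) auto
  qed
  have L: "?L \<subseteq> {..CARD('n)}"
    using le_n[of I "{0}"] I idl.subspace_single_0 idl.subspace_0[OF I]
    by (auto simp: regular_sequence_ideal_module_iff[OF I])
  have "regular_sequence (ideal_module I) []"
    using \<open>I \<noteq> {0}\<close> by (auto simp: regular_sequence_ideal_module_iff[OF I])
  hence "?L \<noteq> {}" by (metis (mono_tags, lifting) empty_Collect_eq empty_set empty_subsetI)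
  hence "depth (ideal_module I) \<in> ?L"
    unfolding depth_def using finite_subset[OF L] by (intro Max_in) auto
  moreover from this have "depth (ideal_module I) \<le> CARD('n)" using L by blast
  ultimately have "depth (ideal_module I) \<in> ?L" "depth (ideal_module I) \<le> CARD('n)" .
  then obtain fs where "depth (ideal_module I) = length fs" "set fs \<subseteq> ?m"
    "regular_sequence (ideal_module I) fs" by blast
  hence fs: "length fs = depth (ideal_module I)" "set fs \<subseteq> ?m" "regular_list I {0} fs"
    by (simp_all add: regular_sequence_ideal_module_iff[OF I])
  have finQ: "finite ?Q"
  proof (rule finite_subset)
    show "?Q \<subseteq> {..CARD('n)}"
      using le_n[of UNIV I] I idl.subspace_UNIV
      by (auto simp: regular_sequence_quot_module_iff[OF I])
  qed simp
  show ?thesis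
  proof (cases "depth (ideal_module I) \<le> 1")
    case False
    \<comment> \<open>Depth at most 1 is trivial. Otherwise \<open>S\<close> also has grade at least
      the depth of \<open>I\<close>, which is at most \<open>n\<close>, and the comparison along
      \<open>0 -> I -> S -> S/I -> 0\<close> loses one.\<close>
    then obtain t where t: "depth (ideal_module I) = Suc (Suc t)"
      by (metis One_nat_def Suc_le_mono le0 not0_implies_Suc)
    have "grade_ge ?m I (Suc (Suc t)) {0}"
      unfolding grade_ge_iff_regular_list using fs t by auto
    moreover have "grade_ge ?m UNIV (Suc (Suc t)) {0}"
      unfolding max_ideal_eq using \<open>depth (ideal_module I) \<le> CARD('n)\<close> t by (intro grade_ge_mpoly) simp
    ultimately have "grade_ge ?m UNIV (Suc t) I"
      using I idl.subspace_0[OF I] by (intro grade_ge_quotient[of UNIV I "{0}"]) (auto simp: idl.subspace_single_0)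
    then obtain gs where gs: "length gs = Suc t" "set gs \<subseteq> ?m" "regular_list UNIV I gs"
      unfolding grade_ge_iff_regular_list by blast
    have "adjoin_list UNIV gs I \<subseteq> ?m" by (rule adjoin_list_subset[OF ideal_m sub gs(2)])
    hence "adjoin_list UNIV gs I \<noteq> UNIV" using \<open>1 \<notin> ?m\<close> by blast
    hence "Suc t \<in> ?Q" using gs by (force simp: regular_sequence_quot_module_iff[OF I])
    hence "Suc t \<le> depth (quot_module I)" unfolding depth_def using finQ by (rule Max_ge[rotated])
    thus ?thesis using t by simp
  qed simp
qed

text \<open>From \<open>\<lceil>y\<rceil> < y + 1\<close> one gets \<open>m < x + x/(k - 1)\<close>.
  Both numerical hypotheses have this shape, with \<open>x = s\<close> for the quotient and
  \<open>x = 2 s - 2\<close> for the ideal.\<close>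

lemma ceil_quot_bound:
  fixes x :: int
  assumes "2 \<le> k" "ereal (real m) \<le> ereal (of_int (x - 1)) + ceil_quot x (int k - 1)"
  shows "int ((k - 1) * m) < int k * x"
proof -
  have k: "real_of_int (int k - 1) > 0" using assms(1) by simp
  have "real m \<le> of_int (x - 1) + of_int \<lceil>real_of_int x / real_of_int (int k - 1)\<rceil>"
    using assms by (simp add: ceil_quot_def)
  also have "\<dots> < of_int x + real_of_int x / real_of_int (int k - 1)"
    using ceiling_correct[of "real_of_int x / real_of_int (int k - 1)"] by simp
  finally have "real m * real_of_int (int k - 1) < (of_int x + real_of_int x / real_of_int (int k - 1)) * real_of_int (int k - 1)"
    using k by (simp add: mult_strict_right_mono)
  also have "\<dots> = real_of_int (int k * x)" using k by (simp add: field_simps)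
  finally have "real_of_int (int m * (int k - 1)) < real_of_int (int k * x)" by simp
  hence "int m * (int k - 1) < int k * x" by (simp only: of_int_less_iff)
  thus ?thesis using assms(1) by (simp add: of_nat_diff mult.commute)
qed

lemma ceil_quot_minus_one: "ceil_quot a (- 1) = ereal (of_int (- a))"
  by (simp add: ceil_quot_def)

theorem theorem1p8:
  fixes I :: "('n::finite, 'k::field) mpoly set"
    and G :: "('n, 'k) mpoly set"
    and n m k :: nat and s :: int
  assumes n: "n = CARD('n)"
    and "monomial_ideal I" and "I \<noteq> carrier \<S>"
    and "minimal_monomial_generators I G" and "m = card G"
    and "k = Max {num_vars P | P. P \<in> associated_primes (quot_module I)}"
    and "s \<ge> int k"
  shows "(ereal (real m) \<le> ereal (of_int (s - 1)) + ceil_quot s (int k - 1) \<longrightarrow>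
           int (sdepth (quot_module I)) \<ge> int n - s) \<and>
         (ereal (real m) \<le> ereal (of_int (2 * s - 3)) + ceil_quot (2 * s - 2) (int k - 1) \<longrightarrow>
           int (sdepth (ideal_module I)) \<ge> int n - s + 1) \<and>
         (int (depth (quot_module I)) = int n - s \<longrightarrow>
           (ereal (real m) \<le> ereal (of_int (s - 1)) + ceil_quot s (int k - 1) \<longrightarrow>
             depth (quot_module I) \<le> sdepth (quot_module I)) \<and>
           (ereal (real m) \<le> ereal (of_int (2 * s - 3)) + ceil_quot (2 * s - 2) (int k - 1) \<longrightarrow>
             depth (ideal_module I) \<le> sdepth (ideal_module I)))"
proof -
  obtain E where I: "I = supported (multiples E)" and E: "length E = m"
    using minimal_monomial_generators_list assms(4,5) by metis
  have zero: "0 \<notin> multiples E"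
  proof
    assume "0 \<in> multiples E"
    hence "a \<in> multiples E" for a using multiples_add[of 0 E a] by simp
    hence "I = UNIV" by (auto simp: I supported_def)
    thus False using assms(3) by simp
  qed
  have sI: "idl.subspace I" unfolding I by (rule subspace_multiples)
  let ?A = "{num_vars P | P. P \<in> associated_primes (quot_module I)}"
  have "?A \<subseteq> {..CARD('n)}"
    using card_mono[of "UNIV :: 'n set"] by (auto simp: num_vars_def)
  hence finA: "finite ?A" using finite_subset by blast
  have A: "card V \<in> ?A" if "colon_support E u V" for u V
    using associated_prime_of_colon_support[OF that, where ?'k = 'k] num_vars_touching[of V, where ?'k = 'k]
    unfolding I by (metis (mono_tags, lifting) mem_Collect_eq)
  have V: "card V \<le> k" if "colon_support E u V" for u V
    unfolding assms(6) using finA A[OF that] by (rule Max_ge)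
  show ?thesis
  proof (cases "E = []")
    case True
    hence "I = {0}" by (simp add: I multiples_def supported_empty)
    have "num_vars P = 0" if "P \<in> associated_primes (quot_module I)" for P
      using that unfolding \<open>I = {0}\<close> by (rule num_vars_zero_of_zero_ideal)
    hence "?A \<subseteq> {0}" by auto
    moreover have "?A \<noteq> {}" using ex_colon_support[OF zero] A by blast
    ultimately have "?A = {0}" by (meson subset_singletonD)
    hence "k = 0" using assms(6) by simp
    moreover have "m = 0" using E True by simp
    \<comment> \<open>For the zero ideal both bounds equal \<open>-1\<close>, namely
      \<open>(s - 1) - s\<close> and \<open>(2 s - 3) - (2 s - 2)\<close>, while
      \<open>m = 0\<close>; so neither hypothesis holds.\<close>
    ultimately show ?thesis by (simp add: ceil_quot_minus_one)
  next
    case False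
    hence hd: "hd E \<in> multiples E"
      unfolding multiples_def using hd_in_set exp_dvd_refl by blast
    obtain u W where W: "colon_support E u W" using ex_colon_support[OF zero] by blast
    have "W \<noteq> {}" using ex_frequent_variable[OF W V[OF W] False] by blast
    hence k: "1 \<le> k" using V[OF W] card_gt_0_iff[of W] by simp
    have 1: "int n - s \<le> int (sdepth (quot_module I))"
      if hyp: "ereal (real m) \<le> ereal (of_int (s - 1)) + ceil_quot s (int k - 1)"
    proof -
      have *: "int ((k - 1) * m) < int k * s"
      \<comment> \<open>For \<open>k = 1\<close> the ceiling is infinite and the hypothesis says
        nothing, but then the left side is 0 and \<open>s \<ge> k\<close> suffices.\<close>
      proof (cases "k = 1")
        case True
        thus ?thesis using assms(7) by simp
      qed (use k hyp ceil_quot_bound in auto)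
      have "conic (nat s) (part False UNIV E)"
      proof (rule conic_of_colon_supports[OF V])
        fix m' assume "k * m' \<le> (k - 1) * length E"
        hence "int k * int m' \<le> int ((k - 1) * m)" by (metis E of_nat_le_iff of_nat_mult)
        hence "int k * int m' < int k * s" using * by linarith
        hence "int m' < s" using k by simp
        thus "m' = 0 \<and> False \<or> Suc (if False then m' div 2 else m') \<le> nat s" by simp
      qed
      from sdepth_quot_module_ge[OF this zero, where ?'k = 'k]
      show ?thesis using n I assms(7) by simp
    qed
    have 2: "int n - s + 1 \<le> int (sdepth (ideal_module I))"
      if hyp: "ereal (real m) \<le> ereal (of_int (2 * s - 3)) + ceil_quot (2 * s - 2) (int k - 1)"
    proof -
      have "conic (nat (s - 1)) (part True UNIV E)"
      proof (rule conic_of_colon_supports[OF V])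
        fix m' assume m': "k * m' \<le> (k - 1) * length E"
        show "m' = 0 \<and> True \<or> Suc (if True then m' div 2 else m') \<le> nat (s - 1)"
        \<comment> \<open>For \<open>k = 1\<close> no generator is free of the chosen variable. The
          alternative \<open>m' = 0\<close> is essential here, as \<open>s - 1\<close> may be
          0.\<close>
        proof (cases "k = 1")
          case True
          thus ?thesis using m' by simp
        next
          case False
          have "int k * int m' \<le> int ((k - 1) * m)" by (metis m' E of_nat_le_iff of_nat_mult)
          also have "int ((k - 1) * m) < int k * (2 * s - 2)"
            using k False hyp by (intro ceil_quot_bound) (simp_all add: algebra_simps)
          finally have "int m' < 2 * s - 2" using k by simp
          hence "m' div 2 < nat (s - 1)" by (intro less_mult_imp_div_less) linarith
          thus ?thesis by simp
        qed
      qed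
      moreover have "multiples E \<noteq> {}" using hd by blast
      ultimately have "CARD('n) - nat (s - 1) \<le> sdepth (ideal_module I)"
        unfolding I by (rule sdepth_ideal_module_ge)
      thus ?thesis using n k assms(7) by simp
    qed
    have "I \<noteq> {0}"
    proof -
      have "monomial (hd E) \<in> I" using hd by (simp add: I monomial_in_supported)
      moreover have "monomial (hd E) \<noteq> (0 :: ('n, 'k) mpoly)" by (simp add: monomial_def flip: keys_eq_empty)
      ultimately show ?thesis by blast
    qed
    moreover have "I \<subseteq> max_ideal"
    proof -
      have "a \<in> touching UNIV" if "a \<in> multiples E" for a
      proof -
        have "a \<noteq> 0" using that zero by blast
        hence "\<exists>i. Poly_Mapping.lookup a i \<noteq> 0" by (metis lookup_zero poly_mapping_eqI)
        thus ?thesis by (simp add: touching_def)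
      qed
      thus ?thesis by (auto simp: I max_ideal_eq supported_def)
    qed
    ultimately have "depth (ideal_module I) \<le> depth (quot_module I) + 1"
      using depth_ideal_module_le[OF sI] by blast
    \<comment> \<open>If \<open>S/I\<close> has depth \<open>n - s\<close>, then \<open>I\<close>
      has depth at most \<open>n - s + 1\<close>, the lower bound for its Stanley depth.\<close>
    thus ?thesis using 1 2 by auto
  qed
qed

end
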